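(* Let $k\geq 1$. Then a locally disconnected parapolar space $\Omega$ of symplectic rank at least $3$ is $k$-lacunary if and only if it is a buttoned parapolar space over the family $\mathcal C_k$ of all polar spaces of rank at least $\max\{3,k+1\}$ and locally connected $k$-lacunary parapolar spaces of symplectic rank at least $3$.
   Context: A point-line geometry $\Omega=(X,\mathcal L)$ is a set $X$ of points with a set $\mathcal L$ of subsets of $X$ (lines), each of size at least 2, covering $X$. Distinct points on a common line are called collinear ($x\perp y$); $x^\perp$ is the set of points equal or collinear to $x$. A subspace is a set of points containing every line joining two of its collinear points; it is singular if its points are pairwise collinear. Distance $\delta$ is taken in the collinearity graph; points in different components (or different geometries) have distance $\infty$. A subspace is convex if it contains all points of all shortest paths between its points; the convex closure of a set is the intersection of all convex subspaces containing it. Polar space: a point-line geometry such that every line has at least three points; no point is collinear to all other points; every nested sequence of singular subspaces is finite; for every point $x$ and line $L$, either one or all points of $L$ are collinear to $x$. Its rank is the integer $r\ge2$ such that its maximal singular subspaces (projective spaces) have dimension $r-1$; only finite rank is considered. Parapolar space: a point-line geometry $\Omega$ such that (PPS1) $\Omega$ is connected; for each line $L$ and point $p\notin L$, $p$ is collinear to none, one or all points of $L$; and some pair $(p,L)$ has $p$ collinear to no point of $L$; (PPS2) for non-collinear points $p,q$ with $p^\perp\cap q^\perp\neq\emptyset$, either the convex closure of $\{p,q\}$ is a polar space (called a symplecton or symp), or $p^\perp\cap q^\perp$ is a single point; (PPS3) every line is contained in a symp. Symplectic rank at least $d$: all symps have rank at least $d$. Locally connected: for every point $p$, any two lines through $p$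 are contained in a finite sequence of singular planes consecutively intersecting in lines through $p$; locally disconnected means not locally connected. $k$-lacunary: every symp has rank at least $k+1$, and no two symps intersect in precisely a $k$-dimensional singular subspace. Buttoning. Let $\mathcal F=\{\Omega_i=(X_i,\mathcal L_i): i\in I\}$ be a family of disjoint locally connected polar or parapolar spaces (of symplectic rank at least $2$), $I\neq\emptyset$, and $\mathcal R$ an equivalence relation on $\widetilde X=\bigcup_i X_i$ such that: (C1) if $\widetilde p,\widetilde q,\widetilde r,\widetilde s$ are not necessarily distinct $\mathcal R$-classes with $\widetilde p\notin\{\widetilde q,\widetilde r,\widetilde s\}$, $p_1\ne p_2$ are in $\widetilde p$, and $q_1,q_2\in\widetilde q$, $r_1,r_2\in\widetilde r$, $s_1,s_2\in\widetilde s$, then $\delta(p_2,q_1)+\delta(q_2,r_1)+\delta(r_2,s_1)+\delta(s_2,p_1)\ge5$; (C2) the graph on $\mathcal F$, with $\Omega_i,\Omega_j$ adjacent if some point of $\Omega_i$ is in the same class as some point of $\Omega_j$, is connected. Then $\Omega(\mathcal F,\mathcal R)$ is the point-line geometry with point set $\widetilde X/\mathcal R$ and lines $\{\widetilde p: p\in L\}$ for $L\in\mathcal L_i$, $i\in I$ ($\widetilde p$ being the class of $p$). If $\mathcal R$ is non-trivial it is called a buttoned geometry with sheet space $\mathcal F$; it is buttoned over a class $\mathcal C$ if every member of $\mathcal F$ is in $\mathcal C$ (members of $\mathcal C$ may occur multiple times in $\mathcal F$). *)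

theory Defs
  imports Main "HOL-Library.Extended_Nat"
begin

section \<open>Point-line geometries\<close>

record 'a geometry =
  points :: "'a set"
  lines :: "'a set set"

definition point_line_geometry :: "'a geometry \<Rightarrow> bool" where
  "point_line_geometry G \<longleftrightarrow>
     (\<forall>L\<in>lines G. L \<subseteq> points G \<and> (\<exists>x\<in>L. \<exists>y\<in>L. x \<noteq> y)) \<and>
     \<Union>(lines G) = points G"

definition geometry_isomorphic :: "'a geometry \<Rightarrow> 'b geometry \<Rightarrow> bool" where
  "geometry_isomorphic G H \<longleftrightarrow>
     (\<exists>f. bij_betw f (points G) (points H) \<and> (\<lambda>L. f ` L) ` lines G = lines H)"

definition collinear :: "'a geometry \<Rightarrow> 'a \<Rightarrow> 'a \<Rightarrow> bool" where
  "collinear G x y \<longleftrightarrow> x \<noteq> y \<and> (\<exists>L\<in>lines G. x \<in> L \<and> y \<in> L)"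

definition perp :: "'a geometry \<Rightarrow> 'a \<Rightarrow> 'a set" where
  "perp G x = {y \<in> points G. y = x \<or> collinear G x y}"

definition is_subspace :: "'a geometry \<Rightarrow> 'a set \<Rightarrow> bool" where
  "is_subspace G S \<longleftrightarrow>
     S \<subseteq> points G \<and>
     (\<forall>x\<in>S. \<forall>y\<in>S. x \<noteq> y \<longrightarrow> (\<forall>L\<in>lines G. x \<in> L \<and> y \<in> L \<longrightarrow> L \<subseteq> S))"

definition singular_subspace :: "'a geometry \<Rightarrow> 'a set \<Rightarrow> bool" where
  "singular_subspace G S \<longleftrightarrow>
     is_subspace G S \<and> (\<forall>x\<in>S. \<forall>y\<in>S. x \<noteq> y \<longrightarrow> collinear G x y)"

definition generated_subspace :: "'a geometry \<Rightarrow> 'a set \<Rightarrow> 'a set" where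
  "generated_subspace G A = \<Inter>{S. is_subspace G S \<and> A \<subseteq> S}"

text \<open>The dimension of a singular subspace is one less than the least size of a generating set;
  for a projective space this is the projective dimension (0 for points, 1 for lines,
  2 for planes). The empty subspace has no (natural number) dimension.\<close>

definition singular_dim :: "'a geometry \<Rightarrow> 'a set \<Rightarrow> nat \<Rightarrow> bool" where
  "singular_dim G U d \<longleftrightarrow>
     singular_subspace G U \<and>
     (\<exists>B. B \<subseteq> U \<and> finite B \<and> card B = d + 1 \<and> generated_subspace G B = U) \<and>
     (\<forall>B. B \<subseteq> U \<and> finite B \<and> generated_subspace G B = U \<longrightarrow> d + 1 \<le> card B)"

text \<open>Meant for a subspace \<open>S\<close> of \<open>G\<close>.\<close>

definition induced_geometry :: "'a geometry \<Rightarrow> 'a set \<Rightarrow> 'a geometry" where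
  "induced_geometry G S = \<lparr>points = S, lines = {L \<in> lines G. L \<subseteq> S}\<rparr>"


section \<open>Distance and convexity\<close>

definition is_path :: "'a geometry \<Rightarrow> 'a \<Rightarrow> 'a list \<Rightarrow> 'a \<Rightarrow> bool" where
  "is_path G x xs y \<longleftrightarrow>
     xs \<noteq> [] \<and> hd xs = x \<and> last xs = y \<and> set xs \<subseteq> points G \<and> successively (collinear G) xs"

text \<open>The infimum of the empty set is \<open>\<infinity>\<close>, the distance between different components.\<close>

definition gdist :: "'a geometry \<Rightarrow> 'a \<Rightarrow> 'a \<Rightarrow> enat" where
  "gdist G x y = (INF xs\<in>{xs. is_path G x xs y}. enat (length xs - 1))"

definition shortest_path :: "'a geometry \<Rightarrow> 'a \<Rightarrow> 'a list \<Rightarrow> 'a \<Rightarrow> bool" where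
  "shortest_path G x xs y \<longleftrightarrow> is_path G x xs y \<and> enat (length xs - 1) = gdist G x y"

definition connected_geometry :: "'a geometry \<Rightarrow> bool" where
  "connected_geometry G \<longleftrightarrow> (\<forall>x\<in>points G. \<forall>y\<in>points G. \<exists>xs. is_path G x xs y)"

definition convex_subspace :: "'a geometry \<Rightarrow> 'a set \<Rightarrow> bool" where
  "convex_subspace G S \<longleftrightarrow>
     is_subspace G S \<and>
     (\<forall>x\<in>S. \<forall>y\<in>S. \<forall>xs. shortest_path G x xs y \<longrightarrow> set xs \<subseteq> S)"

definition convex_closure :: "'a geometry \<Rightarrow> 'a set \<Rightarrow> 'a set" where
  "convex_closure G A = \<Inter>{S. convex_subspace G S \<and> A \<subseteq> S}"


section \<open>Polar spaces\<close>

text \<open>Nonemptiness only excludes the geometry without points and lines, to which no rank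
  \<open>\<ge> 2\<close> can be assigned. In the one-or-all axiom a point of \<open>L\<close> equal to \<open>x\<close> counts as
  collinear to \<open>x\<close>, so that the axiom is automatic for \<open>x \<in> L\<close>.\<close>

definition polar_space :: "'a geometry \<Rightarrow> bool" where
  "polar_space G \<longleftrightarrow>
     point_line_geometry G \<and> points G \<noteq> {} \<and>
     (\<forall>L\<in>lines G. \<exists>x\<in>L. \<exists>y\<in>L. \<exists>z\<in>L. x \<noteq> y \<and> x \<noteq> z \<and> y \<noteq> z) \<and>
     \<not> (\<exists>x\<in>points G. \<forall>y\<in>points G. y \<noteq> x \<longrightarrow> collinear G x y) \<and>
     (\<forall>C. subset.chain {S. singular_subspace G S} C \<longrightarrow> finite C) \<and>
     (\<forall>x\<in>points G. \<forall>L\<in>lines G. (\<exists>!y. y \<in> L \<and> y \<in> perp G x) \<or> L \<subseteq> perp G x)"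

definition maximal_singular_subspace :: "'a geometry \<Rightarrow> 'a set \<Rightarrow> bool" where
  "maximal_singular_subspace G M \<longleftrightarrow>
     singular_subspace G M \<and> (\<forall>S. singular_subspace G S \<and> M \<subseteq> S \<longrightarrow> S = M)"

definition polar_space_of_rank :: "'a geometry \<Rightarrow> nat \<Rightarrow> bool" where
  "polar_space_of_rank G r \<longleftrightarrow>
     polar_space G \<and> r \<ge> 2 \<and> (\<forall>M. maximal_singular_subspace G M \<longrightarrow> singular_dim G M (r - 1))"

definition polar_space_of_rank_at_least :: "'a geometry \<Rightarrow> nat \<Rightarrow> bool" where
  "polar_space_of_rank_at_least G d \<longleftrightarrow> (\<exists>r\<ge>d. polar_space_of_rank G r)"


section \<open>Parapolar spaces\<close>

definition symplecton :: "'a geometry \<Rightarrow> 'a set \<Rightarrow> bool" where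
  "symplecton G S \<longleftrightarrow>
     (\<exists>p\<in>points G. \<exists>q\<in>points G.
        p \<noteq> q \<and> \<not> collinear G p q \<and> perp G p \<inter> perp G q \<noteq> {} \<and>
        S = convex_closure G {p, q} \<and> polar_space (induced_geometry G S))"

definition parapolar_space :: "'a geometry \<Rightarrow> bool" where
  "parapolar_space G \<longleftrightarrow>
     point_line_geometry G \<and>
     connected_geometry G \<and>
     (\<forall>L\<in>lines G. \<forall>p\<in>points G - L.
        (\<forall>y\<in>L. \<not> collinear G p y) \<or> (\<exists>!y. y \<in> L \<and> collinear G p y) \<or> (\<forall>y\<in>L. collinear G p y)) \<and>
     (\<exists>L\<in>lines G. \<exists>p\<in>points G - L. \<forall>y\<in>L. \<not> collinear G p y) \<and>
     (\<forall>p\<in>points G. \<forall>q\<in>points G.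
        p \<noteq> q \<and> \<not> collinear G p q \<and> perp G p \<inter> perp G q \<noteq> {} \<longrightarrow>
        polar_space (induced_geometry G (convex_closure G {p, q})) \<or>
        (\<exists>x. perp G p \<inter> perp G q = {x})) \<and>
     (\<forall>L\<in>lines G. \<exists>S. symplecton G S \<and> L \<subseteq> S)"

text \<open>Also used for a polar space, whose only symplecton is the whole point set.\<close>

definition symplectic_rank_at_least :: "nat \<Rightarrow> 'a geometry \<Rightarrow> bool" where
  "symplectic_rank_at_least d G \<longleftrightarrow>
     (\<forall>S. symplecton G S \<longrightarrow> polar_space_of_rank_at_least (induced_geometry G S) d)"

definition singular_plane :: "'a geometry \<Rightarrow> 'a set \<Rightarrow> bool" where
  "singular_plane G P \<longleftrightarrow> singular_dim G P 2"

definition locally_connected :: "'a geometry \<Rightarrow> bool" where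
  "locally_connected G \<longleftrightarrow>
     (\<forall>p\<in>points G. \<forall>L\<in>lines G. \<forall>M\<in>lines G. p \<in> L \<and> p \<in> M \<and> L \<noteq> M \<longrightarrow>
        (\<exists>Ps. Ps \<noteq> [] \<and> (\<forall>P\<in>set Ps. singular_plane G P) \<and> L \<subseteq> hd Ps \<and> M \<subseteq> last Ps \<and>
              successively (\<lambda>P Q. P \<inter> Q \<in> lines G \<and> p \<in> P \<inter> Q) Ps))"

definition lacunary :: "nat \<Rightarrow> 'a geometry \<Rightarrow> bool" where
  "lacunary k G \<longleftrightarrow>
     symplectic_rank_at_least (k + 1) G \<and>
     \<not> (\<exists>S T. symplecton G S \<and> symplecton G T \<and> S \<noteq> T \<and> singular_dim G (S \<inter> T) k)"


section \<open>Buttoning\<close>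

text \<open>A family of pairwise disjoint polar or parapolar spaces is given as a set of geometries:
  its members are nonempty, so disjointness makes any indexing injective, and several copies of
  one space are represented by different isomorphic members.\<close>

definition disjoint_family_of_sheets :: "'b geometry set \<Rightarrow> bool" where
  "disjoint_family_of_sheets \<F> \<longleftrightarrow>
     \<F> \<noteq> {} \<and>
     (\<forall>G\<in>\<F>. (polar_space G \<or> parapolar_space G) \<and> locally_connected G \<and>
             symplectic_rank_at_least 2 G) \<and>
     (\<forall>G\<in>\<F>. \<forall>H\<in>\<F>. G \<noteq> H \<longrightarrow> points G \<inter> points H = {})"

text \<open>By disjointness, the distance in the union of the family is the distance in a member if
  both points belong to it, and \<open>\<infinity>\<close> for points of different members.\<close>

definition union_geometry :: "'b geometry set \<Rightarrow> 'b geometry" where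
  "union_geometry \<F> = \<lparr>points = (\<Union>G\<in>\<F>. points G), lines = (\<Union>G\<in>\<F>. lines G)\<rparr>"

definition button_C1 :: "'b geometry set \<Rightarrow> ('b \<times> 'b) set \<Rightarrow> bool" where
  "button_C1 \<F> R \<longleftrightarrow>
     (let X = points (union_geometry \<F>); \<delta> = gdist (union_geometry \<F>) in
      \<forall>P\<in>X // R. \<forall>Q\<in>X // R. \<forall>U\<in>X // R. \<forall>V\<in>X // R. P \<notin> {Q, U, V} \<longrightarrow>
        (\<forall>p1\<in>P. \<forall>p2\<in>P. \<forall>q1\<in>Q. \<forall>q2\<in>Q. \<forall>r1\<in>U. \<forall>r2\<in>U. \<forall>s1\<in>V. \<forall>s2\<in>V.
           p1 \<noteq> p2 \<longrightarrow> \<delta> p2 q1 + \<delta> q2 r1 + \<delta> r2 s1 + \<delta> s2 p1 \<ge> 5))"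

definition button_C2 :: "'b geometry set \<Rightarrow> ('b \<times> 'b) set \<Rightarrow> bool" where
  "button_C2 \<F> R \<longleftrightarrow>
     (\<forall>G\<in>\<F>. \<forall>H\<in>\<F>.
        (G, H) \<in> {(A, B). A \<in> \<F> \<and> B \<in> \<F> \<and> (\<exists>x\<in>points A. \<exists>y\<in>points B. (x, y) \<in> R)}\<^sup>*)"

definition buttoning :: "'b geometry set \<Rightarrow> ('b \<times> 'b) set \<Rightarrow> bool" where
  "buttoning \<F> R \<longleftrightarrow>
     disjoint_family_of_sheets \<F> \<and> equiv (points (union_geometry \<F>)) R \<and>
     button_C1 \<F> R \<and> button_C2 \<F> R"

definition buttoned_geometry :: "'b geometry set \<Rightarrow> ('b \<times> 'b) set \<Rightarrow> 'b set geometry" where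
  "buttoned_geometry \<F> R =
     \<lparr>points = points (union_geometry \<F>) // R,
      lines = {(\<lambda>p. R `` {p}) ` L | L. L \<in> lines (union_geometry \<F>)}\<rparr>"

text \<open>The sheets have points in the type \<open>'b\<close>, fixed by the class \<open>\<C>\<close>. For \<open>G\<close> with points in
  \<open>'a\<close>, the type \<open>'a \<times> 'a set set\<close> is large enough to represent every buttoning: by the first
  button condition, a point of a sheet is determined by its class together with a set of lines of
  \<open>G\<close> through that class.\<close>

definition buttoned_over :: "('b geometry \<Rightarrow> bool) \<Rightarrow> 'a geometry \<Rightarrow> bool" where
  "buttoned_over \<C> G \<longleftrightarrow>
     (\<exists>\<F> R. buttoning \<F> R \<and> (\<exists>x y. (x, y) \<in> R \<and> x \<noteq> y) \<and> (\<forall>H\<in>\<F>. \<C> H) \<and>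
            geometry_isomorphic G (buttoned_geometry \<F> R))"

definition lacunary_class :: "nat \<Rightarrow> 'b geometry \<Rightarrow> bool" where
  "lacunary_class k G \<longleftrightarrow>
     polar_space_of_rank_at_least G (max 3 (k + 1)) \<or>
     (parapolar_space G \<and> locally_connected G \<and> symplectic_rank_at_least 3 G \<and> lacunary k G)"

end

theory Submission
  imports Defs
begin

text \<open>Over a point \<open>p\<close> of \<open>\<Omega>\<close> put one new point for each local component of \<open>p\<close>, that is, for each class
  of lines through \<open>p\<close> linked by chains of lines spanning planes. A line then lifts uniquely, and the
  sheets are the connected components of the new geometry. Two lines through \<open>p\<close> in a common
  triangle, or in a common quadrangle, lie in the same local component (for a quadrangle with
  noncollinear diagonal points this uses a symp of rank at least 3), and this is precisely the
  first button condition.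

  Conversely, the first button condition, already restricted to closed walks of at most four
  collinear steps, makes every symp of the union of the sheets embed as a symp of the quotient and every
  symp of the quotient lift to a single sheet, such that two symps meeting in a line keep their
  intersection. Hence being \<open>k\<close>-lacunary is the same property for the union of the sheets and for the
  quotient. A sheet without a point far from a line is a single symp, that is, a polar space.\<close>

section \<open>Collinearity and subspaces\<close>

text \<open>Local connectedness is stated with singular planes meeting in lines, whereas
  collinearity only produces triangles. The bridge needs a theory of planes, and the polar axioms do
  not even say that two points lie on at most one line. Hence one-or-all and nondegeneracy are first
  made to yield that perps separate points, that joining lines are unique, and that the double perp
  of a line and a point is a plane with the exchange property. The geometric content of rank at
  least 3 is \<open>symp_line_extends\<close>: no line of a symp is a maximal singular subspace. It
  places every triangle in a symp and lets a quadrangle be filled by triangles. Shortest paths are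
  awkward to compare across the class map. Symps are therefore handled through the local notion
  \<open>symp\<close>, closure under common neighbours of noncollinear points. Transporting it
  involves closed walks of at most four steps, which is what the bound 5 in the button condition
  controls. The hypothesis \<open>k \<ge> 1\<close> makes a \<open>k\<close>-dimensional
  intersection of symps contain a line; its lift lies in both lifted symps and keeps them in one
  sheet.\<close>

definition adj :: "'a geometry \<Rightarrow> 'a \<Rightarrow> 'a \<Rightarrow> bool" where
  "adj G x y \<longleftrightarrow> x \<in> points G \<and> y \<in> points G \<and> (x = y \<or> collinear G x y)"

lemma collinear_sym: "collinear G x y \<Longrightarrow> collinear G y x"
  unfolding collinear_def by blast

lemma adj_sym: "adj G x y \<Longrightarrow> adj G y x"
  unfolding adj_def using collinear_sym[of G] by blast

lemma adj_refl: "x \<in> points G \<Longrightarrow> adj G x x"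
  unfolding adj_def by blast

lemma perp_iff_adj: "x \<in> points G \<Longrightarrow> y \<in> perp G x \<longleftrightarrow> adj G x y"
  unfolding perp_def adj_def by blast

lemma induced_simps [simp]:
  "points (induced_geometry G S) = S"
  "lines (induced_geometry G S) = {L \<in> lines G. L \<subseteq> S}"
  unfolding induced_geometry_def by simp_all

lemma induced_induced: "T \<subseteq> S \<Longrightarrow> induced_geometry (induced_geometry G S) T = induced_geometry G T"
  unfolding induced_geometry_def by auto

lemma subspace_line:
  "\<lbrakk>is_subspace G S; x \<in> S; y \<in> S; x \<noteq> y; L \<in> lines G; x \<in> L; y \<in> L\<rbrakk> \<Longrightarrow> L \<subseteq> S"
  unfolding is_subspace_def by blast

lemma subspace_points: "is_subspace G S \<Longrightarrow> S \<subseteq> points G"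
  unfolding is_subspace_def by blast

lemma collinear_induced:
  assumes "is_subspace G S"
  shows "collinear (induced_geometry G S) x y \<longleftrightarrow> x \<in> S \<and> y \<in> S \<and> collinear G x y"
  using subspace_line[OF assms] unfolding collinear_def by (simp, blast)

lemma adj_induced:
  assumes "is_subspace G S"
  shows "adj (induced_geometry G S) x y \<longleftrightarrow> x \<in> S \<and> y \<in> S \<and> adj G x y"
  using collinear_induced[OF assms] subspace_points[OF assms] unfolding adj_def by auto

lemma subspace_induced:
  assumes "is_subspace G S"
  shows "is_subspace (induced_geometry G S) W \<longleftrightarrow> W \<subseteq> S \<and> is_subspace G W"
proof
  assume W: "is_subspace (induced_geometry G S) W"
  then have "W \<subseteq> S" using subspace_points by fastforce
  moreover have "L \<subseteq> W" if "x \<in> W" "y \<in> W" "x \<noteq> y" "L \<in> lines G" "x \<in> L" "y \<in> L" for x y L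
    using subspace_line[OF assms, of x y L] subspace_line[OF W that(1-3) _ that(5,6)] that \<open>W \<subseteq> S\<close>
      by auto
  ultimately show "W \<subseteq> S \<and> is_subspace G W"
    using subspace_points[OF assms] unfolding is_subspace_def by blast
next
  assume "W \<subseteq> S \<and> is_subspace G W"
  then show "is_subspace (induced_geometry G S) W" unfolding is_subspace_def by simp
qed

lemma singular_subspace_induced:
  assumes "is_subspace G S"
  shows "singular_subspace (induced_geometry G S) W \<longleftrightarrow> W \<subseteq> S \<and> singular_subspace G W"
  unfolding singular_subspace_def subspace_induced[OF assms] collinear_induced[OF assms] by blast

lemma subspaceI:
  assumes "S \<subseteq> points G"
    and "\<And>x y L. \<lbrakk>x \<in> S; y \<in> S; x \<noteq> y; L \<in> lines G; x \<in> L; y \<in> L\<rbrakk> \<Longrightarrow> L \<subseteq> S"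
  shows "is_subspace G S"
  using assms unfolding is_subspace_def by simp

lemma subspace_Int:
  assumes "is_subspace G S" "is_subspace G T"
  shows "is_subspace G (S \<inter> T)"
proof (rule subspaceI)
  show "S \<inter> T \<subseteq> points G" using subspace_points[OF assms(1)] by blast
  show "L \<subseteq> S \<inter> T"
    if "x \<in> S \<inter> T" "y \<in> S \<inter> T" "x \<noteq> y" "L \<in> lines G" "x \<in> L" "y \<in> L" for x y L
    using subspace_line[OF assms(1) _ _ that(3-6)] subspace_line[OF assms(2) _ _ that(3-6)] that by simp
qed

lemma generated_induced:
  assumes "is_subspace G S" "A \<subseteq> S"
  shows "generated_subspace (induced_geometry G S) A = generated_subspace G A"
proof
  show "generated_subspace (induced_geometry G S) A \<subseteq> generated_subspace G A"
    unfolding generated_subspace_def subspace_induced[OF assms(1)]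
  proof (rule Inter_greatest)
    fix W assume "W \<in> {W. is_subspace G W \<and> A \<subseteq> W}"
    then have "S \<inter> W \<in> {W. (W \<subseteq> S \<and> is_subspace G W) \<and> A \<subseteq> W}"
      using assms subspace_Int by auto
    from Inter_lower[OF this] show "\<Inter>{W. (W \<subseteq> S \<and> is_subspace G W) \<and> A \<subseteq> W} \<subseteq> W"
      by (rule order_trans) simp
  qed
  show "generated_subspace G A \<subseteq> generated_subspace (induced_geometry G S) A"
    unfolding generated_subspace_def subspace_induced[OF assms(1)] by (rule Inter_anti_mono) blast
qed

lemma generated_least: "is_subspace G S \<Longrightarrow> A \<subseteq> S \<Longrightarrow> generated_subspace G A \<subseteq> S"
  unfolding generated_subspace_def by blast

lemma generated_superset: "A \<subseteq> generated_subspace G A"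
  unfolding generated_subspace_def by blast

lemma subspace_points_self: "point_line_geometry G \<Longrightarrow> is_subspace G (points G)"
  unfolding is_subspace_def point_line_geometry_def by blast

lemma generated_is_subspace:
  assumes "is_subspace G S" "A \<subseteq> S"
  shows "is_subspace G (generated_subspace G A)"
proof -
  have "L \<subseteq> generated_subspace G A"
    if "x \<in> generated_subspace G A" "y \<in> generated_subspace G A" "x \<noteq> y" "L \<in> lines G" "x \<in> L" "y \<in> L"
    for x y L
    unfolding generated_subspace_def
  proof (rule Inter_greatest)
    fix W assume W: "W \<in> {W. is_subspace G W \<and> A \<subseteq> W}"
    then have "generated_subspace G A \<subseteq> W" unfolding generated_subspace_def by (rule Inter_lower)
    then show "L \<subseteq> W" using subspace_line[of G W x y L] W that by auto
  qed
  then show ?thesis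
    using generated_least[OF assms] subspace_points[OF assms(1)] by (intro subspaceI) auto
qed

lemma singular_dim_induced:
  assumes "is_subspace G S" "U \<subseteq> S"
  shows "singular_dim (induced_geometry G S) U d \<longleftrightarrow> singular_dim G U d"
proof -
  have gen: "generated_subspace (induced_geometry G S) B = generated_subspace G B" if "B \<subseteq> U" for B
    using generated_induced[OF assms(1)] that assms(2) by blast
  show ?thesis
    unfolding singular_dim_def singular_subspace_induced[OF assms(1)] using assms(2)
    by (simp add: gen cong: conj_cong)
qed

section \<open>Nondegenerate one-or-all geometries\<close>

locale shult =
  fixes G :: "'a geometry"
  assumes line_points: "L \<in> lines G \<Longrightarrow> x \<in> L \<Longrightarrow> x \<in> points G"
    and line_two: "L \<in> lines G \<Longrightarrow> \<exists>x\<in>L. \<exists>y\<in>L. x \<noteq> y"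
    and line_one: "L \<in> lines G \<Longrightarrow> x \<in> points G \<Longrightarrow> \<exists>c\<in>L. adj G x c"
    and line_all: "\<lbrakk>L \<in> lines G; a \<in> L; b \<in> L; a \<noteq> b; adj G x a; adj G x b; c \<in> L\<rbrakk> \<Longrightarrow> adj G x c"
    and nondegenerate: "x \<in> points G \<Longrightarrow> \<exists>y\<in>points G. \<not> adj G x y"
begin

lemma join: "adj G x y \<Longrightarrow> x \<noteq> y \<Longrightarrow> \<exists>L\<in>lines G. x \<in> L \<and> y \<in> L"
  unfolding adj_def collinear_def by blast

lemma line_adj: "L \<in> lines G \<Longrightarrow> x \<in> L \<Longrightarrow> y \<in> L \<Longrightarrow> adj G x y"
  unfolding adj_def collinear_def using line_points by blast

lemma adj_points: "adj G x y \<Longrightarrow> x \<in> points G \<and> y \<in> points G"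
  unfolding adj_def by blast

lemma line_all': "\<lbrakk>L \<in> lines G; a \<in> L; b \<in> L; a \<noteq> b; adj G a x; adj G b x; c \<in> L\<rbrakk> \<Longrightarrow> adj G c x"
  by (rule adj_sym, rule line_all) (auto intro: adj_sym)

text \<open>On a line through \<open>x\<close> and \<open>y\<close> take the point \<open>u\<close>
  collinear to some \<open>z\<close> outside the perp of \<open>y\<close>. Neighbours of
  \<open>x\<close> are neighbours of \<open>y\<close>, hence of \<open>u\<close>. For
  \<open>t\<close> not collinear to \<open>u\<close>, join \<open>t\<close> to a point
  \<open>z'\<close> of the line \<open>zu\<close>; the point of this join collinear to
  \<open>x\<close> can only be \<open>z'\<close>. Then \<open>x\<close> is collinear to
  \<open>u\<close> and \<open>z'\<close>, hence to \<open>z\<close>, a contradiction.\<close>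

lemma perp_inclusion_eq:
  assumes "x \<in> points G" "y \<in> points G" "\<And>w. adj G x w \<Longrightarrow> adj G y w"
  shows "x = y"
proof (rule ccontr)
  assume "x \<noteq> y"
  have xy: "adj G x y" using assms adj_refl adj_sym by metis
  then obtain L where L: "L \<in> lines G" "x \<in> L" "y \<in> L" using join \<open>x \<noteq> y\<close> by blast
  obtain z where z: "z \<in> points G" "\<not> adj G y z" using nondegenerate assms by blast
  then have zx: "\<not> adj G x z" using assms by blast
  obtain u where u: "u \<in> L" "adj G z u" using line_one L z by blast
  have "u \<noteq> x" "u \<noteq> y" using u z zx adj_sym by metis+
  have xu: "adj G u v" if "adj G x v" for v
    using line_all'[OF L \<open>x \<noteq> y\<close> that assms(3)[OF that]] u by blast
  have "u \<in> points G" using u L line_points by blast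
  have "z \<noteq> u" using u L z zx line_adj by metis
  obtain N where N: "N \<in> lines G" "z \<in> N" "u \<in> N" using join u \<open>z \<noteq> u\<close> by metis
  obtain t where t: "t \<in> points G" "\<not> adj G u t" using nondegenerate \<open>u \<in> points G\<close> by blast
  obtain z' where z': "z' \<in> N" "adj G t z'" using line_one N t by blast
  have "z' \<noteq> u" using z' t adj_sym by metis
  have uz': "adj G u z'" using line_adj N z' by blast
  then have "z' \<noteq> t" using t by blast
  then obtain M where M: "M \<in> lines G" "t \<in> M" "z' \<in> M" using join z' by metis
  obtain s where s: "s \<in> M" "adj G x s" using line_one M assms by blast
  have us: "adj G u s" using xu s by blast
  have "s = z'" using line_all[OF M(1) s(1) M(3) _ us uz' M(2)] t by blast
  then have "adj G x z" using line_all[OF N(1) z'(1) N(3) \<open>z' \<noteq> u\<close> _ _ N(2)] s line_adj L u by metis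
  then show False using zx by blast
qed

text \<open>For \<open>z\<close> on \<open>M\<close> outside \<open>L\<close>, a common neighbour of
  \<open>x\<close> and \<open>z\<close> is collinear to \<open>y\<close> and hence to all of
  \<open>L\<close>. Some \<open>l\<close> on \<open>L\<close> turns out to be collinear to every
  neighbour of \<open>z\<close>, so that \<open>perp_inclusion_eq\<close> gives
  \<open>z = l\<close>.\<close>

lemma line_subset:
  assumes L: "L \<in> lines G" "x \<in> L" "y \<in> L" and M: "M \<in> lines G" "x \<in> M" "y \<in> M" and "x \<noteq> y"
  shows "M \<subseteq> L"
proof (rule subsetI, rule ccontr)
  fix z assume z: "z \<in> M" "z \<notin> L"
  have LM: "adj G w l" if "adj G x w" "adj G z w" "l \<in> L" for w l
  proof -
    have "adj G y w" using line_all'[OF M(1,2) z(1) _ that(1,2) M(3)] z L by metis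
    then show ?thesis using line_all'[OF L assms(7) that(1) _ that(3)] adj_sym by metis
  qed
  have zx: "z \<in> points G" "x \<in> points G" "z \<noteq> x" using line_points M L z by metis+
  then obtain e where e: "adj G z e" "\<not> adj G x e" using perp_inclusion_eq[of z x] by blast
  obtain l where l: "l \<in> L" "adj G e l" using line_one L e adj_points by metis
  have zL: "adj G z c" if "c \<in> L" for c
    using LM[OF _ _ that, of z] line_adj[OF M(1) M(2) z(1)] adj_refl zx(1) by metis
  \<comment> \<open>Away from the perp of \<open>x\<close>, collinearity to \<open>l\<close> spreads
    along lines within the perp of \<open>z\<close>: such a line has a point \<open>g\<close>
    collinear to \<open>x\<close>, and \<open>LM\<close> makes \<open>g\<close> collinear to
    \<open>l\<close>.\<close>
  have step: "adj G t l"
    if f: "adj G z t" "\<not> adj G x t" "adj G z f" "\<not> adj G x f" "adj G f l" "adj G t f"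
    for t f
  proof (cases "t = f")
    case False
    then obtain N where N: "N \<in> lines G" "t \<in> N" "f \<in> N" using join[OF f(6) False] by blast
    obtain g where g: "g \<in> N" "adj G x g" using line_one[OF N(1) zx(2)] by blast
    have "g \<noteq> f" using g f by blast
    have "adj G z g" using line_all[OF N(1,2,3) False f(1,3) g(1)] .
    then have "adj G g l" using LM[OF g(2)] l by blast
    then show ?thesis using line_all'[OF N(1) g(1) N(3) \<open>g \<noteq> f\<close> _ f(5) N(2)] by blast
  next
    case True
    then show ?thesis using f(5) by simp
  qed
  have "adj G l w" if w: "adj G z w" for w
  proof (cases "adj G x w")
    case True
    then show ?thesis using LM w l adj_sym by metis
  next
    case nx: False
    show ?thesis
    proof (rule ccontr)
      assume nl: "\<not> adj G l w"
      have "l \<noteq> e" using l L line_adj e by metis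
      then obtain N where N: "N \<in> lines G" "l \<in> N" "e \<in> N" using join l adj_sym by metis
      \<comment> \<open>The point \<open>h\<close> of the line \<open>le\<close> lies in the perp of
        \<open>z\<close> but not in that of \<open>x\<close>, so \<open>step\<close> carries
        collinearity to \<open>l\<close> from \<open>h\<close> to \<open>w\<close>.\<close>
      obtain h where h: "h \<in> N" "adj G w h" using line_one N w adj_points by metis
      have "h \<noteq> l" using h nl adj_sym by metis
      have "adj G z h" using line_all[OF N(1,2,3) \<open>l \<noteq> e\<close> _ e(1) h(1)] zL l by metis
      moreover have "\<not> adj G x h"
        using line_all[OF N(1) h(1) N(2) \<open>h \<noteq> l\<close> _ _ N(3)] e line_adj[OF L(1,2) l(1)] by blast
      moreover have "adj G h l" using line_adj N h by metis
      ultimately have "adj G w l" using step[OF w nx _ _ _ h(2)] by blast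
      then show False using nl adj_sym by metis
    qed
  qed
  then have "z = l" using perp_inclusion_eq[of z l] zx line_points L l by metis
  then show False using z l by blast
qed

lemma partial_linear:
  assumes "L \<in> lines G" "x \<in> L" "y \<in> L" "M \<in> lines G" "x \<in> M" "y \<in> M" "x \<noteq> y"
  shows "L = M"
  using line_subset[OF assms] line_subset[OF assms(4-6,1-3,7)] by blast

text \<open>Nondegeneracy of the geometry of common neighbours: since perps separate points, some
  neighbour \<open>w\<close> of \<open>p\<close> is not collinear to \<open>a\<close>, and the line
  \<open>pw\<close> contains a neighbour of \<open>q\<close>.\<close>

lemma common_neighbour:
  assumes "\<not> adj G p q" "adj G p a" "adj G q a"
  shows "\<exists>b. adj G p b \<and> adj G q b \<and> \<not> adj G a b"
proof -
  have "p \<noteq> a" using assms adj_sym by metis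
  then obtain w where w: "adj G p w" "\<not> adj G a w"
    using perp_inclusion_eq[of p a] adj_points assms by metis
  have "p \<noteq> w" using w assms adj_sym by metis
  then obtain N where N: "N \<in> lines G" "p \<in> N" "w \<in> N" using join w by metis
  obtain b where b: "b \<in> N" "adj G q b" using line_one N assms adj_points by metis
  have "p \<noteq> b" using b assms adj_sym by metis
  have "\<not> adj G a b" using line_all[OF N(1,2) b(1) \<open>p \<noteq> b\<close> _ _ N(3)] w assms adj_sym by metis
  then show ?thesis using b line_adj N by metis
qed

section \<open>The common neighbours of two noncollinear points, and planes as double perps\<close>

lemma common_subspace: "is_subspace G {x. adj G p x \<and> adj G q x}"
proof (rule subspaceI)
  show "L \<subseteq> {x. adj G p x \<and> adj G q x}"
    if "x \<in> {x. adj G p x \<and> adj G q x}" "y \<in> {x. adj G p x \<and> adj G q x}" "x \<noteq> y"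
      "L \<in> lines G" "x \<in> L" "y \<in> L" for x y L
    using line_all[OF that(4,5,6,3)] that(1,2) by auto
  show "{x. adj G p x \<and> adj G q x} \<subseteq> points G" using adj_points by blast
qed

lemma common_shult:
  assumes "\<not> adj G p q"
  shows "shult (induced_geometry G {x. adj G p x \<and> adj G q x})"
proof
  note A = common_subspace[of p q]
  show "adj (induced_geometry G {x. adj G p x \<and> adj G q x}) x c"
    if "L \<in> lines (induced_geometry G {x. adj G p x \<and> adj G q x})" "a \<in> L" "b \<in> L" "a \<noteq> b"
      "adj (induced_geometry G {x. adj G p x \<and> adj G q x}) x a"
      "adj (induced_geometry G {x. adj G p x \<and> adj G q x}) x b" "c \<in> L" for L a b x c
  proof -
    have L: "L \<in> lines G" "L \<subseteq> {x. adj G p x \<and> adj G q x}" using that(1) by simp_all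
    have x: "x \<in> {x. adj G p x \<and> adj G q x}" "adj G x a" "adj G x b"
      using that(5,6) unfolding adj_induced[OF A] by simp_all
    show ?thesis unfolding adj_induced[OF A]
      using line_all[OF L(1) that(2-4) x(2,3) that(7)] x(1) subsetD[OF L(2) that(7)] by simp
  qed
  show "\<exists>y\<in>points (induced_geometry G {x. adj G p x \<and> adj G q x}).
            \<not> adj (induced_geometry G {x. adj G p x \<and> adj G q x}) x y"
    if "x \<in> points (induced_geometry G {x. adj G p x \<and> adj G q x})" for x
    using common_neighbour[OF assms, of x] that unfolding adj_induced[OF A] by auto
  show "\<exists>c\<in>L. adj (induced_geometry G {x. adj G p x \<and> adj G q x}) x c"
    if "L \<in> lines (induced_geometry G {x. adj G p x \<and> adj G q x})"
      "x \<in> points (induced_geometry G {x. adj G p x \<and> adj G q x})" for L x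
  proof -
    have L: "L \<in> lines G" "L \<subseteq> {x. adj G p x \<and> adj G q x}" using that by simp_all
    have x: "x \<in> {x. adj G p x \<and> adj G q x}" "x \<in> points G" using that(2) adj_points[of q x] by auto
    obtain c where "c \<in> L" "adj G x c" using line_one L x by blast
    then show ?thesis unfolding adj_induced[OF A] using x L by blast
  qed
next
  show "\<exists>x\<in>L. \<exists>y\<in>L. x \<noteq> y" if "L \<in> lines (induced_geometry G {x. adj G p x \<and> adj G q x})" for L
    using that line_two[of L] by simp
  show "x \<in> points (induced_geometry G {x. adj G p x \<and> adj G q x})"
    if "L \<in> lines (induced_geometry G {x. adj G p x \<and> adj G q x})" "x \<in> L" for L x
    using that by auto
qed

text \<open>In the nondegenerate geometry of all common neighbours of \<open>p \<in> L\<close> and some \<open>q\<close>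
  not collinear to \<open>p\<close>, the line \<open>L\<close> and the line \<open>pe\<close> become distinct points.\<close>

lemma line_perp_separates:
  assumes L: "L \<in> lines G" and e: "e \<notin> L" "\<And>x. x \<in> L \<Longrightarrow> adj G e x"
  shows "\<exists>w. (\<forall>x\<in>L. adj G w x) \<and> \<not> adj G w e"
proof -
  obtain p where p: "p \<in> L" using line_two L by blast
  obtain q where q: "q \<in> points G" "\<not> adj G p q" using nondegenerate p L line_points by metis
  obtain a where a: "a \<in> L" "adj G q a" using line_one L q by blast
  have "p \<noteq> a" using a q adj_sym by metis
  have "p \<noteq> e" using p e by blast
  then obtain N where N: "N \<in> lines G" "p \<in> N" "e \<in> N" using join e p adj_sym by metis
  obtain n where n: "n \<in> N" "adj G q n" using line_one N q by blast
  have "p \<noteq> n" using n q adj_sym by metis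
  have "n \<noteq> a" using partial_linear[OF L p a(1) N(1,2) _ \<open>p \<noteq> a\<close>] n N e by blast
  note A = common_subspace[of p q]
  interpret A: shult "induced_geometry G {x. adj G p x \<and> adj G q x}"
    using common_shult q by blast
  have "\<exists>w. adj G p w \<and> adj G q w \<and> adj G a w \<and> \<not> adj G n w"
    using A.perp_inclusion_eq[of a n] \<open>n \<noteq> a\<close> a n line_adj[OF L p a(1)] line_adj[OF N(1,2) n(1)]
    unfolding adj_induced[OF A] by auto
  then obtain w where w: "adj G p w" "adj G a w" "\<not> adj G n w" by blast
  have "adj G w x" if "x \<in> L" for x
    using line_all[OF L p a(1) \<open>p \<noteq> a\<close> _ _ that] w adj_sym by metis
  moreover have "\<not> adj G w e"
    using line_all[OF N \<open>p \<noteq> e\<close> _ _ n(1)] w adj_sym by metis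
  ultimately show ?thesis by blast
qed

text \<open>Read with \<open>D\<^sup>\<perp>\<close> as the ambient space: of two nested hyperplanes \<open>b\<^sup>\<perp> \<subseteq> e\<^sup>\<perp>\<close>, the larger one is
  everything if the inclusion is proper.\<close>

lemma hyperplane_maximal:
  assumes e: "\<And>d. d \<in> D \<Longrightarrow> adj G e d" "adj G e b"
    and incl: "\<And>w. \<lbrakk>\<And>d. d \<in> D \<Longrightarrow> adj G w d; adj G w b\<rbrakk> \<Longrightarrow> adj G w e"
    and w: "\<And>d. d \<in> D \<Longrightarrow> adj G w d" "adj G w e" "\<not> adj G w b"
    and v: "v \<in> points G" "\<And>d. d \<in> D \<Longrightarrow> adj G v d"
  shows "adj G v e"
proof (rule ccontr)
  assume ve: "\<not> adj G v e"
  \<comment> \<open>The point \<open>f\<close> of the line \<open>hv\<close> collinear to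
    \<open>b\<close> is also collinear to \<open>D\<close>, hence to \<open>e\<close> by
    \<open>incl\<close>. As \<open>h\<close> is collinear to \<open>e\<close> too, so would be all
    of \<open>hv\<close>.\<close>
  have core: False if h: "\<And>d. d \<in> D \<Longrightarrow> adj G h d" "adj G h e" "\<not> adj G h b" "adj G v h" for h
  proof -
    have "h \<noteq> v" using h ve by blast
    then obtain N where N: "N \<in> lines G" "h \<in> N" "v \<in> N" using join[OF adj_sym[OF h(4)]] by blast
    obtain f where f: "f \<in> N" "adj G b f" using line_one[OF N(1), of b] e(2) adj_points by blast
    have "adj G f d" if "d \<in> D" for d
      using line_all'[OF N \<open>h \<noteq> v\<close> h(1)[OF that] v(2)[OF that] f(1)] .
    then have fe: "adj G f e" using incl[of f] adj_sym[OF f(2)] by blast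
    have "f \<noteq> h" using adj_sym[OF f(2)] h(3) by blast
    then show False using line_all'[OF N(1) f(1) N(2) _ fe h(2) N(3)] ve by blast
  qed
  show False
  proof (cases "adj G v w")
    case True
    then show False using core[of w] w by blast
  next
    \<comment> \<open>The point \<open>h\<close> of the line \<open>we\<close> collinear to
      \<open>v\<close> can replace \<open>w\<close>: it keeps the properties of \<open>w\<close>
      because \<open>e\<close> is collinear to \<open>D\<close> and to \<open>b\<close>.\<close>
    case False
    have "w \<noteq> e" using w(3) e(2) by blast
    then obtain N where N: "N \<in> lines G" "w \<in> N" "e \<in> N" using join[OF w(2)] by blast
    obtain h where h: "h \<in> N" "adj G v h" using line_one[OF N(1) v(1)] by blast
    have "h \<noteq> e" using h(2) ve by blast
    have "adj G h d" if "d \<in> D" for d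
      using line_all'[OF N \<open>w \<noteq> e\<close> w(1)[OF that] e(1)[OF that] h(1)] .
    moreover have "adj G h e" using line_adj[OF N(1) h(1) N(3)] .
    moreover have "\<not> adj G h b" using line_all'[OF N(1) h(1) N(3) \<open>h \<noteq> e\<close> _ e(2) N(2)] w(3) by blast
    ultimately show False using core[of h] h(2) by blast
  qed
qed

text \<open>The double perp of \<open>L\<close> and \<open>b\<close>. In this form it is easily seen
  to be a pairwise collinear subspace; that it is no larger than the plane spanned by
  \<open>L\<close> and \<open>b\<close> is \<open>plane_on_least\<close>.\<close>

definition plane_on :: "'a set \<Rightarrow> 'a \<Rightarrow> 'a set" where
  "plane_on L b = {e \<in> points G. \<forall>w. (\<forall>x\<in>L. adj G w x) \<and> adj G w b \<longrightarrow> adj G w e}"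

context
  fixes L b
  assumes L: "L \<in> lines G" and b: "b \<notin> L" "\<And>x. x \<in> L \<Longrightarrow> adj G b x"
begin

lemma plane_on_superset: "L \<subseteq> plane_on L b" "b \<in> plane_on L b"
proof -
  show "L \<subseteq> plane_on L b" unfolding plane_on_def using line_points[OF L] by blast
  have "b \<in> points G" using b(2) line_two[OF L] adj_points by blast
  then show "b \<in> plane_on L b" unfolding plane_on_def by blast
qed

lemma plane_on_adj_base: "e \<in> plane_on L b \<Longrightarrow> x \<in> L \<Longrightarrow> adj G e x" "e \<in> plane_on L b \<Longrightarrow> adj G e b"
proof -
  obtain y where y: "y \<in> L" using line_two[OF L] by blast
  have bb: "adj G b b" using adj_refl[of b G] adj_points[OF b(2)[OF y]] by blast
  show "adj G e x" if "e \<in> plane_on L b" "x \<in> L"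
  proof -
    have "(\<forall>y\<in>L. adj G x y) \<and> adj G x b" using line_adj[OF L that(2)] adj_sym[OF b(2)[OF that(2)]]
      by blast
    then show ?thesis using that(1) adj_sym[of G x e] unfolding plane_on_def by blast
  qed
  show "adj G e b" if "e \<in> plane_on L b"
    using that b(2) bb adj_sym[of G b e] unfolding plane_on_def by blast
qed

lemma plane_on_adj: "e \<in> plane_on L b \<Longrightarrow> f \<in> plane_on L b \<Longrightarrow> adj G e f"
  using plane_on_adj_base[of e] unfolding plane_on_def[of L b] by (simp add: Ball_def)

lemma plane_on_subspace: "is_subspace G (plane_on L b)"
proof (rule subspaceI)
  show "N \<subseteq> plane_on L b"
    if xy: "x \<in> plane_on L b" "y \<in> plane_on L b" "x \<noteq> y" "N \<in> lines G" "x \<in> N" "y \<in> N" for x y N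
  proof
    fix c assume c: "c \<in> N"
    have "adj G w c" if w: "(\<forall>x\<in>L. adj G w x) \<and> adj G w b" for w
      using line_all[OF xy(4,5,6,3) _ _ c, of w] w xy(1,2) unfolding plane_on_def by simp
    then show "c \<in> plane_on L b" using line_points[OF xy(4) c] unfolding plane_on_def by simp
  qed
qed (auto simp: plane_on_def)

text \<open>Within the perp of \<open>L\<close>, the perp of \<open>b\<close> is contained in that
  of \<open>e\<close>, and the latter is proper by \<open>line_perp_separates\<close>. By
  \<open>hyperplane_maximal\<close> the two cannot differ.\<close>

lemma plane_on_perp:
  assumes e: "e \<in> plane_on L b" "e \<notin> L" and w: "\<And>x. x \<in> L \<Longrightarrow> adj G w x" "adj G w e"
  shows "adj G w b"
proof (rule ccontr)
  assume wb: "\<not> adj G w b"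
  obtain v where v: "\<forall>x\<in>L. adj G v x" "\<not> adj G v e"
    using line_perp_separates[OF L e(2)] plane_on_adj_base(1)[OF e(1)] by blast
  have "v \<in> points G" using v(1) line_two[OF L] adj_points by blast
  moreover have "\<And>w. \<lbrakk>\<And>d. d \<in> L \<Longrightarrow> adj G w d; adj G w b\<rbrakk> \<Longrightarrow> adj G w e"
    using e unfolding plane_on_def by blast
  ultimately have "adj G v e"
    using hyperplane_maximal[of L e b w v] plane_on_adj_base[OF e(1)] w wb v(1) by blast
  then show False using v by blast
qed

text \<open>Take \<open>w\<close> collinear to all of \<open>L\<close> but not to \<open>b\<close>.
  The point of the line \<open>eb\<close> collinear to \<open>w\<close> lies in the plane; off
  \<open>L\<close> it would make \<open>w\<close> collinear to \<open>b\<close> by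
  \<open>plane_on_perp\<close>.\<close>

lemma plane_on_line:
  assumes e: "e \<in> plane_on L b" "e \<notin> L" "e \<noteq> b"
  shows "\<exists>s\<in>L. \<exists>N\<in>lines G. b \<in> N \<and> s \<in> N \<and> e \<in> N"
proof -
  obtain w where w: "\<forall>x\<in>L. adj G w x" "\<not> adj G w b"
    using line_perp_separates[OF L b] by blast
  obtain N where N: "N \<in> lines G" "e \<in> N" "b \<in> N"
    using join[OF plane_on_adj_base(2)[OF e(1)] e(3)] by blast
  have "w \<in> points G" using w(1) line_two[OF L] adj_points by blast
  then obtain s where s: "s \<in> N" "adj G w s" using line_one[OF N(1)] by blast
  have "s \<in> plane_on L b"
    using subspace_line[OF plane_on_subspace e(1) plane_on_superset(2) e(3) N] s by blast
  then have "s \<in> L" using plane_on_perp[of s w] s(2) w by blast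
  then show ?thesis using s N by blast
qed

text \<open>The exchange property: the line \<open>be\<close> meets \<open>L\<close>, so
  \<open>e\<close> recovers \<open>b\<close>, and every other point lies on a line from
  \<open>b\<close> to a point of \<open>L\<close>.\<close>

lemma plane_on_least:
  assumes K: "is_subspace G K" "L \<subseteq> K" and e: "e \<in> K" "e \<in> plane_on L b" "e \<notin> L"
  shows "plane_on L b \<subseteq> K"
proof -
  have "b \<in> K"
  proof (cases "e = b")
    case False
    then obtain s N where N: "s \<in> L" "N \<in> lines G" "b \<in> N" "s \<in> N" "e \<in> N" 
      using plane_on_line[OF e(2,3)] by blast
    have "s \<in> K" "s \<noteq> e" using N(1) K(2) e(3) by auto
    then show ?thesis using subspace_line[OF K(1) _ e(1) _ N(2,4,5)] N(3) by blast
  qed (use e in simp)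
  show ?thesis
  proof
    fix f assume f: "f \<in> plane_on L b"
    show "f \<in> K"
    proof (cases "f \<in> L \<or> f = b")
      case False
      then obtain s N where N: "s \<in> L" "N \<in> lines G" "b \<in> N" "s \<in> N" "f \<in> N" 
        using plane_on_line[OF f] by blast
      have "s \<in> K" "s \<noteq> b" using N(1) K(2) b(1) by auto
      then show ?thesis using subspace_line[OF K(1) _ \<open>b \<in> K\<close> _ N(2,4,3)] N(5) by blast
    qed (use \<open>b \<in> K\<close> K in blast)
  qed
qed

end

lemma line_subspace: "L \<in> lines G \<Longrightarrow> is_subspace G L"
  using partial_linear line_points by (intro subspaceI) (blast, metis subset_refl)

end

lemma polar_space_shult:
  assumes "polar_space G"
  shows "shult G"
proof -
  have plg: "\<forall>L\<in>lines G. L \<subseteq> points G \<and> (\<exists>x\<in>L. \<exists>y\<in>L. x \<noteq> y)"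
    and nondeg: "\<not> (\<exists>x\<in>points G. \<forall>y\<in>points G. y \<noteq> x \<longrightarrow> collinear G x y)"
    and oa: "\<forall>x\<in>points G. \<forall>L\<in>lines G. (\<exists>!y. y \<in> L \<and> y \<in> perp G x) \<or> L \<subseteq> perp G x"
    using assms unfolding polar_space_def point_line_geometry_def by simp_all
  have alt: "(\<exists>!y. y \<in> L \<and> adj G x y) \<or> (\<forall>y\<in>L. adj G x y)" if "x \<in> points G" "L \<in> lines G" for x L
    using oa[rule_format, OF that] perp_iff_adj[OF that(1)] by (simp add: subset_iff Ball_def)
  show ?thesis
  proof
    show "\<exists>c\<in>L. adj G x c" if "L \<in> lines G" "x \<in> points G" for L x
      using alt[OF that(2,1)] plg[rule_format, OF that(1)] by blast
    show "adj G x c"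
      if "L \<in> lines G" "a \<in> L" "b \<in> L" "a \<noteq> b" "adj G x a" "adj G x b" "c \<in> L" for L a b x c
    proof -
      have "x \<in> points G" using that(5) unfolding adj_def by simp
      from alt[OF this that(1)] show ?thesis using that by blast
    qed
    show "\<exists>y\<in>points G. \<not> adj G x y" if "x \<in> points G" for x
      using nondeg that unfolding adj_def by auto
    show "x \<in> points G" if "L \<in> lines G" "x \<in> L" for L x
      using plg that by blast
    show "\<exists>x\<in>L. \<exists>y\<in>L. x \<noteq> y" if "L \<in> lines G" for L
      using plg that by blast
  qed
qed

section \<open>Symplecta\<close>

lemma gdist_le_path: "is_path G x xs y \<Longrightarrow> gdist G x y \<le> enat (length xs - 1)"
  unfolding gdist_def by (rule INF_lower) simp

lemma gdist_ge:
  assumes "\<And>xs. is_path G x xs y \<Longrightarrow> n \<le> length xs - 1"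
  shows "enat n \<le> gdist G x y"
  unfolding gdist_def
proof (rule INF_greatest)
  show "enat n \<le> enat (length xs - 1)" if "xs \<in> {xs. is_path G x xs y}" for xs
    using assms that by simp
qed

lemma is_path_two: "x \<in> points G \<Longrightarrow> y \<in> points G \<Longrightarrow> collinear G x y \<Longrightarrow> is_path G x [x, y] y"
  unfolding is_path_def by simp

lemma is_path_three:
  "\<lbrakk>x \<in> points G; z \<in> points G; y \<in> points G; collinear G x z; collinear G z y\<rbrakk> \<Longrightarrow>
    is_path G x [x, z, y] y"
  unfolding is_path_def by simp

lemma is_path_short:
  assumes "is_path G x xs y" "length xs \<le> 3"
  shows "xs = [x] \<and> x = y \<or> xs = [x, y] \<and> collinear G x y \<or>
    (\<exists>z. xs = [x, z, y] \<and> collinear G x z \<and> collinear G z y)"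
proof -
  consider a where "xs = [a]" | a b where "xs = [a, b]" | a b c where "xs = [a, b, c]"
  proof -
    have "xs \<noteq> []" using assms unfolding is_path_def by simp
    then obtain a ys where 1: "xs = a # ys" by (cases xs) auto
    show ?thesis
    proof (cases ys)
      case Nil
      then show ?thesis using 1 that by simp
    next
      case (Cons b zs)
      show ?thesis
      proof (cases zs)
        case Nil
        then show ?thesis using 1 Cons that by simp
      next
        case (Cons c us)
        then have "us = []" using assms(2) 1 \<open>ys = b # zs\<close> by simp
        then show ?thesis using 1 \<open>ys = b # zs\<close> Cons that by simp
      qed
    qed
  qed
  then show ?thesis using assms(1) unfolding is_path_def by cases auto
qed

lemma shortest_path_three:
  assumes "x \<in> points G" "z \<in> points G" "y \<in> points G" "collinear G x z" "collinear G z y"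
    and "x \<noteq> y" "\<not> collinear G x y"
  shows "shortest_path G x [x, z, y] y"
proof -
  have p: "is_path G x [x, z, y] y" using is_path_three assms by metis
  have "2 \<le> length xs - 1" if xs: "is_path G x xs y" for xs
  proof (rule ccontr)
    assume n: "\<not> 2 \<le> length xs - 1"
    then have "length xs \<le> 3" by simp
    from is_path_short[OF xs this] show False using assms(6,7) n by auto
  qed
  then have "enat 2 \<le> gdist G x y" by (rule gdist_ge)
  moreover have "gdist G x y \<le> enat 2" using gdist_le_path[OF p] by (simp add: numeral_2_eq_2)
  ultimately have "gdist G x y = enat 2" by (rule antisym[rotated])
  then show ?thesis using p unfolding shortest_path_def by (simp add: numeral_2_eq_2)
qed

text \<open>Symplecta without convex closures: noncollinear points of a polar space have a common
  neighbour, so convexity reduces to containing all common neighbours of such pairs. The equivalence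
  is \<open>symplecton_iff_symp\<close>.\<close>

definition symp :: "'a geometry \<Rightarrow> 'a set \<Rightarrow> bool" where
  "symp G S \<longleftrightarrow> is_subspace G S \<and> polar_space (induced_geometry G S) \<and>
     (\<forall>x\<in>S. \<forall>y\<in>S. \<forall>z. x \<noteq> y \<and> \<not> collinear G x y \<and> collinear G x z \<and> collinear G z y \<longrightarrow> z \<in> S)"

lemma symp_subspace: "symp G S \<Longrightarrow> is_subspace G S"
  unfolding symp_def by blast

lemma symp_polar: "symp G S \<Longrightarrow> polar_space (induced_geometry G S)"
  unfolding symp_def by blast

lemma symp_closed:
  "\<lbrakk>symp G S; x \<in> S; y \<in> S; x \<noteq> y; \<not> collinear G x y; collinear G x z; collinear G z y\<rbrakk> \<Longrightarrow> z \<in> S"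
  unfolding symp_def by blast

lemma symp_shult: "symp G S \<Longrightarrow> shult (induced_geometry G S)"
  using symp_polar polar_space_shult by blast

lemma symp_adj: "symp G S \<Longrightarrow> adj (induced_geometry G S) x y \<longleftrightarrow> x \<in> S \<and> y \<in> S \<and> (x = y \<or> collinear G x y)"
  using adj_induced[OF symp_subspace, of G S x y] subspace_points[OF symp_subspace, of G S]
  unfolding adj_def[of G] by auto

lemma symp_line_through:
  assumes "symp G S" "p \<in> S"
  shows "\<exists>L\<in>lines G. L \<subseteq> S \<and> p \<in> L"
proof -
  have "\<Union>(lines (induced_geometry G S)) = points (induced_geometry G S)"
    using symp_polar[OF assms(1)] unfolding polar_space_def point_line_geometry_def by simp
  then show ?thesis using assms(2) by auto
qed

lemma symp_common_neighbour:
  assumes S: "symp G S" and p: "p \<in> S" and q: "q \<in> S" "p \<noteq> q" "\<not> collinear G p q"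
  shows "\<exists>a\<in>S. collinear G p a \<and> collinear G a q"
proof -
  interpret S: shult "induced_geometry G S" using symp_shult[OF S] .
  obtain L where L: "L \<in> lines G" "L \<subseteq> S" "p \<in> L" using symp_line_through[OF S p] by blast
  obtain a where a: "a \<in> L" "adj (induced_geometry G S) q a"
    using S.line_one[of L q] L q by auto
  have "a \<noteq> p" "a \<noteq> q" using a(2) q(2,3) L a(1) collinear_sym[of G q p]
    unfolding symp_adj[OF S] collinear_def by auto
  moreover have "collinear G p a" using \<open>a \<noteq> p\<close> a(1) L unfolding collinear_def by blast
  moreover have "a \<in> S" using a(1) L by blast
  ultimately show ?thesis using a(2) collinear_sym[of G q a] unfolding symp_adj[OF S] by blast
qed

lemma symp_neighbour_pair:
  assumes S: "symp G S" and pq: "p \<in> S" "q \<in> S" "p \<noteq> q" "\<not> collinear G p q"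
    and a: "a \<in> S" "collinear G p a" "collinear G a q"
  shows "\<exists>b\<in>S. collinear G p b \<and> collinear G b q \<and> a \<noteq> b \<and> \<not> collinear G a b"
proof -
  interpret S: shult "induced_geometry G S" using symp_shult[OF S] .
  obtain b where b: "adj (induced_geometry G S) p b" "adj (induced_geometry G S) q b"
     "\<not> adj (induced_geometry G S) a b"
    using S.common_neighbour[of p q a] pq a collinear_sym[of G a q] unfolding symp_adj[OF S] by blast
  have "b \<noteq> p" "b \<noteq> q" using b pq collinear_sym[of G q p] unfolding symp_adj[OF S] by auto
  then show ?thesis using b a collinear_sym[of G q b] unfolding symp_adj[OF S] by blast
qed

lemma symp_noncollinear:
  assumes "symp G S" "p \<in> S"
  shows "\<exists>q\<in>S. p \<noteq> q \<and> \<not> collinear G p q"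
  using shult.nondegenerate[OF symp_shult[OF assms(1)], of p] assms unfolding symp_adj[OF assms(1)]
    by auto

lemma symp_nonempty: "symp G S \<Longrightarrow> \<exists>p. p \<in> S"
  using symp_polar[of G S] unfolding polar_space_def by auto

text \<open>Two points of \<open>S\<close> are joined by at most two steps inside \<open>S\<close>,
  so a shortest path between them has at most one inner vertex.\<close>

lemma symp_convex:
  assumes S: "symp G S"
  shows "convex_subspace G S"
  unfolding convex_subspace_def
proof (intro conjI ballI allI impI symp_subspace[OF S])
  fix x y xs assume xy: "x \<in> S" "y \<in> S" and xs: "shortest_path G x xs y"
  have SG: "S \<subseteq> points G" using subspace_points symp_subspace S by blast
  have path: "is_path G x xs y" "gdist G x y = enat (length xs - 1)" "xs \<noteq> []"
    using xs unfolding shortest_path_def is_path_def by auto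
  have short: "length xs \<le> length ys" if "is_path G x ys y" for ys
    using gdist_le_path[OF that] path that unfolding is_path_def by (cases xs; cases ys) auto
  consider (eq) "x = y" | (col) "x \<noteq> y" "collinear G x y" | (far) "x \<noteq> y" "\<not> collinear G x y" by blast
  then show "set xs \<subseteq> S"
  proof cases
    case eq
    have "is_path G x [x] y" using eq xy SG unfolding is_path_def by auto
    from short[OF this] is_path_short[OF path(1)] show ?thesis using xy by auto
  next
    case col
    have "is_path G x [x, y] y" using is_path_two[OF _ _ col(2)] xy SG by blast
    from short[OF this] is_path_short[OF path(1)] show ?thesis using xy by auto
  next
    case far
    obtain a where "a \<in> S" "collinear G x a" "collinear G a y"
      using symp_common_neighbour[OF S xy far] by blast
    then have "is_path G x [x, a, y] y" using is_path_three[of x G a y] xy SG by blast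
    from short[OF this] have "length xs \<le> 3" by simp
    from is_path_short[OF path(1) this] show ?thesis
      using far xy symp_closed[OF S xy far] by auto
  qed
qed

text \<open>Let \<open>K\<close> be convex with \<open>p\<close> and \<open>q\<close> in it. Every
  line of \<open>S\<close> through \<open>p\<close> has a point other than \<open>p\<close> equal or
  collinear to \<open>q\<close>; it lies in \<open>K\<close>, hence so does the line. A point
  \<open>x\<close> not collinear to \<open>p\<close> is then a common neighbour of two noncollinear
  neighbours of \<open>p\<close>.\<close>

lemma symp_convex_closure:
  assumes S: "symp G S" and pq: "p \<in> S" "q \<in> S" "p \<noteq> q" "\<not> collinear G p q"
  shows "convex_closure G {p, q} = S"
proof
  show "convex_closure G {p, q} \<subseteq> S"
    unfolding convex_closure_def using symp_convex[OF S] pq by (intro Inter_lower) simp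
  have SG: "S \<subseteq> points G" using subspace_points symp_subspace S by blast
  interpret S: shult "induced_geometry G S" using symp_shult[OF S] .
  show "S \<subseteq> convex_closure G {p, q}"
    unfolding convex_closure_def
  proof (rule Inter_greatest)
    fix K assume "K \<in> {K. convex_subspace G K \<and> {p, q} \<subseteq> K}"
    then have K: "is_subspace G K" "p \<in> K" "q \<in> K"
      and conv: "\<And>x y xs. x \<in> K \<Longrightarrow> y \<in> K \<Longrightarrow> shortest_path G x xs y \<Longrightarrow> set xs \<subseteq> K"
      unfolding convex_subspace_def by auto
    have mid: "z \<in> K" if "x \<in> K" "y \<in> K" "x \<in> S" "y \<in> S" "z \<in> S" "collinear G x z" "collinear G z y"
      "x \<noteq> y" "\<not> collinear G x y" for x y z
      using conv[OF that(1,2) shortest_path_three[OF _ _ _ that(6-9)]] that(3-5) SG by auto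
    have near: "u \<in> K" if u: "u \<in> S" "collinear G p u" for u
    proof -
      obtain N where N: "N \<in> lines G" "p \<in> N" "u \<in> N" using u unfolding collinear_def by blast
      have "p \<noteq> u" using u unfolding collinear_def by simp
      have NS: "N \<subseteq> S" using subspace_line[OF symp_subspace[OF S] pq(1) u(1) \<open>p \<noteq> u\<close> N] .
      obtain y where y: "y \<in> N" "adj (induced_geometry G S) q y"
        using S.line_one[of N q] N NS pq by auto
      have "y \<noteq> p" using y(2) pq collinear_sym[of G q p] unfolding symp_adj[OF S] by auto
      have yK: "y \<in> K"
      proof (cases "y = q")
        case False
        have "collinear G p y" using N y \<open>y \<noteq> p\<close> unfolding collinear_def by blast
        moreover have "collinear G y q" using y(2) False collinear_sym[of G q y] unfolding symp_adj[OF S]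
          by blast
        ultimately show ?thesis using mid[OF K(2,3) pq(1,2) _ _ _ pq(3,4)] y NS by blast
      qed (use K in simp)
      then show ?thesis using subspace_line[OF K(1,2) yK _ N(1,2) y(1)] \<open>y \<noteq> p\<close> N by blast
    qed
    show "S \<subseteq> K"
    proof
      fix x assume x: "x \<in> S"
      show "x \<in> K"
      proof (cases "x = p \<or> collinear G p x")
        case True
        then show ?thesis using near x K by blast
      next
        case False
        then have px: "p \<noteq> x" "\<not> collinear G p x" by auto
        obtain a where a: "a \<in> S" "collinear G p a" "collinear G a x"
          using symp_common_neighbour[OF S pq(1) x px] by blast
        obtain b where b: "b \<in> S" "collinear G p b" "collinear G b x" "a \<noteq> b" "\<not> collinear G a b"
          using symp_neighbour_pair[OF S pq(1) x px a] by blast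
        show ?thesis
          using mid[OF near[OF a(1,2)] near[OF b(1,2)] a(1) b(1) x a(3) collinear_sym[OF b(3)] b(4,5)] .
      qed
    qed
  qed
qed

lemma convex_closure_convex:
  assumes "point_line_geometry G" "A \<subseteq> points G"
  shows "convex_subspace G (convex_closure G A)"
proof -
  have full: "convex_subspace G (points G)"
    unfolding convex_subspace_def shortest_path_def is_path_def using subspace_points_self[OF assms(1)]
      by blast
  have lower: "convex_closure G A \<subseteq> S" if "convex_subspace G S" "A \<subseteq> S" for S
    unfolding convex_closure_def using that by (intro Inter_lower) simp
  have "is_subspace G (convex_closure G A)"
  proof (rule subspaceI)
    show "convex_closure G A \<subseteq> points G" using lower[OF full assms(2)] .
    fix x y L
    assume xy: "x \<in> convex_closure G A" "y \<in> convex_closure G A" "x \<noteq> y" "L \<in> lines G" "x \<in> L" "y \<in> L"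
    show "L \<subseteq> convex_closure G A"
      unfolding convex_closure_def
    proof (rule Inter_greatest)
      fix S assume "S \<in> {S. convex_subspace G S \<and> A \<subseteq> S}"
      then have S: "convex_subspace G S" "A \<subseteq> S" by simp_all
      show "L \<subseteq> S"
        using subspace_line[of G S x y L] S(1) lower[OF S] xy unfolding convex_subspace_def by auto
    qed
  qed
  moreover have "set xs \<subseteq> convex_closure G A"
    if xy: "x \<in> convex_closure G A" "y \<in> convex_closure G A" "shortest_path G x xs y" for x y xs
    unfolding convex_closure_def
  proof (rule Inter_greatest)
    fix S assume "S \<in> {S. convex_subspace G S \<and> A \<subseteq> S}"
    then have S: "convex_subspace G S" "A \<subseteq> S" by simp_all
    show "set xs \<subseteq> S" using S(1) lower[OF S] xy unfolding convex_subspace_def by blast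
  qed
  ultimately show ?thesis unfolding convex_subspace_def by simp
qed

lemma collinear_points:
  assumes "point_line_geometry G" "collinear G x y"
  shows "x \<in> points G" "y \<in> points G"
  using assms unfolding point_line_geometry_def collinear_def by blast+

lemma convex_polar_symp:
  assumes G: "point_line_geometry G" and S: "convex_subspace G S" "polar_space (induced_geometry G S)"
  shows "symp G S"
proof -
  have sub: "is_subspace G S" and conv: "\<And>x y xs. x \<in> S \<Longrightarrow> y \<in> S \<Longrightarrow> shortest_path G x xs y \<Longrightarrow> set xs \<subseteq> S"
    using S(1) unfolding convex_subspace_def by auto
  have "z \<in> S" if z: "x \<in> S" "y \<in> S" "x \<noteq> y" "\<not> collinear G x y" "collinear G x z" "collinear G z y"
    for x y z
    using conv[OF z(1,2) shortest_path_three[OF _ _ _ z(5,6,3,4)]]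
      collinear_points[OF G z(5)] collinear_points[OF G z(6)] by simp
  then show ?thesis using sub S(2) unfolding symp_def by blast
qed

lemma symplecton_iff_symp:
  assumes G: "point_line_geometry G"
  shows "symplecton G S \<longleftrightarrow> symp G S"
proof
  assume "symplecton G S"
  then obtain p q where "p \<in> points G" "q \<in> points G" "S = convex_closure G {p, q}"
    "polar_space (induced_geometry G S)"
    unfolding symplecton_def by blast
  then show "symp G S" using convex_polar_symp[OF G] convex_closure_convex[OF G, of "{p, q}"] by simp
next
  assume S: "symp G S"
  have SG: "S \<subseteq> points G" using subspace_points symp_subspace S by blast
  obtain p where p: "p \<in> S" using symp_nonempty[OF S] by blast
  obtain q where q: "q \<in> S" "p \<noteq> q" "\<not> collinear G p q" using symp_noncollinear[OF S p] by blast
  obtain a where a: "a \<in> S" "collinear G p a" "collinear G a q"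
    using symp_common_neighbour[OF S p q] by blast
  have "a \<in> perp G p \<inter> perp G q" using a collinear_sym[OF a(3)] SG unfolding perp_def by blast
  then show "symplecton G S"
    using symp_convex_closure[OF S p q] symp_polar[OF S] p q SG unfolding symplecton_def by blast
qed

section \<open>Isomorphisms\<close>

text \<open>The condition \<open>lines_subset\<close> lets \<open>inv_into\<close> undo images of
  lines. So \<open>inverse\<close> is again an instance, and each one-way transport lemma also works
  backwards.\<close>

locale geometry_iso =
  fixes f :: "'a \<Rightarrow> 'b" and G :: "'a geometry" and H :: "'b geometry"
  assumes inj: "inj_on f (points G)"
    and points_image: "points H = f ` points G"
    and lines_image: "lines H = image f ` lines G"
    and lines_subset: "L \<in> lines G \<Longrightarrow> L \<subseteq> points G"
begin

lemma inverse: "geometry_iso (inv_into (points G) f) H G"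
proof
  let ?g = "inv_into (points G) f"
  show "inj_on ?g (points H)" using inj_on_inv_into[of "points H" f "points G"] points_image by simp
  show "points G = ?g ` points H" using inj points_image by simp
  have "?g ` f ` L = L" if "L \<in> lines G" for L
    using inv_into_image_cancel[OF inj lines_subset[OF that]] .
  then show "lines G = image ?g ` lines H" unfolding lines_image by (simp add: image_image)
  show "L \<subseteq> points H" if "L \<in> lines H" for L
    using that lines_subset unfolding lines_image points_image by auto
qed

lemma cancel: "A \<subseteq> points G \<Longrightarrow> inv_into (points G) f ` f ` A = A"
  using inv_into_image_cancel[OF inj] .

lemma cancel': "A \<subseteq> points H \<Longrightarrow> f ` inv_into (points G) f ` A = A"
  using image_inv_into_cancel[of f "points G" "points H" A] points_image by simp

lemma push_collinear: "x \<in> points G \<Longrightarrow> y \<in> points G \<Longrightarrow> collinear G x y \<Longrightarrow> collinear H (f x) (f y)"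
  using inj_on_eq_iff[OF inj, of x y] unfolding collinear_def lines_image by auto

lemma push_subspace:
  assumes "is_subspace G S"
  shows "is_subspace H (f ` S)"
proof (rule subspaceI)
  have SG: "S \<subseteq> points G" using assms subspace_points by blast
  then show "f ` S \<subseteq> points H" unfolding points_image by blast
  fix x y M assume xy: "x \<in> f ` S" "y \<in> f ` S" "x \<noteq> y" "M \<in> lines H" "x \<in> M" "y \<in> M"
  then obtain a b where ab: "a \<in> S" "b \<in> S" "x = f a" "y = f b" by blast
  obtain L where L: "L \<in> lines G" "M = f ` L" using xy unfolding lines_image by blast
  have "a \<in> L" "b \<in> L"
    using xy ab L SG inj_on_image_mem_iff[OF inj _ lines_subset[OF L(1)]] by auto
  moreover have "a \<noteq> b" using xy(3) ab by blast
  ultimately have "L \<subseteq> S" using subspace_line[OF assms ab(1,2) _ L(1)] by blast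
  then show "M \<subseteq> f ` S" using L by blast
qed

lemma push_singular:
  assumes "singular_subspace G S"
  shows "singular_subspace H (f ` S)"
  unfolding singular_subspace_def
proof (intro conjI ballI impI)
  have S: "is_subspace G S" "S \<subseteq> points G" using assms subspace_points unfolding singular_subspace_def
    by auto
  then show "is_subspace H (f ` S)" using push_subspace by blast
  fix x y assume "x \<in> f ` S" "y \<in> f ` S" "x \<noteq> y"
  then obtain a b where "a \<in> S" "b \<in> S" "x = f a" "y = f b" "a \<noteq> b" by blast
  then show "collinear H x y" using push_collinear[of a b] assms S unfolding singular_subspace_def
    by blast
qed

lemma push_generated_subset:
  assumes "A \<subseteq> points G"
  shows "generated_subspace H (f ` A) \<subseteq> f ` generated_subspace G A"
proof (rule generated_least)
  have "is_subspace G (points G)" using lines_subset by (intro subspaceI) auto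
  then show "is_subspace H (f ` generated_subspace G A)"
    using push_subspace[OF generated_is_subspace[OF _ assms]] by blast
  show "f ` A \<subseteq> f ` generated_subspace G A" using image_mono[OF generated_superset] .
qed

end

lemma (in geometry_iso) push_generated:
  assumes "A \<subseteq> points G"
  shows "generated_subspace H (f ` A) = f ` generated_subspace G A"
proof
  let ?g = "inv_into (points G) f"
  have fA: "f ` A \<subseteq> points H" using assms points_image by blast
  have "is_subspace H (points H)"
    using geometry_iso.lines_subset[OF inverse] by (intro subspaceI) auto
  then have sub: "generated_subspace H (f ` A) \<subseteq> points H" using generated_least fA by metis
  have "generated_subspace G A \<subseteq> ?g ` generated_subspace H (f ` A)"
    using geometry_iso.push_generated_subset[OF inverse fA] cancel[OF assms] by simp
  then have "f ` generated_subspace G A \<subseteq> f ` ?g ` generated_subspace H (f ` A)" by blast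
  then show "f ` generated_subspace G A \<subseteq> generated_subspace H (f ` A)" using cancel'[OF sub] by simp
qed (rule push_generated_subset[OF assms])

lemma (in geometry_iso) push_singular_dim:
  assumes "singular_dim G U d"
  shows "singular_dim H (f ` U) d"
proof -
  let ?g = "inv_into (points G) f"
  interpret inv: geometry_iso ?g H G by (rule inverse)
  have U: "singular_subspace G U" "U \<subseteq> points G"
    using assms subspace_points unfolding singular_dim_def singular_subspace_def by auto
  have fU: "f ` U \<subseteq> points H" using U points_image by blast
  obtain B where B: "B \<subseteq> U" "finite B" "card B = d + 1" "generated_subspace G B = U"
    using assms unfolding singular_dim_def by blast
  have min: "\<And>B. B \<subseteq> U \<Longrightarrow> finite B \<Longrightarrow> generated_subspace G B = U \<Longrightarrow> d + 1 \<le> card B"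
    using assms unfolding singular_dim_def by blast
  have BG: "B \<subseteq> points G" using B U by blast
  have "card (f ` B) = d + 1" using B card_image[OF inj_on_subset[OF inj BG]] by simp
  moreover have "generated_subspace H (f ` B) = f ` U" using push_generated[OF BG] B by simp
  ultimately have 1: "\<exists>B. B \<subseteq> f ` U \<and> finite B \<and> card B = d + 1 \<and> generated_subspace H B = f ` U"
    using B by (intro exI[of _ "f ` B"]) auto
  have 2: "d + 1 \<le> card C" if C: "C \<subseteq> f ` U" "finite C" "generated_subspace H C = f ` U" for C
  proof -
    have CH: "C \<subseteq> points H" using C fU by blast
    have "generated_subspace G (?g ` C) = ?g ` f ` U" using inv.push_generated[OF CH] C(3) by simp
    then have "generated_subspace G (?g ` C) = U" using cancel[OF U(2)] by simp
    moreover have "?g ` C \<subseteq> U" using image_mono[OF C(1), of ?g] cancel[OF U(2)] by simp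
    ultimately have "d + 1 \<le> card (?g ` C)" using min C(2) by blast
    also have "\<dots> \<le> card C" using card_image_le[OF C(2)] .
    finally show ?thesis .
  qed
  show ?thesis unfolding singular_dim_def using push_singular[OF U(1)] 1 2 by blast
qed

lemma (in geometry_iso) push_adj: "adj G x y \<Longrightarrow> adj H (f x) (f y)"
  unfolding adj_def using push_collinear points_image by auto

lemma (in geometry_iso) adj_iff:
  assumes "x \<in> points G" "y \<in> points G"
  shows "adj H (f x) (f y) \<longleftrightarrow> adj G x y"
  using push_adj[of x y] geometry_iso.push_adj[OF inverse, of "f x" "f y"] assms
  by (auto simp: inv_into_f_f[OF inj])

lemma (in geometry_iso) push_polar:
  assumes "polar_space G"
  shows "polar_space H"
proof -
  let ?g = "inv_into (points G) f"
  interpret inv: geometry_iso ?g H G by (rule inverse)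
  have G: "point_line_geometry G" "points G \<noteq> {}"
    and thick: "\<And>L. L \<in> lines G \<Longrightarrow> \<exists>x\<in>L. \<exists>y\<in>L. \<exists>z\<in>L. x \<noteq> y \<and> x \<noteq> z \<and> y \<noteq> z"
    and nondeg: "\<not> (\<exists>x\<in>points G. \<forall>y\<in>points G. y \<noteq> x \<longrightarrow> collinear G x y)"
    and chains: "\<And>C. subset.chain {S. singular_subspace G S} C \<Longrightarrow> finite C"
    and oa: "\<And>x L. x \<in> points G \<Longrightarrow> L \<in> lines G \<Longrightarrow> (\<exists>!y. y \<in> L \<and> y \<in> perp G x) \<or> L \<subseteq> perp G x"
    using assms unfolding polar_space_def by simp_all
  have "point_line_geometry H"
    unfolding point_line_geometry_def
  proof (intro conjI ballI)
    have "\<Union>(lines G) = points G" using G unfolding point_line_geometry_def by simp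
    then show "\<Union>(lines H) = points H" unfolding points_image lines_image by blast
    show "L \<subseteq> points H" if "L \<in> lines H" for L using inv.lines_subset[OF that] .
    show "\<exists>x\<in>L. \<exists>y\<in>L. x \<noteq> y" if "L \<in> lines H" for L
    proof -
      obtain M where M: "M \<in> lines G" "L = f ` M" using \<open>L \<in> lines H\<close> unfolding lines_image by blast
      obtain x y where "x \<in> M" "y \<in> M" "x \<noteq> y" using thick[OF M(1)] by blast
      then show ?thesis using M inj_on_contraD[OF inj_on_subset[OF inj lines_subset[OF M(1)]], of x y]
        by blast
    qed
  qed
  moreover have "\<exists>x\<in>L. \<exists>y\<in>L. \<exists>z\<in>L. x \<noteq> y \<and> x \<noteq> z \<and> y \<noteq> z" if "L \<in> lines H" for L
  proof -
    obtain M where M: "M \<in> lines G" "L = f ` M" using \<open>L \<in> lines H\<close> unfolding lines_image by blast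
    have neq: "f x \<noteq> f y" if "x \<in> M" "y \<in> M" "x \<noteq> y" for x y
      using inj_on_contraD[OF inj_on_subset[OF inj lines_subset[OF M(1)]] that(3,1,2)] .
    obtain x y z where "x \<in> M" "y \<in> M" "z \<in> M" "x \<noteq> y" "x \<noteq> z" "y \<noteq> z" using thick[OF M(1)] by blast
    then have "f x \<in> L" "f y \<in> L" "f z \<in> L" "f x \<noteq> f y" "f x \<noteq> f z" "f y \<noteq> f z" using neq M by auto
    then show ?thesis by blast
  qed
  moreover have "\<not> (\<exists>x\<in>points H. \<forall>y\<in>points H. y \<noteq> x \<longrightarrow> collinear H x y)"
  proof
    assume "\<exists>x\<in>points H. \<forall>y\<in>points H. y \<noteq> x \<longrightarrow> collinear H x y"
    then obtain x where x: "x \<in> points G" "\<forall>y\<in>points G. f y \<noteq> f x \<longrightarrow> collinear H (f x) (f y)"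
      unfolding points_image by auto
    have "collinear G x y" if "y \<in> points G" "y \<noteq> x" for y
    proof -
      have "f y \<noteq> f x" using inj_on_contraD[OF inj] that x by blast
      then have "adj H (f x) (f y)" using x that points_image unfolding adj_def by blast
      then show ?thesis using adj_iff[OF x(1) that(1)] that unfolding adj_def by blast
    qed
    then show False using nondeg x by blast
  qed
  moreover have "finite C" if C: "subset.chain {S. singular_subspace H S} C" for C
  proof -
    have sing: "S \<in> C \<Longrightarrow> singular_subspace H S" for S
      using C unfolding subset.chain_def by blast
    have lin: "S \<subseteq> T \<or> T \<subseteq> S" if "S \<in> C" "T \<in> C" for S T
      using C that unfolding subset.chain_def by auto
    have sub: "S \<in> C \<Longrightarrow> S \<subseteq> points H" for S
      using sing[of S] subspace_points[of H S] unfolding singular_subspace_def by blast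
    have "subset.chain {S. singular_subspace G S} (image ?g ` C)"
      unfolding subset_chain_def
    proof (intro conjI ballI subsetI)
      show "X \<in> {S. singular_subspace G S}" if "X \<in> image ?g ` C" for X
        using that inv.push_singular sing by auto
      fix X Y assume "X \<in> image ?g ` C" "Y \<in> image ?g ` C"
      then obtain S T where "S \<in> C" "T \<in> C" "X = ?g ` S" "Y = ?g ` T" by blast
      then show "X \<subseteq> Y \<or> Y \<subseteq> X" using lin[of S T] by (auto intro: image_mono)
    qed
    then have "finite (image f ` image ?g ` C)" using chains by blast
    moreover have "image f ` image ?g ` C = C"
      using cancel'[OF sub] by (simp add: image_image)
    ultimately show ?thesis by simp
  qed
  moreover have "(\<exists>!y. y \<in> L \<and> y \<in> perp H x) \<or> L \<subseteq> perp H x" if xL: "x \<in> points H" "L \<in> lines H" for x L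
  proof -
    obtain a where a: "a \<in> points G" "x = f a" using xL unfolding points_image by blast
    obtain M where M: "M \<in> lines G" "L = f ` M" using xL unfolding lines_image by blast
    have perp: "f b \<in> perp H x \<longleftrightarrow> b \<in> perp G a" if "b \<in> M" for b
      using perp_iff_adj[of x H "f b"] perp_iff_adj[of a G b] adj_iff[of a b] a \<open>x \<in> points H\<close>
        lines_subset[OF M(1)] that by auto
    consider "\<exists>!y. y \<in> M \<and> y \<in> perp G a" | "M \<subseteq> perp G a" using oa[OF a(1) M(1)] by blast
    then show ?thesis
    proof cases
      case 1
      then obtain y where y: "y \<in> M" "y \<in> perp G a" "\<And>z. z \<in> M \<Longrightarrow> z \<in> perp G a \<Longrightarrow> z = y" by blast
      have "f y \<in> L \<and> f y \<in> perp H x" using y perp M by blast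
      moreover have "z = f y" if "z \<in> L \<and> z \<in> perp H x" for z
        using that y(3) perp M by blast
      ultimately show ?thesis by blast
    next
      case 2
      then show ?thesis using perp M by blast
    qed
  qed
  ultimately show ?thesis unfolding polar_space_def using G points_image by simp
qed

lemma (in geometry_iso) push_rank:
  assumes "polar_space_of_rank G r"
  shows "polar_space_of_rank H r"
proof -
  let ?g = "inv_into (points G) f"
  interpret inv: geometry_iso ?g H G by (rule inverse)
  have r: "polar_space G" "r \<ge> 2" "\<And>M. maximal_singular_subspace G M \<Longrightarrow> singular_dim G M (r - 1)"
    using assms unfolding polar_space_of_rank_def by auto
  have "singular_dim H M (r - 1)" if M: "maximal_singular_subspace H M" for M
  proof -
    have MS: "singular_subspace H M" and MM: "\<And>S. singular_subspace H S \<Longrightarrow> M \<subseteq> S \<Longrightarrow> S = M"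
      using M unfolding maximal_singular_subspace_def by auto
    have sub: "M \<subseteq> points H" using MS subspace_points unfolding singular_subspace_def by blast
    have "maximal_singular_subspace G (?g ` M)"
      unfolding maximal_singular_subspace_def
    proof (intro conjI allI impI inv.push_singular[OF MS])
      fix S assume S: "singular_subspace G S \<and> ?g ` M \<subseteq> S"
      then have SG: "S \<subseteq> points G" using subspace_points unfolding singular_subspace_def by blast
      have "M \<subseteq> f ` S" using image_mono[of "?g ` M" S f] S cancel'[OF sub] by simp
      then have "f ` S = M" using MM push_singular S by blast
      then show "S = ?g ` M" using cancel[OF SG] by simp
    qed
    then have "singular_dim H (f ` ?g ` M) (r - 1)" using push_singular_dim r(3) by blast
    then show ?thesis using cancel'[OF sub] by simp
  qed
  then show ?thesis using r push_polar unfolding polar_space_of_rank_def by blast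
qed

section \<open>Parapolar spaces of symplectic rank at least three\<close>

text \<open>The axioms of a parapolar space of symplectic rank at least 3, without connectedness and
  without the existence of a point far from a line. They pass to the connected components of the
  unbuttoned space, some of which are polar spaces.\<close>

locale pre_parapolar =
  fixes G :: "'a geometry"
  assumes plg: "point_line_geometry G"
    and one_or_all: "\<lbrakk>L \<in> lines G; p \<in> points G; p \<notin> L; y \<in> L; z \<in> L; y \<noteq> z; collinear G p y;
      collinear G p z; w \<in> L\<rbrakk> \<Longrightarrow> collinear G p w"
    and symp_or_unique: "\<lbrakk>collinear G p r; collinear G r q; p \<noteq> q; \<not> collinear G p q\<rbrakk> \<Longrightarrow>
      (\<exists>S. symp G S \<and> p \<in> S \<and> q \<in> S) \<or> (\<forall>s. collinear G p s \<and> collinear G s q \<longrightarrow> s = r)"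
    and line_in_symp: "L \<in> lines G \<Longrightarrow> \<exists>S. symp G S \<and> L \<subseteq> S"
    and rank_three: "symp G S \<Longrightarrow> polar_space_of_rank_at_least (induced_geometry G S) 3"

lemma parapolar_pre_parapolar:
  assumes G: "parapolar_space G" and rank: "symplectic_rank_at_least 3 G"
  shows "pre_parapolar G"
proof
  have 1: "\<forall>L\<in>lines G. \<forall>p\<in>points G - L.
        (\<forall>y\<in>L. \<not> collinear G p y) \<or> (\<exists>!y. y \<in> L \<and> collinear G p y) \<or> (\<forall>y\<in>L. collinear G p y)"
    and 2: "\<forall>p\<in>points G. \<forall>q\<in>points G.
        p \<noteq> q \<and> \<not> collinear G p q \<and> perp G p \<inter> perp G q \<noteq> {} \<longrightarrow>
        polar_space (induced_geometry G (convex_closure G {p, q})) \<or>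
        (\<exists>x. perp G p \<inter> perp G q = {x})"
    and 3: "\<forall>L\<in>lines G. \<exists>S. symplecton G S \<and> L \<subseteq> S"
    using G unfolding parapolar_space_def by simp_all
  show plg: "point_line_geometry G" using G unfolding parapolar_space_def by simp
  show "collinear G p w" if "L \<in> lines G" "p \<in> points G" "p \<notin> L" "y \<in> L" "z \<in> L" "y \<noteq> z"
    "collinear G p y" "collinear G p z" "w \<in> L" for L p y z w
  proof -
    have "p \<in> points G - L" using that by blast
    from 1[rule_format, OF that(1) this] show ?thesis using that by blast
  qed
  show "\<exists>S. symp G S \<and> L \<subseteq> S" if "L \<in> lines G" for L
    using 3 that symplecton_iff_symp[OF plg] by blast
  show "polar_space_of_rank_at_least (induced_geometry G S) 3" if "symp G S" for S
    using rank that symplecton_iff_symp[OF plg] unfolding symplectic_rank_at_least_def by blast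
  show "(\<exists>S. symp G S \<and> p \<in> S \<and> q \<in> S) \<or> (\<forall>s. collinear G p s \<and> collinear G s q \<longrightarrow> s = r)"
    if pq: "collinear G p r" "collinear G r q" "p \<noteq> q" "\<not> collinear G p q" for p q r
  proof -
    have pts: "p \<in> points G" "q \<in> points G"
      using collinear_points[OF plg pq(1)] collinear_points[OF plg pq(2)] by auto
    have perp: "s \<in> perp G p \<inter> perp G q" if "collinear G p s" "collinear G s q" for s
      using that collinear_points[OF plg that(1)] collinear_sym[OF that(2)] unfolding perp_def by blast
    have "perp G p \<inter> perp G q \<noteq> {}" using perp[OF pq(1,2)] by blast
    then consider "polar_space (induced_geometry G (convex_closure G {p, q}))"
      | x where "perp G p \<inter> perp G q = {x}"
      using 2[rule_format, OF pts] pq by blast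
    then show ?thesis
    proof cases
      case 1
      have "symp G (convex_closure G {p, q})"
        using convex_polar_symp[OF plg convex_closure_convex[OF plg] 1] pts by simp
      moreover have "{p, q} \<subseteq> convex_closure G {p, q}" unfolding convex_closure_def by blast
      ultimately show ?thesis by blast
    next
      case 2
      then have "s = x" if "collinear G p s" "collinear G s q" for s using perp[OF that] by blast
      then show ?thesis using pq(1,2) by metis
    qed
  qed
qed

text \<open>A triangle at \<open>p\<close>, with \<open>u = v\<close> allowed so that a line is
  linked to itself. One pair of points is enough: by one-or-all each of them is collinear to the
  whole of the other line.\<close>

definition link :: "'a geometry \<Rightarrow> 'a \<Rightarrow> 'a set \<Rightarrow> 'a set \<Rightarrow> bool" where
  "link G p L M \<longleftrightarrow> L \<in> lines G \<and> M \<in> lines G \<and> p \<in> L \<and> p \<in> M \<and>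
     (\<exists>u\<in>L. \<exists>v\<in>M. u \<noteq> p \<and> v \<noteq> p \<and> (u = v \<or> collinear G u v))"

lemma link_sym: "link G p L M \<Longrightarrow> link G p M L"
  unfolding link_def using collinear_sym[of G] by blast

context pre_parapolar
begin

lemma line_points: "L \<in> lines G \<Longrightarrow> x \<in> L \<Longrightarrow> x \<in> points G"
  using plg unfolding point_line_geometry_def by blast

lemma line_two: "L \<in> lines G \<Longrightarrow> \<exists>x\<in>L. \<exists>y\<in>L. x \<noteq> y"
  using plg unfolding point_line_geometry_def by blast

lemma point_line: "x \<in> points G \<Longrightarrow> \<exists>L\<in>lines G. x \<in> L"
  using plg unfolding point_line_geometry_def by blast

lemma line_adj: "L \<in> lines G \<Longrightarrow> x \<in> L \<Longrightarrow> y \<in> L \<Longrightarrow> adj G x y"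
  unfolding adj_def collinear_def using line_points by blast

lemma adj_join: "adj G x y \<Longrightarrow> x \<noteq> y \<Longrightarrow> \<exists>L\<in>lines G. x \<in> L \<and> y \<in> L"
  unfolding adj_def collinear_def by blast

lemma line_all:
  assumes "L \<in> lines G" "a \<in> L" "b \<in> L" "a \<noteq> b" "adj G x a" "adj G x b" "c \<in> L"
  shows "adj G x c"
proof (cases "x \<in> L")
  case True
  then show ?thesis using line_adj assms by blast
next
  case False
  then have "collinear G x c" using one_or_all[OF assms(1) _ False assms(2-4) _ _ assms(7)] assms
    unfolding adj_def by blast
  then show ?thesis using line_points assms unfolding adj_def by blast
qed

lemma symp_sub: "symp G S \<Longrightarrow> x \<in> S \<Longrightarrow> x \<in> points G"
  using subspace_points[OF symp_subspace] by blast

lemma symp_adj_iff: "symp G S \<Longrightarrow> adj (induced_geometry G S) x y \<longleftrightarrow> x \<in> S \<and> y \<in> S \<and> adj G x y"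
  by (rule adj_induced[OF symp_subspace])

text \<open>Inherited from a symp containing \<open>L\<close>: being a subspace, it contains
  \<open>M\<close> as well.\<close>

lemma partial_linear:
  assumes L: "L \<in> lines G" "x \<in> L" "y \<in> L" and M: "M \<in> lines G" "x \<in> M" "y \<in> M" and "x \<noteq> y"
  shows "L = M"
proof -
  obtain S where S: "symp G S" "L \<subseteq> S" using line_in_symp L by blast
  interpret S: shult "induced_geometry G S" using symp_shult S by blast
  have "x \<in> S" "y \<in> S" using L S by auto
  then have "M \<subseteq> S" using subspace_line[OF symp_subspace[OF S(1)] _ _ \<open>x \<noteq> y\<close> M] by simp
  then show ?thesis using S.partial_linear[of L x y M] assms S by simp
qed

lemma line_subspace: "L \<in> lines G \<Longrightarrow> is_subspace G L"
  using partial_linear line_points by (intro subspaceI) (blast, metis subset_refl)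

text \<open>Otherwise \<open>L\<close> would be a maximal singular subspace; two points generate it,
  against the dimension \<open>r - 1 \<ge> 2\<close> imposed by the rank.\<close>

lemma symp_line_extends:
  assumes S: "symp G S" and L: "L \<in> lines G" "L \<subseteq> S"
  shows "\<exists>n\<in>S. n \<notin> L \<and> (\<forall>x\<in>L. adj G n x)"
proof (rule ccontr)
  assume no: "\<not> ?thesis"
  let ?I = "induced_geometry G S"
  obtain r where r: "r \<ge> 3" "\<And>M. maximal_singular_subspace ?I M \<Longrightarrow> singular_dim ?I M (r - 1)"
    using rank_three[OF S] unfolding polar_space_of_rank_at_least_def polar_space_of_rank_def by blast
  have sub: "is_subspace G S" using symp_subspace S by blast
  have "singular_subspace G L"
    unfolding singular_subspace_def using line_subspace[OF L(1)] L unfolding collinear_def by blast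
  then have sing: "singular_subspace ?I L" using singular_subspace_induced[OF sub] L by blast
  have "T = L" if T: "singular_subspace ?I T" "L \<subseteq> T" for T
  proof -
    have T': "T \<subseteq> S" "singular_subspace G T" using T singular_subspace_induced[OF sub] by auto
    have "n \<in> L" if n: "n \<in> T" for n
    proof -
      have "\<forall>x\<in>L. adj G n x"
      proof
        fix x assume "x \<in> L"
        then have "x \<in> T" using T(2) by blast
        then have "n = x \<or> collinear G n x" using T'(2) n unfolding singular_subspace_def by blast
        then show "adj G n x"
          using symp_sub[OF S, of x] symp_sub[OF S, of n] T'(1) n \<open>x \<in> T\<close> unfolding adj_def by blast
      qed
      then show ?thesis using no n T'(1) by blast
    qed
    then show ?thesis using T(2) by blast
  qed
  then have "maximal_singular_subspace ?I L" unfolding maximal_singular_subspace_def using sing by blast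
  then have dim: "singular_dim ?I L (r - 1)" using r by blast
  obtain x y where xy: "x \<in> L" "y \<in> L" "x \<noteq> y" using line_two L by blast
  have "generated_subspace ?I {x, y} = L"
  proof
    have "is_subspace ?I L" using sing unfolding singular_subspace_def by blast
    then show "generated_subspace ?I {x, y} \<subseteq> L" using xy by (intro generated_least) simp_all
    show "L \<subseteq> generated_subspace ?I {x, y}"
      unfolding generated_subspace_def
    proof (rule Inter_greatest)
      fix K assume "K \<in> {K. is_subspace ?I K \<and> {x, y} \<subseteq> K}"
      then show "L \<subseteq> K" using subspace_line[of ?I K x y L] xy L by simp
    qed
  qed
  moreover have min: "\<And>B. B \<subseteq> L \<Longrightarrow> finite B \<Longrightarrow> generated_subspace ?I B = L \<Longrightarrow> r - 1 + 1 \<le> card B"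
    using dim unfolding singular_dim_def by blast
  ultimately have "r - 1 + 1 \<le> card {x, y}" using xy by (intro min) simp_all
  then show False using r xy by simp
qed

lemma symp_line_separates:
  assumes S: "symp G S" and L: "L \<in> lines G" "L \<subseteq> S" and e: "e \<in> S" "e \<notin> L" "\<And>x. x \<in> L \<Longrightarrow> adj G e x"
  shows "\<exists>w\<in>S. (\<forall>x\<in>L. adj G w x) \<and> \<not> adj G w e"
proof -
  interpret S: shult "induced_geometry G S" using symp_shult S by blast
  have "L \<in> lines (induced_geometry G S)" using L by simp
  moreover have "adj (induced_geometry G S) e x" if "x \<in> L" for x
    using e L that symp_adj_iff[OF S] by blast
  ultimately obtain w where w: "\<forall>x\<in>L. adj (induced_geometry G S) w x" "\<not> adj (induced_geometry G S) w e"
    using S.line_perp_separates e(2) by blast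
  then have "w \<in> S" using line_two[OF L(1)] symp_adj_iff[OF S] by blast
  then show ?thesis using w e(1) symp_adj_iff[OF S] by blast
qed

text \<open>Inside a symp \<open>T\<close> on \<open>L\<close>, choose noncollinear \<open>n\<close>
  and \<open>m\<close> collinear to all of \<open>L\<close>. If \<open>b\<close> is collinear to
  both, closure puts it into \<open>T\<close>. Otherwise \<open>b\<close> and one of them are
  noncollinear with several common neighbours on \<open>L\<close>, so they lie in a symp, which
  contains \<open>L\<close> by closure.\<close>

lemma triangle_in_symp:
  assumes L: "L \<in> lines G" and b: "b \<notin> L" "\<And>x. x \<in> L \<Longrightarrow> adj G b x"
  shows "\<exists>S. symp G S \<and> L \<subseteq> S \<and> b \<in> S"
proof -
  obtain T where T: "symp G T" "L \<subseteq> T" using line_in_symp L by blast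
  obtain n where n: "n \<in> T" "n \<notin> L" "\<forall>x\<in>L. adj G n x" using symp_line_extends[OF T(1) L T(2)] by blast
  obtain m where m: "m \<in> T" "\<forall>x\<in>L. adj G m x" "\<not> adj G m n"
    using symp_line_separates[OF T(1) L T(2) n(1,2)] n(3) by blast
  obtain x y where xy: "x \<in> L" "y \<in> L" "x \<noteq> y" using line_two L by blast
  have bp: "b \<in> points G" using b(2)[OF xy(1)] unfolding adj_def by blast
  have far: ?thesis if v: "v \<in> T" "\<forall>x\<in>L. adj G v x" "\<not> adj G b v" for v
  proof -
    have cb: "collinear G b z" if "z \<in> L" for z using b that unfolding adj_def by blast
    have "v \<notin> L" using v(3) b(2) by blast
    then have cv: "collinear G z v" if "z \<in> L" for z
      using v(2)[rule_format, OF that] that collinear_sym[of G v z] unfolding adj_def by metis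
    have bv: "b \<noteq> v" "\<not> collinear G b v" using v(3) bp symp_sub[OF T(1) v(1)] unfolding adj_def by auto
    obtain S where S: "symp G S" "b \<in> S" "v \<in> S"
      using symp_or_unique[OF cb[OF xy(1)] cv[OF xy(1)] bv] cb[OF xy(2)] cv[OF xy(2)] xy(3) by blast
    have "L \<subseteq> S" using symp_closed[OF S bv] cb cv by blast
    then show ?thesis using S by blast
  qed
  show ?thesis
  proof (cases "adj G b n \<and> adj G b m")
    case True
    have "b \<in> T"
    proof (rule ccontr)
      assume "b \<notin> T"
      then have "collinear G n b" "collinear G b m"
        using True n(1) m(1) collinear_sym[of G b n] unfolding adj_def by auto
      moreover have "n \<noteq> m" "\<not> collinear G n m"
        using m(3) symp_sub[OF T(1)] n(1) m(1) collinear_sym[of G n m] unfolding adj_def by auto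
      ultimately show False using symp_closed[OF T(1) n(1) m(1)] \<open>b \<notin> T\<close> by blast
    qed
    then show ?thesis using T by blast
  next
    case False
    then show ?thesis using far n m by blast
  qed
qed

section \<open>Singular planes and chains of triangles\<close>

abbreviation "plane_of L b \<equiv> generated_subspace G (insert b L)"

text \<open>The double perp is formed in one symp, but its minimality identifies it with a subspace
  generated in \<open>G\<close>, so the plane does not depend on the symp. The last clause carries
  the exchange property.\<close>

lemma plane_eq_plane_on:
  assumes L: "L \<in> lines G" and b: "b \<notin> L" "\<And>x. x \<in> L \<Longrightarrow> adj G b x"
  obtains P where "is_subspace G P" "\<And>x y. x \<in> P \<Longrightarrow> y \<in> P \<Longrightarrow> adj G x y" "L \<subseteq> P" "b \<in> P"
    "\<And>e. e \<in> P \<Longrightarrow> e \<notin> L \<Longrightarrow> plane_of L e = P"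
proof -
  obtain S where S: "symp G S" "L \<subseteq> S" "b \<in> S" using triangle_in_symp[OF assms] by blast
  have sub: "is_subspace G S" using symp_subspace S by blast
  interpret S: shult "induced_geometry G S" using symp_shult S by blast
  have L': "L \<in> lines (induced_geometry G S)" using L S by simp
  have bL: "adj (induced_geometry G S) b x" if "x \<in> L" for x
    using b S that symp_adj_iff[OF S(1)] by blast
  define P where "P = S.plane_on L b"
  have P: "P \<subseteq> S" "is_subspace G P"
    using S.plane_on_subspace[OF L' b(1) bL] subspace_induced[OF sub] unfolding P_def by auto
  have adj: "adj G x y" if "x \<in> P" "y \<in> P" for x y
    using S.plane_on_adj[OF L' b(1) bL] that symp_adj_iff[OF S(1)] unfolding P_def by blast
  have sup: "L \<subseteq> P" "b \<in> P" using S.plane_on_superset[OF L' b(1) bL] unfolding P_def by auto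
  have "plane_of L e = P" if e: "e \<in> P" "e \<notin> L" for e
  proof
    show "plane_of L e \<subseteq> P" using generated_least[OF P(2)] e sup by blast
    show "P \<subseteq> plane_of L e"
      unfolding generated_subspace_def
    proof (rule Inter_greatest)
      fix K assume "K \<in> {K. is_subspace G K \<and> insert e L \<subseteq> K}"
      then have K: "is_subspace G K" "e \<in> K" "L \<subseteq> K" by auto
      have "is_subspace (induced_geometry G S) (K \<inter> S)"
        using subspace_induced[OF sub] subspace_Int[OF K(1) sub] by blast
      then have "P \<subseteq> K \<inter> S"
        using S.plane_on_least[OF L' b(1) bL, of "K \<inter> S" e] K S e P unfolding P_def by blast
      then show "P \<subseteq> K" by blast
    qed
  qed
  then show ?thesis using that P(2) adj sup by blast
qed

text \<open>Ensures that distinct planes through \<open>L\<close> meet in \<open>L\<close> only, as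
  the chains in \<open>locally_connected\<close> demand.\<close>

lemma plane_of_exchange:
  assumes L: "L \<in> lines G" and b: "b \<notin> L" "\<And>x. x \<in> L \<Longrightarrow> adj G b x"
    and e: "e \<in> plane_of L b" "e \<notin> L"
  shows "plane_of L e = plane_of L b"
proof -
  obtain P where P: "b \<in> P" "\<And>e. e \<in> P \<Longrightarrow> e \<notin> L \<Longrightarrow> plane_of L e = P"
    using plane_eq_plane_on[OF L b] by metis
  have "plane_of L b = P" using P b by blast
  then show ?thesis using P(2) e by blast
qed

lemma plane_of_singular_plane:
  assumes L: "L \<in> lines G" and b: "b \<notin> L" "\<And>x. x \<in> L \<Longrightarrow> adj G b x"
  shows "singular_plane G (plane_of L b)"
proof -
  obtain P where P: "is_subspace G P" "\<And>x y. x \<in> P \<Longrightarrow> y \<in> P \<Longrightarrow> adj G x y" "L \<subseteq> P" "b \<in> P"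
    "\<And>e. e \<in> P \<Longrightarrow> e \<notin> L \<Longrightarrow> plane_of L e = P"
    using plane_eq_plane_on[OF L b] by blast
  have eq: "plane_of L b = P" using P b by blast
  obtain x y where xy: "x \<in> L" "y \<in> L" "x \<noteq> y" using line_two L by blast
  have sing: "singular_subspace G P"
    unfolding singular_subspace_def using P(1,2) unfolding adj_def by blast
  have xyb: "{x, y, b} \<subseteq> P" using xy P(3,4) by auto
  have "generated_subspace G {x, y, b} = P"
  proof
    show "generated_subspace G {x, y, b} \<subseteq> P" using generated_least[OF P(1) xyb] .
    have "is_subspace G (generated_subspace G {x, y, b})"
      using generated_is_subspace[OF P(1) xyb] .
    then have "L \<subseteq> generated_subspace G {x, y, b}"
      using subspace_line[OF _ _ _ xy(3) L xy(1,2)] generated_superset[of "{x, y, b}" G] by blast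
    then show "P \<subseteq> generated_subspace G {x, y, b}"
      using generated_least[OF \<open>is_subspace G (generated_subspace G {x, y, b})\<close>, of "insert b L"]
        generated_superset[of "{x, y, b}" G] eq by blast
  qed
  moreover have "x \<noteq> b" "y \<noteq> b" using xy b(1) by auto
  then have "card {x, y, b} = 2 + 1" using xy(3) by simp
  moreover have "2 + 1 \<le> card B" if B: "B \<subseteq> P" "finite B" "generated_subspace G B = P" for B
  proof (rule ccontr)
    assume "\<not> 2 + 1 \<le> card B"
    \<comment> \<open>At most two pairwise collinear points lie on a line. Lines are subspaces, so
      such a set cannot generate \<open>P\<close>, which contains \<open>b\<close> off
      \<open>L\<close>.\<close>
    then consider "card B = 0" | "card B = 1" | "card B = 2" by linarith
    then have "\<exists>N\<in>lines G. B \<subseteq> N"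
    proof cases
      case 1
      then show ?thesis using B(2) L by auto
    next
      case 2
      then obtain u where u: "B = {u}" using card_1_singletonE by blast
      then have "u \<in> points G" using B(1) subspace_points[OF P(1)] by blast
      then show ?thesis using point_line u by blast
    next
      case 3
      then obtain u v where "B = {u, v}" "u \<noteq> v" using card_2_iff[of B] by blast
      then show ?thesis using adj_join[OF P(2), of u v] B(1) by blast
    qed
    then obtain N where N: "N \<in> lines G" "B \<subseteq> N" by blast
    then have "P \<subseteq> N" using generated_least[OF line_subspace[OF N(1)] N(2)] B(3) by blast
    then have "L = N" using partial_linear[OF L xy(1,2) N(1) _ _ xy(3)] xy P(3) by blast
    then show False using \<open>P \<subseteq> N\<close> P(4) b(1) by blast
  qed
  ultimately show ?thesis
    unfolding singular_plane_def singular_dim_def eq using sing xy P(3,4)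
    by (intro conjI exI[of _ "{x, y, b}"] allI impI) auto
qed

text \<open>The conclusion is strengthened for the induction: recording the last plane as spanned by
  the last line and a point \<open>u\<close> off it makes it comparable, by exchange, with the next
  plane through that line.\<close>

lemma link_chain_planes:
  assumes "(link G p)\<^sup>*\<^sup>* L M" "L \<in> lines G" "p \<in> L"
  shows "L = M \<or> (\<exists>Ps u. Ps \<noteq> [] \<and> (\<forall>P\<in>set Ps. singular_plane G P) \<and> L \<subseteq> hd Ps \<and>
    successively (\<lambda>P Q. P \<inter> Q \<in> lines G \<and> p \<in> P \<inter> Q) Ps \<and>
    last Ps = plane_of M u \<and> u \<notin> M \<and> (\<forall>x\<in>M. adj G u x))"
  using assms(1)
proof induction
  case (step M N)
  then obtain u v where M: "M \<in> lines G" "p \<in> M" and N: "N \<in> lines G" "p \<in> N"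
    and uv: "u \<in> M" "v \<in> N" "u \<noteq> p" "v \<noteq> p" "u = v \<or> collinear G u v"
    unfolding link_def by blast
  show ?case
  proof (cases "M = N")
    case True
    then show ?thesis using step by simp
  next
    case False
    have vM: "v \<notin> M" using partial_linear[OF M _ N uv(2)] uv(4) False by blast
    have uN: "u \<notin> N" using partial_linear[OF M uv(1) N] uv(3) False by blast
    have auv: "adj G u v" using uv(5) line_points[OF M(1) uv(1)] line_points[OF N(1) uv(2)]
      unfolding adj_def by blast
    have av: "adj G v x" if "x \<in> M" for x
      using line_all[OF M uv(1) uv(3)[symmetric] line_adj[OF N(1) uv(2) N(2)] adj_sym[OF auv] that] .
    have au: "adj G u x" if "x \<in> N" for x
      using line_all[OF N uv(2) uv(4)[symmetric] line_adj[OF M(1) uv(1) M(2)] auv that] .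
    \<comment> \<open>The triangle \<open>p\<close>, \<open>u\<close>, \<open>v\<close> spans one
      plane, whether described by \<open>M\<close> and \<open>v\<close> or by \<open>N\<close> and
      \<open>u\<close>.\<close>
    let ?Q = "plane_of M v"
    have ptsM: "insert v M \<subseteq> points G" "insert u N \<subseteq> points G"
      using line_points[OF M(1)] line_points[OF N(1)] uv by auto
    note gen = generated_is_subspace[OF subspace_points_self[OF plg]]
    have sM: "insert v M \<subseteq> ?Q" "insert u N \<subseteq> plane_of N u" by (rule generated_superset)+
    have "N \<subseteq> ?Q" using subspace_line[OF gen[OF ptsM(1)] _ _ uv(4) N(1) uv(2) N(2)] sM M(2) by blast
    then have "plane_of N u \<subseteq> ?Q" using generated_least[OF gen[OF ptsM(1)], of "insert u N"] sM(1) uv(1)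
      by blast
    moreover have "M \<subseteq> plane_of N u"
      using subspace_line[OF gen[OF ptsM(2)] _ _ uv(3) M(1) uv(1) M(2)] sM N(2) by blast
    then have "?Q \<subseteq> plane_of N u" using generated_least[OF gen[OF ptsM(2)], of "insert v M"] sM(2) uv(2)
      by blast
    ultimately have Q: "?Q = plane_of N u" by (rule antisym[rotated])
    have plane: "singular_plane G ?Q" using plane_of_singular_plane[OF M(1) vM av] .
    have new: "u \<notin> N \<and> (\<forall>x\<in>N. adj G u x)" using uN au by blast
    show ?thesis
    proof (cases "L = M")
      case True
      then have "L \<subseteq> ?Q" using sM by blast
      then show ?thesis using Q plane new by (intro disjI2 exI[of _ "[?Q]"] exI[of _ u]) simp
    next
      case nLM: False
      then obtain Ps w where Ps: "Ps \<noteq> []" "\<forall>P\<in>set Ps. singular_plane G P" "L \<subseteq> hd Ps"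
        "successively (\<lambda>P Q. P \<inter> Q \<in> lines G \<and> p \<in> P \<inter> Q) Ps"
        "last Ps = plane_of M w" "w \<notin> M" "\<forall>x\<in>M. adj G w x"
        using step.IH by auto
      show ?thesis
      \<comment> \<open>A plane equal to its predecessor is not appended, since neighbours in the
        chain have to meet in a line.\<close>
      proof (cases "plane_of M w = ?Q")
        case True
        then show ?thesis using Ps Q new by (intro disjI2 exI[of _ Ps] exI[of _ u]) simp
      next
        case nQ: False
        have "plane_of M w \<inter> ?Q = M"
        proof
          show "M \<subseteq> plane_of M w \<inter> ?Q"
            using generated_superset[of "insert w M" G] sM(1) by blast
          show "plane_of M w \<inter> ?Q \<subseteq> M"
          proof (rule subsetI, rule ccontr)
            fix e assume e: "e \<in> plane_of M w \<inter> ?Q" "e \<notin> M"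
            have "plane_of M e = plane_of M w"
              using plane_of_exchange[OF M(1) Ps(6), of e] Ps(7) e by blast
            moreover have "plane_of M e = ?Q"
              using plane_of_exchange[OF M(1) vM av, of e] e by blast
            ultimately show False using nQ by simp
          qed
        qed
        then have "last Ps \<inter> ?Q \<in> lines G \<and> p \<in> last Ps \<inter> ?Q" using Ps(5) M by simp
        then have "successively (\<lambda>P Q. P \<inter> Q \<in> lines G \<and> p \<in> P \<inter> Q) (Ps @ [?Q])"
          using Ps(4) by (simp add: successively_append_iff)
        then show ?thesis using Ps Q new plane
          by (intro disjI2 exI[of _ "Ps @ [?Q]"] exI[of _ u]) simp
      qed
    qed
  qed
qed simp

lemma locally_connected_of_links:
  assumes "\<And>p L M. \<lbrakk>L \<in> lines G; M \<in> lines G; p \<in> L; p \<in> M\<rbrakk> \<Longrightarrow> (link G p)\<^sup>*\<^sup>* L M"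
  shows "locally_connected G"
  unfolding locally_connected_def
proof (intro ballI impI)
  fix p L M assume "L \<in> lines G" "M \<in> lines G" "p \<in> L \<and> p \<in> M \<and> L \<noteq> M"
  then obtain Ps u where "Ps \<noteq> []" "\<forall>P\<in>set Ps. singular_plane G P" "L \<subseteq> hd Ps"
        "successively (\<lambda>P Q. P \<inter> Q \<in> lines G \<and> p \<in> P \<inter> Q) Ps" "last Ps = plane_of M u"
    using link_chain_planes[OF assms, of L M p] by blast
  then show "\<exists>Ps. Ps \<noteq> [] \<and> (\<forall>P\<in>set Ps. singular_plane G P) \<and> L \<subseteq> hd Ps \<and> M \<subseteq> last Ps \<and>
              successively (\<lambda>P Q. P \<inter> Q \<in> lines G \<and> p \<in> P \<inter> Q) Ps"
    using generated_superset[of "insert u M" G] by (intro exI[of _ Ps]) auto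
qed

text \<open>A point \<open>n\<close> off \<open>L\<close> and collinear to all of \<open>L\<close>
  (rank at least 3) gives a line \<open>pn\<close>, whose point \<open>m\<close> collinear to
  \<open>z\<close> spans with \<open>y\<close> a line \<open>K\<close> of common neighbours of
  \<open>p\<close> and \<open>z\<close>. The point \<open>t\<close> of \<open>K\<close> collinear to
  \<open>w\<close> provides the intermediate line \<open>pt\<close>.\<close>

lemma symp_links:
  assumes S: "symp G S" and S': "p \<in> S" "z \<in> S" "y \<in> S" "w \<in> S"
    and pz: "\<not> adj G p z" and y: "adj G p y" "adj G y z" and w: "adj G p w" "adj G w z"
    and L: "L \<in> lines G" "p \<in> L" "y \<in> L" and M: "M \<in> lines G" "p \<in> M" "w \<in> M"
  shows "(link G p)\<^sup>*\<^sup>* L M"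
proof -
  have py: "p \<noteq> y" "p \<noteq> w" using pz y w by auto
  note sub = symp_subspace[OF S]
  have LS: "L \<subseteq> S" using subspace_line[OF sub S'(1,3) py(1) L] .
  interpret S: shult "induced_geometry G S" using symp_shult S by blast
  obtain n where n: "n \<in> S" "n \<notin> L" "\<forall>x\<in>L. adj G n x" using symp_line_extends[OF S L(1) LS] by blast
  have "n \<noteq> p" using n L by blast
  moreover have "adj G n p" using n L by blast
  ultimately obtain N where N: "N \<in> lines G" "n \<in> N" "p \<in> N" using adj_join by blast
  have NS: "N \<subseteq> S" using subspace_line[OF sub n(1) S'(1) \<open>n \<noteq> p\<close> N] .
  obtain m where m: "m \<in> N" "adj G z m"
    using S.line_one[of N z] N NS S' symp_adj_iff[OF S] by auto
  have "m \<noteq> p" using m pz adj_sym[of G z p] by blast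
  have "m \<noteq> y" using partial_linear[OF N(1,3) m(1) L(1,2)] L(3) N(2) n(2) \<open>m \<noteq> p\<close> by blast
  have ym: "adj G y m"
    using line_all[OF N(1,3,2) \<open>n \<noteq> p\<close>[symmetric] adj_sym[OF y(1)] _ m(1)] n(3) L(3) adj_sym[of G n y]
      by blast
  then obtain K where K: "K \<in> lines G" "y \<in> K" "m \<in> K" using adj_join \<open>m \<noteq> y\<close> by metis
  have KS: "K \<subseteq> S" using subspace_line[OF sub S'(3) _ \<open>m \<noteq> y\<close>[symmetric] K] m NS by blast
  obtain t where t: "t \<in> K" "adj G w t"
    using S.line_one[of K w] K KS S' symp_adj_iff[OF S] by auto
  have pt: "adj G p t"
    using line_all[OF K \<open>m \<noteq> y\<close>[symmetric] y(1) line_adj[OF N(1,3) m(1)] t(1)] .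
  have "adj G z t" using line_all[OF K \<open>m \<noteq> y\<close>[symmetric] adj_sym[OF y(2)] m(2) t(1)] .
  then have "t \<noteq> p" using pz adj_sym[of G z p] by blast
  then obtain T where T: "T \<in> lines G" "p \<in> T" "t \<in> T" using adj_join[OF pt] by blast
  have "link G p L T"
    unfolding link_def using L T py \<open>t \<noteq> p\<close> line_adj[OF K(1,2) t(1)] unfolding adj_def by metis
  moreover have "link G p T M"
    unfolding link_def using M T py \<open>t \<noteq> p\<close> adj_sym[OF t(2)] unfolding adj_def by metis
  ultimately show ?thesis by (meson converse_rtranclp_into_rtranclp rtranclp.rtrancl_refl)
qed

text \<open>The neighbours in a symp \<open>S\<close> of a point \<open>x\<close> outside it are
  pairwise collinear, by closure. Yet if \<open>p\<close> in \<open>S\<close> is not collinear to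
  \<open>x\<close>, then \<open>x\<close> has neighbours other than \<open>p\<close> on two lines
  \<open>pa\<close> and \<open>pb\<close> with \<open>a\<close>, \<open>b\<close> noncollinear.
  Collinearity of these two neighbours would make \<open>a\<close> and \<open>b\<close>
  collinear.\<close>

lemma near_lines_symp:
  assumes ne: "points G \<noteq> {}"
    and near: "\<And>L p. L \<in> lines G \<Longrightarrow> p \<in> points G \<Longrightarrow> p \<notin> L \<Longrightarrow> \<exists>y\<in>L. collinear G p y"
  shows "symp G (points G)"
proof -
  obtain L where "L \<in> lines G" using ne point_line by blast
  then obtain S where S: "symp G S" "L \<subseteq> S" using line_in_symp by blast
  note sub = symp_subspace[OF S(1)]
  have "x \<in> S" if x: "x \<in> points G" for x
  proof (rule ccontr)
    assume xS: "x \<notin> S"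
    have clique: "adj G a b" if ab: "a \<in> S" "b \<in> S" "collinear G x a" "collinear G x b" for a b
    proof (rule ccontr)
      assume "\<not> adj G a b"
      then have "a \<noteq> b" "\<not> collinear G a b" using ab symp_sub[OF S(1)] unfolding adj_def by auto
      then show False using symp_closed[OF S(1) ab(1,2) _ _ collinear_sym[OF ab(3)] ab(4)] xS by blast
    qed
    obtain p where p: "p \<in> S" "\<not> collinear G x p"
    proof -
      obtain a where a: "a \<in> S" using symp_nonempty[OF S(1)] by blast
      obtain b where b: "b \<in> S" "a \<noteq> b" "\<not> collinear G a b" using symp_noncollinear[OF S(1) a] by blast
      then have "\<not> (collinear G x a \<and> collinear G x b)" using clique[OF a b(1)] unfolding adj_def
        by blast
      then show ?thesis using that a b by blast
    qed
    obtain q where q: "q \<in> S" "p \<noteq> q" "\<not> collinear G p q" using symp_noncollinear[OF S(1) p(1)] by blast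
    obtain a where a: "a \<in> S" "collinear G p a" "collinear G a q"
      using symp_common_neighbour[OF S(1) p(1) q] by blast
    obtain b where b: "b \<in> S" "collinear G p b" "collinear G b q" "a \<noteq> b" "\<not> collinear G a b"
      using symp_neighbour_pair[OF S(1) p(1) q a] by blast
    have meet: "\<exists>N c. N \<in> lines G \<and> p \<in> N \<and> v \<in> N \<and> c \<in> N \<and> c \<in> S \<and> c \<noteq> p \<and> collinear G x c"
      if v: "v \<in> S" "collinear G p v" for v
    proof -
      obtain N where N: "N \<in> lines G" "p \<in> N" "v \<in> N" using v unfolding collinear_def by blast
      have "p \<noteq> v" using v(2) unfolding collinear_def by blast
      then have NS: "N \<subseteq> S" using subspace_line[OF sub p(1) v(1) _ N] by blast
      then have "x \<notin> N" using xS by blast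
      then obtain c where "c \<in> N" "collinear G x c" using near[OF N(1) x] by blast
      then show ?thesis using N NS p(2) by blast
    qed
    obtain A a' where A: "A \<in> lines G" "p \<in> A" "a \<in> A" "a' \<in> A" "a' \<in> S" "a' \<noteq> p" "collinear G x a'"
      using meet[OF a(1,2)] by blast
    obtain B b' where B: "B \<in> lines G" "p \<in> B" "b \<in> B" "b' \<in> B" "b' \<in> S" "b' \<noteq> p" "collinear G x b'"
      using meet[OF b(1,2)] by blast
    have "adj G b' a'" using clique[OF B(5) A(5) B(7) A(7)] .
    then have "adj G b' a"
      using line_all[OF A(1,2,4) A(6)[symmetric] line_adj[OF B(1,4,2)] _ A(3)] by blast
    then have "adj G a b"
      using line_all[OF B(1,2,4) B(6)[symmetric] line_adj[OF A(1,3,2)] _ B(3)] adj_sym[of G b' a]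
        by blast
    then show False using b(4,5) unfolding adj_def by blast
  qed
  then have "points G = S" using subspace_points[OF sub] by blast
  then show ?thesis using S by simp
qed

lemma parapolar_of_far_line:
  assumes "connected_geometry G" and far: "L \<in> lines G" "p \<in> points G" "p \<notin> L" "\<forall>y\<in>L. \<not> collinear G p y"
  shows "parapolar_space G"
proof -
  have "(\<forall>y\<in>L. \<not> collinear G p y) \<or> (\<exists>!y. y \<in> L \<and> collinear G p y) \<or> (\<forall>y\<in>L. collinear G p y)"
    if L: "L \<in> lines G" "p \<in> points G - L" for L p
  proof (rule ccontr)
    assume no: "\<not> ?thesis"
    then obtain y where y: "y \<in> L" "collinear G p y" by blast
    then obtain z where z: "z \<in> L" "collinear G p z" "y \<noteq> z" using no by blast
    have "\<forall>w\<in>L. collinear G p w" using one_or_all[OF L(1) _ _ y(1) z(1,3) y(2) z(2)] L(2) by blast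
    then show False using no by blast
  qed
  moreover have "polar_space (induced_geometry G (convex_closure G {p, q})) \<or> (\<exists>x. perp G p \<inter> perp G q =
    {x})"
    if pq: "p \<in> points G" "q \<in> points G" "p \<noteq> q" "\<not> collinear G p q" "perp G p \<inter> perp G q \<noteq> {}" for p q
  proof -
    obtain r where "r \<in> perp G p" "r \<in> perp G q" using pq(5) by blast
    moreover have perp: "s \<in> perp G p \<inter> perp G q \<longleftrightarrow> collinear G p s \<and> collinear G s q" for s
      using pq(3,4) collinear_sym[of G] collinear_points[OF plg, of p s] unfolding perp_def by blast
    ultimately have r: "collinear G p r" "collinear G r q" by auto
    consider S where "symp G S" "p \<in> S" "q \<in> S" | "\<forall>s. collinear G p s \<and> collinear G s q \<longrightarrow> s = r"
      using symp_or_unique[OF r pq(3,4)] by blast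
    then show ?thesis
    proof cases
      case 1
      then show ?thesis using symp_convex_closure[OF 1 pq(3,4)] symp_polar[OF 1(1)] by simp
    next
      case 2
      then have "perp G p \<inter> perp G q = {r}" using perp r by blast
      then show ?thesis by blast
    qed
  qed
  moreover have "\<exists>S. symplecton G S \<and> L \<subseteq> S" if "L \<in> lines G" for L
    using line_in_symp[OF that] symplecton_iff_symp[OF plg] by blast
  moreover have "\<exists>L\<in>lines G. \<exists>p\<in>points G - L. \<forall>y\<in>L. \<not> collinear G p y" using far by blast
  ultimately show ?thesis unfolding parapolar_space_def using assms(1) plg by simp
qed

end

section \<open>Unbuttoning\<close>

text \<open>The map \<open>\<pi>\<close> sends a point of the disjoint union \<open>X\<close> of the sheets to its class. The last three
  axioms are the first button condition for closed walks of two, three and four collinear steps: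
  primed and unprimed letters are the two ends of a jump inside a class.\<close>

locale unbuttoning =
  fixes X :: "'b geometry" and G :: "'a geometry" and \<pi> :: "'b \<Rightarrow> 'a"
  assumes plgX: "point_line_geometry X" and plgG: "point_line_geometry G"
    and lines_image: "lines G = image \<pi> ` lines X"
    and collinear_neq: "collinear X x y \<Longrightarrow> \<pi> x \<noteq> \<pi> y"
    and digon: "\<lbrakk>collinear X x y; collinear X y' x'; \<pi> x' = \<pi> x; \<pi> y' = \<pi> y\<rbrakk> \<Longrightarrow> x' = x"
    and triangle: "\<lbrakk>collinear X x y; collinear X y' z; collinear X z' x';
      \<pi> x' = \<pi> x; \<pi> y' = \<pi> y; \<pi> z' = \<pi> z\<rbrakk> \<Longrightarrow> x' = x"
    and quadrangle: "\<lbrakk>collinear X x y; collinear X y' z; collinear X z' w; collinear X w' x';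
      \<pi> x' = \<pi> x; \<pi> y' = \<pi> y; \<pi> z' = \<pi> z; \<pi> w' = \<pi> w; \<pi> x \<noteq> \<pi> z\<rbrakk> \<Longrightarrow> x' = x"
begin

section \<open>Lifting edges and symps along the class map\<close>

lemma line_pair: "L \<in> lines X \<Longrightarrow> x \<in> L \<Longrightarrow> \<exists>y\<in>L. collinear X x y"
  using plgX unfolding point_line_geometry_def collinear_def by metis

lemma push_collinear:
  assumes "collinear X x y"
  shows "collinear G (\<pi> x) (\<pi> y)"
  using collinear_neq[OF assms] assms unfolding collinear_def lines_image by blast

lemma lift_in_line:
  assumes "L \<in> lines X" "u \<in> \<pi> ` L" "v \<in> \<pi> ` L" "u \<noteq> v"
  shows "\<exists>x y. x \<in> L \<and> y \<in> L \<and> \<pi> x = u \<and> \<pi> y = v \<and> collinear X x y"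
  using assms unfolding collinear_def by blast

lemma lift_collinear: "collinear G u v \<Longrightarrow> \<exists>x y. collinear X x y \<and> \<pi> x = u \<and> \<pi> y = v"
proof -
  assume "collinear G u v"
  then obtain L where L: "L \<in> lines X" "u \<in> \<pi> ` L" "v \<in> \<pi> ` L" "u \<noteq> v"
    unfolding collinear_def lines_image by blast
  show ?thesis using lift_in_line[OF L] by blast
qed

lemma iso_induced:
  assumes "inj_on \<pi> U" "\<And>L. L \<in> lines X \<Longrightarrow> \<pi> ` L \<subseteq> \<pi> ` U \<Longrightarrow> L \<subseteq> U"
  shows "geometry_iso \<pi> (induced_geometry X U) (induced_geometry G (\<pi> ` U))"
proof
  show "lines (induced_geometry G (\<pi> ` U)) = (`) \<pi> ` lines (induced_geometry X U)"
    (is "?l = ?r")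
  proof
    show "?l \<subseteq> ?r"
    proof
      fix M assume "M \<in> ?l"
      then obtain L where L: "L \<in> lines X" "M = \<pi> ` L" "M \<subseteq> \<pi> ` U" using lines_image by auto
      then show "M \<in> ?r" using assms(2)[of L] by simp
    qed
    show "?r \<subseteq> ?l" using lines_image by auto
  qed
qed (use assms(1) in auto)

text \<open>Inside \<open>T\<close> the points \<open>x\<close> and \<open>y\<close> are joined by
  at most two steps; with the edge \<open>x'y'\<close> they form a closed walk of two or three
  steps.\<close>

lemma lift_unique_in_symp:
  assumes T: "symp X T" "x \<in> T" "y \<in> T" and xy': "collinear X x' y'" "\<pi> x' = \<pi> x" "\<pi> y' = \<pi> y"
  shows "x' = x" "y' = y"
proof -
  have "x \<noteq> y" using collinear_neq[OF xy'(1)] xy' by auto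
  show "x' = x"
  proof (cases "collinear X x y")
    case True
    then show ?thesis using digon[OF True collinear_sym[OF xy'(1)] xy'(2,3)] by simp
  next
    case False
    obtain z where "collinear X x z" "collinear X z y"
      using symp_common_neighbour[OF T \<open>x \<noteq> y\<close> False] by blast
    then show ?thesis using triangle[OF _ _ collinear_sym[OF xy'(1)] xy'(2) _ xy'(3)] by blast
  qed
  show "y' = y"
  proof (cases "collinear X x y")
    case True
    then show ?thesis using digon[OF collinear_sym[OF True] xy'(1,3,2)] by simp
  next
    case False
    obtain z where "collinear X x z" "collinear X z y"
      using symp_common_neighbour[OF T \<open>x \<noteq> y\<close> False] by blast
    then show ?thesis using triangle[OF _ _ xy'(1) xy'(3) _ xy'(2)] collinear_sym by metis
  qed
qed

text \<open>Two points of a symp with the same image are noncollinear, so they have a common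
  neighbour, and going there and back is a digon.\<close>

lemma symp_inj:
  assumes T: "symp X T"
  shows "inj_on \<pi> T"
proof (rule inj_onI, rule ccontr)
  fix x y assume xy: "x \<in> T" "y \<in> T" "\<pi> x = \<pi> y" "x \<noteq> y"
  then have "\<not> collinear X x y" using collinear_neq by blast
  then obtain z where "collinear X x z" "collinear X z y" using symp_common_neighbour[OF T xy(1,2,4)]
    by blast
  then show False using digon[of x z z y] xy(3,4) by simp
qed

lemma symp_line_subset:
  assumes T: "symp X T" and L: "L \<in> lines X" "\<pi> ` L \<subseteq> \<pi> ` T"
  shows "L \<subseteq> T"
proof
  fix x assume x: "x \<in> L"
  then obtain y where y: "y \<in> L" "collinear X x y" using line_pair L by blast
  obtain a b where "a \<in> T" "b \<in> T" "\<pi> x = \<pi> a" "\<pi> y = \<pi> b" using L(2) x y(1) by blast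
  then show "x \<in> T" using lift_unique_in_symp[OF T _ _ y(2)] by metis
qed

lemma symp_iso:
  assumes "symp X T"
  shows "geometry_iso \<pi> (induced_geometry X T) (induced_geometry G (\<pi> ` T))"
  using iso_induced[OF symp_inj[OF assms] symp_line_subset[OF assms]] .

lemma push_symp:
  assumes T: "symp X T"
  shows "symp G (\<pi> ` T)"
  unfolding symp_def
proof (intro conjI ballI allI impI)
  show sub: "is_subspace G (\<pi> ` T)"
  proof (rule subspaceI)
    show "\<pi> ` T \<subseteq> points G"
    proof
      fix u assume "u \<in> \<pi> ` T"
      then obtain x where x: "x \<in> T" "u = \<pi> x" by blast
      then obtain L where L: "L \<in> lines X" "x \<in> L" using symp_line_through[OF T] by blast
      then have "\<pi> ` L \<in> lines G" "u \<in> \<pi> ` L" using x unfolding lines_image by auto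
      then show "u \<in> points G" using plgG unfolding point_line_geometry_def by blast
    qed
    fix u v M assume uv: "u \<in> \<pi> ` T" "v \<in> \<pi> ` T" "u \<noteq> v" "M \<in> lines G" "u \<in> M" "v \<in> M"
    obtain L where L: "L \<in> lines X" "M = \<pi> ` L" using uv(4) unfolding lines_image by blast
    obtain x y where xy: "x \<in> L" "y \<in> L" "\<pi> x = u" "\<pi> y = v" "collinear X x y"
      using lift_in_line[OF L(1) _ _ uv(3)] uv L(2) by metis
    obtain a b where ab: "a \<in> T" "b \<in> T" "u = \<pi> a" "v = \<pi> b" using uv by blast
    have "x \<in> T" "y \<in> T" using lift_unique_in_symp[OF T ab(1,2) xy(5)] ab xy(3,4) by simp_all
    moreover have "x \<noteq> y" using xy(5) unfolding collinear_def by blast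
    ultimately have "L \<subseteq> T" using subspace_line[OF symp_subspace[OF T]] L(1) xy(1,2) by metis
    then show "M \<subseteq> \<pi> ` T" using L by blast
  qed
  show "polar_space (induced_geometry G (\<pi> ` T))"
    using geometry_iso.push_polar[OF symp_iso[OF T] symp_polar[OF T]] .
  fix u v w assume "u \<in> \<pi> ` T" "v \<in> \<pi> ` T"
    and uv: "u \<noteq> v \<and> \<not> collinear G u v \<and> collinear G u w \<and> collinear G w v"
  then obtain x y where xy: "x \<in> T" "y \<in> T" "u = \<pi> x" "v = \<pi> y" by blast
  then have nxy: "x \<noteq> y" "\<not> collinear X x y" using uv push_collinear by auto
  obtain z where z: "z \<in> T" "collinear X x z" "collinear X z y"
    using symp_common_neighbour[OF T xy(1,2) nxy] by blast
  obtain x1 w1 where w1: "collinear X x1 w1" "\<pi> x1 = u" "\<pi> w1 = w" using lift_collinear uv by blast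
  obtain w2 y2 where w2: "collinear X w2 y2" "\<pi> w2 = w" "\<pi> y2 = v" using lift_collinear uv by blast
  show "w \<in> \<pi> ` T"
  \<comment> \<open>The image quadrangle has corners \<open>u\<close>, \<open>\<pi> z\<close>,
    \<open>v\<close>, \<open>w\<close>. Applied at \<open>u\<close>, \<open>v\<close> and
    \<open>w\<close>, the quadrangle axiom shows that the lifted edges share their ends, so
    \<open>w1\<close> is a common neighbour of \<open>x\<close> and \<open>y\<close>. At
    \<open>w\<close> the axiom requires the opposite corner \<open>\<pi> z\<close> to be different,
    whence the case distinction.\<close>
  proof (cases "w = \<pi> z")
    case False
    have x1: "x1 = x"
      using quadrangle[OF z(2,3) collinear_sym[OF w2(1)] collinear_sym[OF w1(1)]] xy w1 w2 uv by simp
    have y2: "y2 = y"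
      using quadrangle[OF collinear_sym[OF z(3)] collinear_sym[OF z(2)] w1(1) w2(1)] xy w1 w2 uv by auto
    have "w2 = w1"
      using quadrangle[OF collinear_sym[OF w1(1)] _ z(3) collinear_sym[OF w2(1)], of x z]
        z(2) x1 y2 w1 w2 False by simp
    then have "w1 \<in> T" using symp_closed[OF T xy(1,2) nxy] w1(1) w2(1) x1 y2 by simp
    then show ?thesis using w1(3) by blast
  qed (use z in blast)
qed

text \<open>Preimages \<open>a\<close> in \<open>T\<close> and \<open>b\<close> in \<open>U\<close>
  of one point are each at most two steps from the common point \<open>y\<close>, giving a walk of
  at most four steps from \<open>a\<close> to \<open>b\<close>. The image of \<open>y\<close> is
  treated apart because the quadrangle axiom requires distinct opposite classes.\<close>

lemma symp_Int_image:
  assumes T: "symp X T" "symp X U" and y: "y \<in> T" "y \<in> U"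
  shows "\<pi> ` (T \<inter> U) = \<pi> ` T \<inter> \<pi> ` U"
proof
  show "\<pi> ` T \<inter> \<pi> ` U \<subseteq> \<pi> ` (T \<inter> U)"
  proof
    fix u assume "u \<in> \<pi> ` T \<inter> \<pi> ` U"
    then obtain a b where a: "a \<in> T" "\<pi> a = u" and b: "b \<in> U" "\<pi> b = u" by (auto simp: image_iff)
    show "u \<in> \<pi> ` (T \<inter> U)"
    proof (cases "u = \<pi> y")
      case False
      then have ne: "a \<noteq> y" "b \<noteq> y" using a b by auto
      have near: "collinear X c y \<or> (\<exists>z. collinear X c z \<and> collinear X z y)"
        if "symp X V" "c \<in> V" "y \<in> V" "c \<noteq> y" for c V
        using symp_common_neighbour[OF that] by blast
      have "a = b"
        using near[OF T(1) a(1) y(1) ne(1)]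
      proof (elim disjE exE conjE)
        assume ay: "collinear X a y"
        show ?thesis using near[OF T(2) b(1) y(2) ne(2)]
        proof (elim disjE exE conjE)
          assume "collinear X b y"
          then show ?thesis using digon[of b y y a] collinear_sym[OF ay] a b by simp
        next
          fix z assume "collinear X b z" "collinear X z y"
          then show ?thesis using triangle[of b z z y y a] collinear_sym[OF ay] a b by simp
        qed
      next
        fix w assume aw: "collinear X a w" "collinear X w y"
        show ?thesis using near[OF T(2) b(1) y(2) ne(2)]
        proof (elim disjE exE conjE)
          assume "collinear X b y"
          then show ?thesis
            using triangle[of b y y w w a] collinear_sym[OF aw(1)] collinear_sym[OF aw(2)] a b by simp
        next
          fix z assume "collinear X b z" "collinear X z y"
          then show ?thesis
            using quadrangle[of b z z y y w w a] collinear_sym[OF aw(1)] collinear_sym[OF aw(2)] a b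
              False
            by simp
        qed
      qed
      then show ?thesis using a b by blast
    qed (use y in blast)
  qed
qed blast

lemma symp_image_subset:
  assumes T: "symp X T" "symp X U" and sub: "\<pi> ` T \<subseteq> \<pi> ` U"
  shows "T \<subseteq> U"
proof
  fix x assume x: "x \<in> T"
  obtain L where L: "L \<in> lines X" "L \<subseteq> T" "x \<in> L" using symp_line_through[OF T(1) x] by blast
  then have "\<pi> ` L \<subseteq> \<pi> ` U" using sub by blast
  then show "x \<in> U" using symp_line_subset[OF T(2) L(1)] L(3) by blast
qed

text \<open>Any two lines of a symp of \<open>G\<close> through a point \<open>p\<close> are opposite sides of a digon, a triangle or a
  quadrangle through \<open>p\<close> in this symp, so their lifts pass through the same point above \<open>p\<close>.\<close>

lemma lift_symp:
  assumes S: "symp G S"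
  obtains T where "symp X T" "\<pi> ` T = S"
proof -
  \<comment> \<open>Whole lines are lifted rather than points, because a single point of
    \<open>S\<close> may have several preimages.\<close>
  define T where "T = {x. \<exists>L\<in>lines X. x \<in> L \<and> \<pi> ` L \<subseteq> S}"
  have image: "\<pi> ` T = S"
  proof
    show "S \<subseteq> \<pi> ` T"
    proof
      fix p assume "p \<in> S"
      then obtain M where M: "M \<in> lines G" "M \<subseteq> S" "p \<in> M" using symp_line_through[OF S] by blast
      then obtain L where "L \<in> lines X" "M = \<pi> ` L" unfolding lines_image by blast
      then show "p \<in> \<pi> ` T" using M unfolding T_def by blast
    qed
  qed (use T_def in blast)
  have lineT: "L \<subseteq> T" if "L \<in> lines X" "\<pi> ` L \<subseteq> S" for L
    using that unfolding T_def by blast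
  have inj: "inj_on \<pi> T"
  proof (rule inj_onI)
    fix x x' assume x: "x \<in> T" "x' \<in> T" "\<pi> x = \<pi> x'"
    obtain L where L: "L \<in> lines X" "x \<in> L" "\<pi> ` L \<subseteq> S" using x(1) unfolding T_def by blast
    obtain L' where L': "L' \<in> lines X" "x' \<in> L'" "\<pi> ` L' \<subseteq> S" using x(2) unfolding T_def by blast
    obtain y where y: "y \<in> L" "collinear X x y" using line_pair L by blast
    obtain y' where y': "y' \<in> L'" "collinear X x' y'" using line_pair L' by blast
    have S': "\<pi> x \<in> S" "\<pi> y \<in> S" "\<pi> y' \<in> S" using L L' y y' by auto
    consider "\<pi> y = \<pi> y'" | "collinear G (\<pi> y) (\<pi> y')" | "\<pi> y \<noteq> \<pi> y'" "\<not> collinear G (\<pi> y) (\<pi> y')"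
      by blast
    then have "x' = x"
    proof cases
      case 1
      then show ?thesis using digon[OF y(2) collinear_sym[OF y'(2)]] x(3) by simp
    next
      case 2
      then obtain a b where "collinear X a b" "\<pi> a = \<pi> y" "\<pi> b = \<pi> y'" using lift_collinear by blast
      then show ?thesis using triangle[OF y(2) _ collinear_sym[OF y'(2)], of a b] x(3) by simp
    next
      case 3
      have "collinear G (\<pi> y) (\<pi> x)" "collinear G (\<pi> x) (\<pi> y')"
        using push_collinear[OF collinear_sym[OF y(2)]] push_collinear[OF y'(2)] x(3) by simp_all
      \<comment> \<open>The fourth corner of the quadrangle: a common neighbour different from
        \<open>\<pi> x\<close>, as the quadrangle axiom requires.\<close>
      then obtain t where t: "collinear G (\<pi> y) t" "collinear G t (\<pi> y')" "\<pi> x \<noteq> t"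
        using symp_neighbour_pair[OF S S'(2,3) 3 S'(1)] by blast
      obtain a b where "collinear X a b" "\<pi> a = \<pi> y" "\<pi> b = t" using lift_collinear t(1) by blast
      moreover obtain c d where "collinear X c d" "\<pi> c = t" "\<pi> d = \<pi> y'" using lift_collinear t(2)
        by blast
      ultimately show ?thesis using quadrangle[OF y(2) _ _ collinear_sym[OF y'(2)], of a b c d] x(3) t(3)
        by simp
    qed
    then show "x = x'" by simp
  qed
  have sub: "is_subspace X T"
  proof (rule subspaceI)
    show "T \<subseteq> points X" using plgX unfolding T_def point_line_geometry_def by blast
    fix x y L assume xy: "x \<in> T" "y \<in> T" "x \<noteq> y" "L \<in> lines X" "x \<in> L" "y \<in> L"
    have "\<pi> x \<noteq> \<pi> y" using inj_onD[OF inj] xy by blast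
    moreover have "\<pi> x \<in> S" "\<pi> y \<in> S" using xy image by auto
    moreover have "\<pi> ` L \<in> lines G" using xy unfolding lines_image by blast
    ultimately have "\<pi> ` L \<subseteq> S" using subspace_line[OF symp_subspace[OF S]] xy by blast
    then show "L \<subseteq> T" using lineT xy by blast
  qed
  have "geometry_iso \<pi> (induced_geometry X T) (induced_geometry G S)"
    using iso_induced[OF inj] lineT image by simp
  then have "polar_space (induced_geometry X T)"
    using geometry_iso.push_polar[OF geometry_iso.inverse symp_polar[OF S]] by blast
  moreover have "z \<in> T"
    if z: "x \<in> T" "y \<in> T" "x \<noteq> y" "\<not> collinear X x y" "collinear X x z" "collinear X z y"
    for x y z
  proof -
    have S': "\<pi> x \<in> S" "\<pi> y \<in> S" "\<pi> x \<noteq> \<pi> y" using z image inj_onD[OF inj] by auto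
    have "\<not> collinear G (\<pi> x) (\<pi> y)"
    proof
      assume "collinear G (\<pi> x) (\<pi> y)"
      then obtain M where M: "M \<in> lines G" "\<pi> x \<in> M" "\<pi> y \<in> M" unfolding collinear_def by blast
      then have "M \<subseteq> S" using subspace_line[OF symp_subspace[OF S] S'] by blast
      obtain L where L: "L \<in> lines X" "M = \<pi> ` L" using M unfolding lines_image by blast
      obtain a b where ab: "a \<in> L" "b \<in> L" "\<pi> a = \<pi> x" "\<pi> b = \<pi> y" "collinear X a b"
        using lift_in_line[OF L(1) _ _ S'(3)] M L(2) by metis
      have "a \<in> T" "b \<in> T" using lineT[OF L(1)] ab \<open>M \<subseteq> S\<close> L(2) by auto
      then have "a = x" "b = y" using inj_onD[OF inj] ab z by auto
      then show False using ab(5) z(4) by simp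
    qed
    then have "\<pi> z \<in> S" using symp_closed[OF S S'] push_collinear z by blast
    obtain L where L: "L \<in> lines X" "x \<in> L" "z \<in> L" using z(5) unfolding collinear_def by blast
    have "\<pi> ` L \<in> lines G" using L unfolding lines_image by blast
    then have "\<pi> ` L \<subseteq> S"
      using subspace_line[OF symp_subspace[OF S] S'(1) \<open>\<pi> z \<in> S\<close> collinear_neq[OF z(5)]] L by blast
    then show ?thesis using lineT L by blast
  qed
  ultimately have "symp X T" unfolding symp_def using sub by blast
  then show ?thesis using that image by blast
qed

lemma symp_rank_iff:
  assumes T: "symp X T"
  shows "polar_space_of_rank_at_least (induced_geometry G (\<pi> ` T)) d \<longleftrightarrow>
    polar_space_of_rank_at_least (induced_geometry X T) d"
  using geometry_iso.push_rank[OF symp_iso[OF T]]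
    geometry_iso.push_rank[OF geometry_iso.inverse[OF symp_iso[OF T]]]
  unfolding polar_space_of_rank_at_least_def by blast

lemma symplectic_rank_iff: "symplectic_rank_at_least d G \<longleftrightarrow> symplectic_rank_at_least d X"
  unfolding symplectic_rank_at_least_def symplecton_iff_symp[OF plgX] symplecton_iff_symp[OF plgG]
  using push_symp lift_symp symp_rank_iff by metis

text \<open>Dimension depends only on the induced geometry, and \<open>\<pi>\<close> restricts to an
  isomorphism on the intersection.\<close>

lemma symp_Int_singular_dim_iff:
  assumes T: "symp X T" "symp X U" and y: "y \<in> T" "y \<in> U"
  shows "singular_dim G (\<pi> ` T \<inter> \<pi> ` U) k \<longleftrightarrow> singular_dim X (T \<inter> U) k"
proof -
  note eq = symp_Int_image[OF T y]
  have "geometry_iso \<pi> (induced_geometry X (T \<inter> U)) (induced_geometry G (\<pi> ` (T \<inter> U)))"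
  proof (rule iso_induced)
    show "inj_on \<pi> (T \<inter> U)" using symp_inj[OF T(1)] inj_on_subset by blast
    show "L \<subseteq> T \<inter> U" if "L \<in> lines X" "\<pi> ` L \<subseteq> \<pi> ` (T \<inter> U)" for L
      using symp_line_subset[OF T(1) that(1)] symp_line_subset[OF T(2) that(1)] that(2) by blast
  qed
  then interpret iso: geometry_iso \<pi> "induced_geometry X (T \<inter> U)" "induced_geometry G (\<pi> ` T \<inter> \<pi> ` U)"
    unfolding eq .
  have sub: "is_subspace X (T \<inter> U)" "is_subspace G (\<pi> ` T \<inter> \<pi> ` U)"
    using subspace_Int symp_subspace T push_symp by blast+
  have "singular_dim G (\<pi> ` T \<inter> \<pi> ` U) k \<longleftrightarrow>
      singular_dim (induced_geometry G (\<pi> ` T \<inter> \<pi> ` U)) (\<pi> ` (T \<inter> U)) k"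
    using singular_dim_induced[OF sub(2)] eq by simp
  also have "\<dots> \<longleftrightarrow> singular_dim (induced_geometry X (T \<inter> U)) (T \<inter> U) k"
    using iso.push_singular_dim[of "T \<inter> U" k] iso.cancel[of "T \<inter> U"]
      geometry_iso.push_singular_dim[OF iso.inverse, of "\<pi> ` (T \<inter> U)" k] by auto
  also have "\<dots> \<longleftrightarrow> singular_dim X (T \<inter> U) k"
    using singular_dim_induced[OF sub(1)] by simp
  finally show ?thesis .
qed

end

text \<open>Two of the generators already span a line. This is how \<open>k \<ge> 1\<close> is used:
  symps with a \<open>k\<close>-dimensional intersection share a line.\<close>

lemma singular_dim_line:
  assumes "singular_dim G U k" "k \<ge> 1"
  shows "\<exists>L\<in>lines G. L \<subseteq> U"
proof -
  obtain B where B: "B \<subseteq> U" "finite B" "card B = k + 1" and U: "singular_subspace G U"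
    using assms unfolding singular_dim_def by blast
  then have "\<not> card B \<le> Suc 0" using assms by simp
  then obtain x y where xy: "x \<in> B" "y \<in> B" "x \<noteq> y" using card_le_Suc0_iff_eq[OF B(2)] by blast
  then obtain L where L: "L \<in> lines G" "x \<in> L" "y \<in> L"
    using U B(1) unfolding singular_subspace_def collinear_def by blast
  then show ?thesis
    using subspace_line[of G U x y L] xy B(1) U unfolding singular_subspace_def by blast
qed

context unbuttoning
begin

text \<open>By \<open>symp_line_subset\<close>, any lift of a line common to two symps lies in the
  lifts of both. These lifts thus have the common point required for comparing
  intersections.\<close>

lemma lacunary_iff:
  assumes k: "k \<ge> 1"
  shows "lacunary k G \<longleftrightarrow> lacunary k X"
proof -
  have "(\<exists>S S'. symp G S \<and> symp G S' \<and> S \<noteq> S' \<and> singular_dim G (S \<inter> S') k) \<longleftrightarrow>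
    (\<exists>T U. symp X T \<and> symp X U \<and> T \<noteq> U \<and> singular_dim X (T \<inter> U) k)" (is "?l \<longleftrightarrow> ?r")
  proof
    assume ?l
    then obtain S S' where S: "symp G S" "symp G S'" "S \<noteq> S'" "singular_dim G (S \<inter> S') k" by blast
    obtain T where T: "symp X T" "\<pi> ` T = S" using lift_symp[OF S(1)] .
    obtain U where U: "symp X U" "\<pi> ` U = S'" using lift_symp[OF S(2)] .
    obtain M where "M \<in> lines G" "M \<subseteq> S \<inter> S'" using singular_dim_line[OF S(4) k] by blast
    then obtain L where L: "L \<in> lines X" "\<pi> ` L \<subseteq> S \<inter> S'" unfolding lines_image by blast
    then have "L \<subseteq> T \<inter> U" using symp_line_subset T U by blast
    moreover obtain y where "y \<in> L" using plgX L(1) unfolding point_line_geometry_def by blast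
    ultimately have "singular_dim X (T \<inter> U) k" using symp_Int_singular_dim_iff[OF T(1) U(1)] T U S
      by blast
    then show ?r using T U S(3) by blast
  next
    assume ?r
    then obtain T U where T: "symp X T" "symp X U" "T \<noteq> U" "singular_dim X (T \<inter> U) k" by blast
    obtain L where L: "L \<in> lines X" "L \<subseteq> T \<inter> U" using singular_dim_line[OF T(4) k] by blast
    obtain y where "y \<in> L" using plgX L(1) unfolding point_line_geometry_def by blast
    then have "y \<in> T" "y \<in> U" using L(2) by auto
    then have "singular_dim G (\<pi> ` T \<inter> \<pi> ` U) k" using symp_Int_singular_dim_iff[OF T(1,2)] T by blast
    moreover have "\<pi> ` T \<noteq> \<pi> ` U" using symp_image_subset[of T U] symp_image_subset[of U T] T by blast
    ultimately show ?l using push_symp T by blast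
  qed
  then show ?thesis
    unfolding lacunary_def symplecton_iff_symp[OF plgX] symplecton_iff_symp[OF plgG] symplectic_rank_iff
    by simp
qed

lemma pre_parapolar_lift:
  assumes "pre_parapolar G"
  shows "pre_parapolar X"
proof
  interpret G: pre_parapolar G by (rule assms)
  show "point_line_geometry X" by (rule plgX)
  show "polar_space_of_rank_at_least (induced_geometry X S) 3" if "symp X S" for S
    using G.rank_three[OF push_symp[OF that]] symp_rank_iff[OF that] by blast
  show "\<exists>S. symp X S \<and> L \<subseteq> S" if "L \<in> lines X" for L
  proof -
    have "\<pi> ` L \<in> lines G" using that unfolding lines_image by blast
    then obtain S where S: "symp G S" "\<pi> ` L \<subseteq> S" using G.line_in_symp by blast
    obtain T where T: "symp X T" "\<pi> ` T = S" using lift_symp[OF S(1)] .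
    show ?thesis using symp_line_subset[OF T(1) that] S T by blast
  qed
  show "collinear X p w" if h: "L \<in> lines X" "p \<in> points X" "p \<notin> L" "y \<in> L" "z \<in> L" "y \<noteq> z"
    "collinear X p y" "collinear X p z" "w \<in> L" for L p y z w
  proof (cases "w = y")
    case False
    have yz: "collinear X y z" and yw: "collinear X y w" using h False unfolding collinear_def by blast+
    have M: "\<pi> ` L \<in> lines G" using h unfolding lines_image by blast
    have "\<pi> p \<notin> \<pi> ` L"
    proof
      assume "\<pi> p \<in> \<pi> ` L"
      then obtain q where q: "q \<in> L" "\<pi> q = \<pi> p" by (auto simp: image_iff)
      then have "q \<noteq> y" using collinear_neq[OF h(7)] by metis
      then have "collinear X y q" using q h unfolding collinear_def by blast
      then have "q = p" using digon[OF h(7), of y q] q by simp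
      then show False using q h by simp
    qed
    then have "collinear G (\<pi> p) (\<pi> w)"
      using G.one_or_all[OF M _ _ _ _ collinear_neq[OF yz] push_collinear[OF h(7)] push_collinear[OF
        h(8)]]
        collinear_points[OF plgG push_collinear[OF h(7)]] h by blast
    then obtain a b where ab: "collinear X a b" "\<pi> a = \<pi> p" "\<pi> b = \<pi> w" using lift_collinear by blast
    have "a = p" using triangle[OF h(7) yw collinear_sym[OF ab(1)]] ab by simp
    moreover have "b = w" using triangle[OF collinear_sym[OF yw] collinear_sym[OF h(7)] ab(1)] ab by simp
    ultimately show ?thesis using ab by simp
  qed (use h in simp)
  show "(\<exists>S. symp X S \<and> p \<in> S \<and> q \<in> S) \<or> (\<forall>s. collinear X p s \<and> collinear X s q \<longrightarrow> s = r)"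
    if pq: "collinear X p r" "collinear X r q" "p \<noteq> q" "\<not> collinear X p q" for p q r
  proof -
    have ne: "\<pi> p \<noteq> \<pi> q" using digon[OF pq(1,2)] pq(3) by auto
    \<comment> \<open>A lifted edge between the images would close a triangle through
      \<open>r\<close>, and its ends would be \<open>p\<close> and \<open>q\<close>
      themselves.\<close>
    have nc: "\<not> collinear G (\<pi> p) (\<pi> q)"
    proof
      assume "collinear G (\<pi> p) (\<pi> q)"
      then obtain a b where ab: "collinear X a b" "\<pi> a = \<pi> p" "\<pi> b = \<pi> q" using lift_collinear by blast
      have "a = p" using triangle[OF pq(1,2) collinear_sym[OF ab(1)]] ab by simp
      moreover have "b = q" using triangle[OF collinear_sym[OF pq(2)] collinear_sym[OF pq(1)] ab(1)] ab
        by simp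
      ultimately show False using ab pq by simp
    qed
    note pushed = push_collinear[OF pq(1)] push_collinear[OF pq(2)]
    consider S where "symp G S" "\<pi> p \<in> S" "\<pi> q \<in> S"
      | "\<forall>s. collinear G (\<pi> p) s \<and> collinear G s (\<pi> q) \<longrightarrow> s = \<pi> r"
      using G.symp_or_unique[OF pushed ne nc] by blast
    then show ?thesis
    proof cases
      case 1
      have r: "\<pi> r \<in> S" using symp_closed[OF 1 ne nc pushed] .
      obtain T where T: "symp X T" "\<pi> ` T = S" using lift_symp[OF 1(1)] .
      obtain a b c where abc: "a \<in> T" "b \<in> T" "c \<in> T" "\<pi> a = \<pi> p" "\<pi> b = \<pi> q" "\<pi> c = \<pi> r"
        using 1 r T by (metis imageE)
      have "p = a" using lift_unique_in_symp(1)[OF T(1) abc(1,3) pq(1)] abc by simp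
      moreover have "q = b" using lift_unique_in_symp(2)[OF T(1) abc(3,2) pq(2)] abc by simp
      ultimately show ?thesis using T abc by blast
    next
      case 2
      have "s = r" if s: "collinear X p s" "collinear X s q" for s
      proof -
        have "\<pi> s = \<pi> r" using 2 push_collinear s by blast
        then show ?thesis using digon[OF collinear_sym[OF pq(1)] s(1)] by simp
      qed
      then show ?thesis by blast
    qed
  qed
qed

end

section \<open>Sheets\<close>

text \<open>Unions of connected components, expressed without paths. The members of a given family
  and the components of the unbuttoned space are both of this kind.\<close>

definition line_closed :: "'a geometry \<Rightarrow> 'a set \<Rightarrow> bool" where
  "line_closed G K \<longleftrightarrow> K \<subseteq> points G \<and> (\<forall>L\<in>lines G. \<forall>x\<in>L. x \<in> K \<longrightarrow> L \<subseteq> K)"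

lemma line_closed_subspace: "line_closed G K \<Longrightarrow> is_subspace G K"
  unfolding line_closed_def by (rule subspaceI) blast+

lemma line_closed_collinear: "line_closed G K \<Longrightarrow> collinear G x y \<Longrightarrow> x \<in> K \<Longrightarrow> y \<in> K"
  unfolding line_closed_def collinear_def by blast

lemma point_line_geometry_induced:
  assumes "point_line_geometry G" "line_closed G K"
  shows "point_line_geometry (induced_geometry G K)"
  unfolding point_line_geometry_def
proof (intro conjI ballI)
  show "\<Union>(lines (induced_geometry G K)) = points (induced_geometry G K)"
  proof
    show "points (induced_geometry G K) \<subseteq> \<Union>(lines (induced_geometry G K))"
    proof
      fix x assume "x \<in> points (induced_geometry G K)"
      then have "x \<in> K" by simp
      then have "x \<in> points G" using assms(2) unfolding line_closed_def by blast
      then obtain L where "L \<in> lines G" "x \<in> L" using assms(1) unfolding point_line_geometry_def by blast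
      then show "x \<in> \<Union>(lines (induced_geometry G K))"
        using assms(2) \<open>x \<in> K\<close> unfolding line_closed_def by auto
    qed
  qed auto
  show "\<exists>x\<in>L. \<exists>y\<in>L. x \<noteq> y" if "L \<in> lines (induced_geometry G K)" for L
    using assms(1) that unfolding point_line_geometry_def by auto
  show "L \<subseteq> points (induced_geometry G K)" if "L \<in> lines (induced_geometry G K)" for L
    using that by auto
qed

lemma symp_induced:
  assumes K: "line_closed G K"
  shows "symp (induced_geometry G K) T \<longleftrightarrow> T \<subseteq> K \<and> symp G T"
proof -
  note sub = line_closed_subspace[OF K]
  have "collinear (induced_geometry G K) x y \<longleftrightarrow> collinear G x y" if "x \<in> K" for x y
    using collinear_induced[OF sub] line_closed_collinear[OF K] that by blast
  moreover have "collinear (induced_geometry G K) x y \<longleftrightarrow> collinear G x y" if "y \<in> K" for x y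
    using collinear_induced[OF sub] line_closed_collinear[OF K _ that] collinear_sym[of G x y] that
      by blast
  ultimately show ?thesis
    unfolding symp_def subspace_induced[OF sub]
    by (cases "T \<subseteq> K") (simp_all add: induced_induced subset_iff cong: conj_cong)
qed

lemma symp_in_sheet:
  assumes K: "line_closed G K" and T: "symp G T" "x \<in> T" "x \<in> K"
  shows "T \<subseteq> K"
proof
  fix y assume y: "y \<in> T"
  show "y \<in> K"
  proof (cases "x = y \<or> collinear G x y")
    case True
    then show ?thesis using line_closed_collinear[OF K] T by blast
  next
    case False
    then obtain z where "collinear G x z" "collinear G z y"
      using symp_common_neighbour[OF T(1,2) y] by blast
    then show ?thesis using line_closed_collinear[OF K] T by blast
  qed
qed

lemma symplectic_rank_induced:
  assumes G: "point_line_geometry G" and K: "line_closed G K" and rank: "symplectic_rank_at_least d G"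
  shows "symplectic_rank_at_least d (induced_geometry G K)"
  using rank induced_induced[of _ K G]
  unfolding symplectic_rank_at_least_def symplecton_iff_symp[OF G]
    symplecton_iff_symp[OF point_line_geometry_induced[OF G K]] symp_induced[OF K] by simp

lemma lacunary_induced:
  assumes G: "point_line_geometry G" and K: "line_closed G K" and lac: "lacunary k G"
  shows "lacunary k (induced_geometry G K)"
proof -
  have "singular_dim (induced_geometry G K) (S \<inter> T) k \<longleftrightarrow> singular_dim G (S \<inter> T) k" if "S \<subseteq> K" for S T
    using singular_dim_induced[OF line_closed_subspace[OF K], of "S \<inter> T"] that by blast
  then show ?thesis
    using lac symplectic_rank_induced[OF G K] unfolding lacunary_def symplecton_iff_symp[OF G]
      symplecton_iff_symp[OF point_line_geometry_induced[OF G K]] symp_induced[OF K] by blast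
qed

lemma pre_parapolar_induced:
  assumes G: "pre_parapolar G" and K: "line_closed G K"
  shows "pre_parapolar (induced_geometry G K)"
proof -
  interpret G: pre_parapolar G by (rule G)
  note sub = line_closed_subspace[OF K]
  let ?H = "induced_geometry G K"
  show ?thesis
  proof
    show "point_line_geometry ?H" using point_line_geometry_induced[OF G.plg K] .
    show "collinear ?H p w" if "L \<in> lines ?H" "p \<in> points ?H" "p \<notin> L" "y \<in> L" "z \<in> L" "y \<noteq> z"
      "collinear ?H p y" "collinear ?H p z" "w \<in> L" for L p y z w
    proof -
      have "L \<in> lines G" "L \<subseteq> K" "p \<in> K" using that by auto
      moreover have "collinear G p y" "collinear G p z" using that collinear_induced[OF sub] by auto
      ultimately have "collinear G p w"
        using G.one_or_all[of L p y z w] that subspace_points[OF sub] by blast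
      then show ?thesis using collinear_induced[OF sub] \<open>p \<in> K\<close> \<open>L \<subseteq> K\<close> that(9) by blast
    qed
    show "\<exists>S. symp ?H S \<and> L \<subseteq> S" if "L \<in> lines ?H" for L
    proof -
      have L: "L \<in> lines G" "L \<subseteq> K" using that by auto
      obtain S where S: "symp G S" "L \<subseteq> S" using G.line_in_symp L by blast
      obtain x where "x \<in> L" using G.line_two L by blast
      then have "S \<subseteq> K" using symp_in_sheet[OF K S(1)] S L by blast
      then show ?thesis using S symp_induced[OF K] by blast
    qed
    show "polar_space_of_rank_at_least (induced_geometry ?H S) 3" if "symp ?H S" for S
      using that G.rank_three symp_induced[OF K] induced_induced[of S K G] by auto
    show "(\<exists>S. symp ?H S \<and> p \<in> S \<and> q \<in> S) \<or> (\<forall>s. collinear ?H p s \<and> collinear ?H s q \<longrightarrow> s = r)"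
      if pq: "collinear ?H p r" "collinear ?H r q" "p \<noteq> q" "\<not> collinear ?H p q" for p q r
    proof -
      have pq': "p \<in> K" "q \<in> K" "collinear G p r" "collinear G r q" "\<not> collinear G p q"
        using pq collinear_induced[OF sub] by auto
      consider S where "symp G S" "p \<in> S" "q \<in> S" | "\<forall>s. collinear G p s \<and> collinear G s q \<longrightarrow> s = r"
        using G.symp_or_unique[OF pq'(3,4) pq(3) pq'(5)] by blast
      then show ?thesis
      proof cases
        case 1
        have "S \<subseteq> K" using symp_in_sheet[OF K 1(1,2) pq'(1)] .
        then show ?thesis using symp_induced[OF K, of S] 1 by blast
      next
        case 2
        then show ?thesis using collinear_induced[OF sub] by blast
      qed
    qed
  qed
qed

lemma induced_points:
  assumes "point_line_geometry G"
  shows "induced_geometry G (points G) = G"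
proof -
  have "{L \<in> lines G. L \<subseteq> points G} = lines G" using assms unfolding point_line_geometry_def by blast
  then show ?thesis unfolding induced_geometry_def by simp
qed

lemma symp_points_polar: "symp G (points G) \<Longrightarrow> point_line_geometry G \<Longrightarrow> polar_space G"
  using symp_polar[of G "points G"] induced_points[of G] by simp

text \<open>For a noncollinear pair in \<open>S\<close>, both \<open>S\<close> and the full point
  set are its convex closure.\<close>

lemma polar_space_symp_iff:
  assumes "polar_space G"
  shows "symp G S \<longleftrightarrow> S = points G"
proof -
  have G: "point_line_geometry G" using assms unfolding polar_space_def by blast
  have full: "symp G (points G)"
    using subspace_points_self[OF G] induced_points[OF G] assms collinear_points[OF G] unfolding symp_def
      by auto
  show ?thesis
  proof
    assume S: "symp G S"
    note SG = subspace_points[OF symp_subspace[OF S]]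
    obtain p where p: "p \<in> S" using symp_nonempty[OF S] by blast
    obtain q where q: "q \<in> S" "p \<noteq> q" "\<not> collinear G p q" using symp_noncollinear[OF S p] by blast
    show "S = points G"
      using symp_convex_closure[OF S p q] symp_convex_closure[OF full _ _ q(2,3)] p q(1) SG by blast
  qed (use full in simp)
qed

section \<open>Buttoned spaces are lacunary\<close>

lemma gdist_refl: "x \<in> points G \<Longrightarrow> gdist G x x = 0"
  using gdist_le_path[of G x "[x]" x] by (simp add: is_path_def flip: zero_enat_def)

lemma gdist_collinear:
  assumes "point_line_geometry G" "collinear G x y"
  shows "gdist G x y \<le> 1"
  using gdist_le_path[OF is_path_two[OF collinear_points[OF assms] assms(2)]] by (simp add: one_enat_def)

lemma polar_rank_at_least_mono:
  "polar_space_of_rank_at_least G d \<Longrightarrow> e \<le> d \<Longrightarrow> polar_space_of_rank_at_least G e"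
  unfolding polar_space_of_rank_at_least_def by (meson order_trans)

lemma lacunary_class_geometry: "lacunary_class k G \<Longrightarrow> point_line_geometry G"
  unfolding lacunary_class_def polar_space_of_rank_at_least_def polar_space_of_rank_def polar_space_def
    parapolar_space_def by blast

lemma lacunary_class_lacunary:
  assumes "lacunary_class k G"
  shows "lacunary k G"
proof (cases "polar_space_of_rank_at_least G (max 3 (k + 1))")
  case True
  then have polar: "polar_space G" unfolding polar_space_of_rank_at_least_def polar_space_of_rank_def
    by blast
  have G: "point_line_geometry G" using lacunary_class_geometry[OF assms] .
  have "polar_space_of_rank_at_least G (k + 1)" using polar_rank_at_least_mono[OF True] by simp
  then show ?thesis
    unfolding lacunary_def symplectic_rank_at_least_def symplecton_iff_symp[OF G] polar_space_symp_iff[OF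
      polar]
    using induced_points[OF G] by simp
next
  case False
  then show ?thesis using assms unfolding lacunary_class_def by blast
qed

text \<open>By disjointness, a line of the union that meets \<open>points H\<close> is a line of
  \<open>H\<close>.\<close>

lemma union_geometry_sheet:
  assumes plg: "\<And>H. H \<in> \<F> \<Longrightarrow> point_line_geometry H"
    and disj: "\<And>H H'. H \<in> \<F> \<Longrightarrow> H' \<in> \<F> \<Longrightarrow> H \<noteq> H' \<Longrightarrow> points H \<inter> points H' = {}"
    and H: "H \<in> \<F>"
  shows "line_closed (union_geometry \<F>) (points H)" "induced_geometry (union_geometry \<F>) (points H) = H"
proof -
  have *: "L \<in> lines H" if L: "L \<in> lines (union_geometry \<F>)" "x \<in> L" "x \<in> points H" for L x
  proof -
    obtain H' where H': "H' \<in> \<F>" "L \<in> lines H'" using L(1) by (auto simp: union_geometry_def)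
    then have "x \<in> points H'" using plg[OF H'(1)] L(2) unfolding point_line_geometry_def by blast
    then have "H' = H" using disj[OF H'(1) H] L(3) by blast
    then show ?thesis using H' by simp
  qed
  have sub: "L \<subseteq> points H" "\<exists>x. x \<in> L" if "L \<in> lines H" for L
    using plg[OF H] that unfolding point_line_geometry_def by blast+
  show "line_closed (union_geometry \<F>) (points H)"
    unfolding line_closed_def
  proof (intro conjI ballI impI)
    show "points H \<subseteq> points (union_geometry \<F>)" using H unfolding union_geometry_def by auto
    show "L \<subseteq> points H" if "L \<in> lines (union_geometry \<F>)" "x \<in> L" "x \<in> points H" for L x
      using sub(1)[OF *[OF that]] .
  qed
  have "{L \<in> lines (union_geometry \<F>). L \<subseteq> points H} = lines H"
  proof
    show "{L \<in> lines (union_geometry \<F>). L \<subseteq> points H} \<subseteq> lines H"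
    proof
      fix L assume L: "L \<in> {L \<in> lines (union_geometry \<F>). L \<subseteq> points H}"
      then obtain H' where "H' \<in> \<F>" "L \<in> lines H'" unfolding union_geometry_def by auto
      then obtain x where "x \<in> L" using plg[of H'] unfolding point_line_geometry_def by blast
      then show "L \<in> lines H" using * L by blast
    qed
    show "lines H \<subseteq> {L \<in> lines (union_geometry \<F>). L \<subseteq> points H}"
      using H sub unfolding union_geometry_def by auto
  qed
  then show "induced_geometry (union_geometry \<F>) (points H) = H"
    unfolding induced_geometry_def by simp
qed

lemma point_line_geometry_union:
  assumes "\<And>H. H \<in> \<F> \<Longrightarrow> point_line_geometry H"
  shows "point_line_geometry (union_geometry \<F>)"
  unfolding point_line_geometry_def
proof (intro conjI ballI)
  have "\<Union>(lines H) = points H" if "H \<in> \<F>" for H using assms[OF that] unfolding point_line_geometry_def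
    by blast
  then have "(\<Union>H\<in>\<F>. \<Union>(lines H)) = (\<Union>H\<in>\<F>. points H)" by simp
  then show "\<Union>(lines (union_geometry \<F>)) = points (union_geometry \<F>)"
    unfolding union_geometry_def by simp blast
  show "L \<subseteq> points (union_geometry \<F>)" if L: "L \<in> lines (union_geometry \<F>)" for L
  proof -
    obtain H where "H \<in> \<F>" "L \<in> lines H" using L unfolding union_geometry_def by auto
    then show ?thesis using assms[of H] unfolding point_line_geometry_def union_geometry_def by auto
  qed
  show "\<exists>x\<in>L. \<exists>y\<in>L. x \<noteq> y" if L: "L \<in> lines (union_geometry \<F>)" for L
  proof -
    obtain H where "H \<in> \<F>" "L \<in> lines H" using L unfolding union_geometry_def by auto
    then show ?thesis using assms[of H] unfolding point_line_geometry_def by blast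
  qed
qed

text \<open>Any symp stays within one sheet, and symps with a \<open>k\<close>-dimensional
  intersection share a line, so both lie in the same sheet.\<close>

lemma lacunary_union:
  assumes plg: "\<And>H. H \<in> \<F> \<Longrightarrow> point_line_geometry H"
    and disj: "\<And>H H'. H \<in> \<F> \<Longrightarrow> H' \<in> \<F> \<Longrightarrow> H \<noteq> H' \<Longrightarrow> points H \<inter> points H' = {}"
    and lac: "\<And>H. H \<in> \<F> \<Longrightarrow> lacunary k H" and k: "k \<ge> 1"
  shows "lacunary k (union_geometry \<F>)"
proof -
  let ?X = "union_geometry \<F>"
  have X: "point_line_geometry ?X" using plg by (rule point_line_geometry_union)
  have closed: "line_closed ?X (points H)" and sheet_eq: "induced_geometry ?X (points H) = H"
    if "H \<in> \<F>" for H
    using union_geometry_sheet[of \<F> H, OF plg disj that] by simp_all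
  have sheet: "\<exists>H\<in>\<F>. T \<subseteq> points H" if T: "symp ?X T" for T
  proof -
    obtain x where x: "x \<in> T" using symp_nonempty[OF T] by blast
    then have "x \<in> points ?X" using subspace_points[OF symp_subspace[OF T]] by blast
    then obtain H where H: "H \<in> \<F>" "x \<in> points H" unfolding union_geometry_def by auto
    then show ?thesis using symp_in_sheet[OF closed[OF H(1)] T x] by blast
  qed
  have in_sheet: "symplecton H T" if "symp ?X T" "H \<in> \<F>" "T \<subseteq> points H" for T H
    using symp_induced[OF closed[OF that(2)], of T] that
      sheet_eq[OF that(2)] symplecton_iff_symp[OF plg[OF that(2)]] by simp
  have "symplectic_rank_at_least (k + 1) ?X"
    unfolding symplectic_rank_at_least_def symplecton_iff_symp[OF X]
  proof (intro allI impI)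
    fix T assume T: "symp ?X T"
    obtain H where H: "H \<in> \<F>" "T \<subseteq> points H" using sheet[OF T] by blast
    have "polar_space_of_rank_at_least (induced_geometry H T) (k + 1)"
      using lac[OF H(1)] in_sheet[OF T H] unfolding lacunary_def symplectic_rank_at_least_def by blast
    then show "polar_space_of_rank_at_least (induced_geometry ?X T) (k + 1)"
      using induced_induced[OF H(2), of ?X] sheet_eq[OF H(1)] by simp
  qed
  moreover have False if T: "symp ?X T" "symp ?X U" "T \<noteq> U" "singular_dim ?X (T \<inter> U) k" for T U
  proof -
    obtain L where L: "L \<in> lines ?X" "L \<subseteq> T \<inter> U" using singular_dim_line[OF T(4) k] by blast
    obtain x where x: "x \<in> L" using X L(1) unfolding point_line_geometry_def by blast
    obtain H where H: "H \<in> \<F>" "T \<subseteq> points H" using sheet[OF T(1)] by blast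
    have "U \<subseteq> points H" using symp_in_sheet[OF closed[OF H(1)] T(2)] x L H by blast
    moreover have "singular_dim H (T \<inter> U) k"
      using singular_dim_induced[OF line_closed_subspace[OF closed[OF H(1)]], of "T \<inter> U"] H T(4)
        sheet_eq[OF H(1)] by auto
    ultimately show False using lac[OF H(1)] in_sheet[OF T(1) H] in_sheet[OF T(2) H(1)] T(3)
      unfolding lacunary_def by blast
  qed
  ultimately show ?thesis unfolding lacunary_def symplecton_iff_symp[OF X] by blast
qed

text \<open>The class map followed by the inverse of the isomorphism satisfies
  \<open>unbuttoning\<close>; then \<open>lacunary_iff\<close> transfers the property from the union
  of the sheets.\<close>

lemma buttoned_over_lacunary:
  fixes \<Omega> :: "'a geometry"
  assumes k: "k \<ge> 1" and plg: "point_line_geometry \<Omega>"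
    and "buttoned_over (lacunary_class k :: 'b geometry \<Rightarrow> bool) \<Omega>"
  shows "lacunary k \<Omega>"
proof -
  obtain \<F> :: "'b geometry set" and R
    where but: "buttoning \<F> R" and cls: "\<And>H. H \<in> \<F> \<Longrightarrow> lacunary_class k H"
    and "geometry_isomorphic \<Omega> (buttoned_geometry \<F> R)"
    using assms(3) unfolding buttoned_over_def by blast
  define X where "X = union_geometry \<F>"
  define q where "q = (\<lambda>p. R `` {p})"
  obtain f where f: "bij_betw f (points \<Omega>) (points X // R)" "image f ` lines \<Omega> = image q ` lines X"
    using \<open>geometry_isomorphic \<Omega> _\<close> unfolding geometry_isomorphic_def buttoned_geometry_def X_def q_def
    by (auto simp: Setcompr_eq_image)
  have equiv: "equiv (points X) R" and C1: "button_C1 \<F> R"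
    and disj: "\<And>H H'. H \<in> \<F> \<Longrightarrow> H' \<in> \<F> \<Longrightarrow> H \<noteq> H' \<Longrightarrow> points H \<inter> points H' = {}"
    using but unfolding buttoning_def disjoint_family_of_sheets_def X_def by blast+
  have plgH: "point_line_geometry H" if "H \<in> \<F>" for H using lacunary_class_geometry[OF cls[OF that]] .
  have X: "point_line_geometry X" unfolding X_def using plgH by (rule point_line_geometry_union)
  define \<pi> where "\<pi> x = inv_into (points \<Omega>) f (q x)" for x
  have qX: "q x \<in> points X // R" if "x \<in> points X" for x
    using quotientI[OF that] unfolding q_def .
  have q_self: "x \<in> q x" if "x \<in> points X" for x
    using equiv_class_self[OF equiv that] unfolding q_def .
  have f\<pi>: "f (\<pi> x) = q x" if "x \<in> points X" for x
    using bij_betw_inv_into_right[OF f(1) qX[OF that]] unfolding \<pi>_def .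
  have sub\<Omega>: "L \<subseteq> points \<Omega>" if "L \<in> lines \<Omega>" for L
    using plg that unfolding point_line_geometry_def by blast
  have cancel: "inv_into (points \<Omega>) f ` f ` L = L" if "L \<in> lines \<Omega>" for L
    using inv_into_image_cancel[OF bij_betw_imp_inj_on[OF f(1)] sub\<Omega>[OF that]] .
  have \<pi>_image: "\<pi> ` L = inv_into (points \<Omega>) f ` q ` L" for L
    unfolding \<pi>_def image_image ..
  have lines: "lines \<Omega> = image \<pi> ` lines X"
  proof
    show "lines \<Omega> \<subseteq> image \<pi> ` lines X"
    proof
      fix M assume M: "M \<in> lines \<Omega>"
      then obtain L where "L \<in> lines X" "f ` M = q ` L" using f(2) by (metis imageE imageI)
      then have "M = \<pi> ` L" using cancel[OF M] \<pi>_image by simp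
      then show "M \<in> image \<pi> ` lines X" using \<open>L \<in> lines X\<close> by blast
    qed
    show "image \<pi> ` lines X \<subseteq> lines \<Omega>"
    proof
      fix M assume "M \<in> image \<pi> ` lines X"
      then obtain L where L: "L \<in> lines X" "M = \<pi> ` L" by blast
      then obtain N where N: "N \<in> lines \<Omega>" "f ` N = q ` L" using f(2) by (metis imageE imageI)
      then have "M = N" using cancel[OF N(1)] \<pi>_image L by simp
      then show "M \<in> lines \<Omega>" using N by simp
    qed
  qed
  \<comment> \<open>Four legs of length at most 1 add up to at most 4, below the bound 5. Shorter
    closed walks are padded by legs of length 0 at a repeated point.\<close>
  have C1': "x = x'"
    if "x \<in> points X" "x' \<in> points X" "y \<in> points X" "y' \<in> points X" "z \<in> points X" "z' \<in> points X"
      "w \<in> points X" "w' \<in> points X" "\<pi> x' = \<pi> x" "\<pi> y' = \<pi> y" "\<pi> z' = \<pi> z" "\<pi> w' = \<pi> w"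
      "\<pi> x \<noteq> \<pi> y" "\<pi> x \<noteq> \<pi> z" "\<pi> x \<noteq> \<pi> w"
      "gdist X x y \<le> 1" "gdist X y' z \<le> 1" "gdist X z' w \<le> 1" "gdist X w' x' \<le> 1"
    for x x' y y' z z' w w'
  proof (rule ccontr)
    assume "x \<noteq> x'"
    have eq: "q x' = q x" "q y' = q y" "q z' = q z" "q w' = q w"
      using that(1-12) f\<pi> by metis+
    have ne: "q x \<noteq> q y" "q x \<noteq> q z" "q x \<noteq> q w" using that(13-15) unfolding \<pi>_def by auto
    have "5 \<le> gdist X x y + gdist X y' z + gdist X z' w + gdist X w' x'"
      using C1[unfolded button_C1_def Let_def, folded X_def, rule_format,
          OF qX[OF that(1)] qX[OF that(3)] qX[OF that(5)] qX[OF that(7)], of x' x y y' z z' w w']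
        ne \<open>x \<noteq> x'\<close> q_self[OF that(1)] q_self[OF that(2)] q_self[OF that(3)] q_self[OF that(4)]
        q_self[OF that(5)] q_self[OF that(6)] q_self[OF that(7)] q_self[OF that(8)] eq by auto
    also have "\<dots> \<le> 1 + 1 + 1 + 1" using that(16-19) by (intro add_mono)
    finally show False by (simp add: one_enat_def numeral_eq_enat)
  qed
  note coll = collinear_points[OF X] gdist_collinear[OF X]
  \<comment> \<open>The button condition requires the other three classes to differ from that of
    \<open>x\<close>, so it cannot be applied to the edge alone. The detour passes through a point
    \<open>z\<close> of the line in another class, available because a line of
    \<open>\<Omega>\<close> has two points.\<close>
  have neq: "\<pi> x \<noteq> \<pi> y" if xy: "collinear X x y" for x y
  proof
    assume eq: "\<pi> x = \<pi> y"
    obtain L where L: "L \<in> lines X" "x \<in> L" "y \<in> L" "x \<noteq> y" using xy unfolding collinear_def by blast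
    have "\<pi> ` L \<in> lines \<Omega>" using lines L(1) by simp
    moreover have "\<forall>M\<in>lines \<Omega>. \<exists>u\<in>M. \<exists>v\<in>M. u \<noteq> v" using plg unfolding point_line_geometry_def by simp
    ultimately have "\<exists>u\<in>\<pi> ` L. \<exists>v\<in>\<pi> ` L. u \<noteq> v" by blast
    then obtain u v where "u \<in> L" "v \<in> L" "\<pi> u \<noteq> \<pi> v" by blast
    then obtain z where z: "z \<in> L" "\<pi> z \<noteq> \<pi> x" by metis
    then have "x \<noteq> z" "y \<noteq> z" using eq by auto
    then have c: "collinear X x z" "collinear X z y" using L z unfolding collinear_def by auto
    have "gdist X z z \<le> 1" using gdist_refl[OF coll(2)[OF c(1)]] by simp
    then show False
      using C1'[of x y z z z z z z] coll(1,2)[OF c(1)] coll(1,2)[OF c(2)] coll(3)[OF c(1)] coll(3)[OF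
        c(2)]
        eq z L(4) by simp
  qed
  interpret unbuttoning X \<Omega> \<pi>
  proof
    show "point_line_geometry X" "point_line_geometry \<Omega>" "lines \<Omega> = image \<pi> ` lines X"
      using X plg lines by auto
    show "\<pi> x \<noteq> \<pi> y" if "collinear X x y" for x y using neq that .
    show "x' = x" if h: "collinear X x y" "collinear X y' x'" "\<pi> x' = \<pi> x" "\<pi> y' = \<pi> y" for x y y' x'
    proof -
      note p = coll(1,2)[OF h(1)] coll(1,2)[OF h(2)]
      have "gdist X y' y' \<le> 1" using gdist_refl[of _ X] p by simp
      then show ?thesis
        using C1'[of x x' y y' y' y' y' y'] p h neq[OF h(1)] coll(3)[OF h(1)] coll(3)[OF h(2)] by simp
    qed
    show "x' = x" if h: "collinear X x y" "collinear X y' z" "collinear X z' x'"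
      "\<pi> x' = \<pi> x" "\<pi> y' = \<pi> y" "\<pi> z' = \<pi> z" for x y y' z z' x'
    proof -
      note p = coll(1,2)[OF h(1)] coll(1,2)[OF h(2)] coll(1,2)[OF h(3)]
      have "gdist X z' z' \<le> 1" using gdist_refl[of _ X] p by simp
      moreover have "\<pi> x \<noteq> \<pi> z" using neq[OF h(3)] h by auto
      ultimately show ?thesis
        using C1'[of x x' y y' z z' z' z'] p h neq[OF h(1)] coll(3)[OF h(1)] coll(3)[OF h(2)] coll(3)[OF
          h(3)]
        by simp
    qed
    show "x' = x" if h: "collinear X x y" "collinear X y' z" "collinear X z' w" "collinear X w' x'"
      "\<pi> x' = \<pi> x" "\<pi> y' = \<pi> y" "\<pi> z' = \<pi> z" "\<pi> w' = \<pi> w" "\<pi> x \<noteq> \<pi> z" for x y y' z z' w w' x'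
    proof -
      note p = coll(1,2)[OF h(1)] coll(1,2)[OF h(2)] coll(1,2)[OF h(3)] coll(1,2)[OF h(4)]
      have "\<pi> x \<noteq> \<pi> w" using neq[OF h(4)] h by auto
      then show ?thesis
        using C1'[of x x' y y' z z' w w'] p h neq[OF h(1)] coll(3)[OF h(1)] coll(3)[OF h(2)] coll(3)[OF
          h(3)]
          coll(3)[OF h(4)] by simp
    qed
  qed
  have "lacunary k X"
    unfolding X_def using plgH disj lacunary_class_lacunary[OF cls] k by (rule lacunary_union)
  then show ?thesis using lacunary_iff[OF k] by simp
qed

section \<open>Lacunary spaces are buttoned\<close>

text \<open>The local component of \<open>p\<close> containing \<open>L\<close>, encoded as a set of
  lines. As \<open>link\<close> is symmetric, linked lines through \<open>p\<close> get equal germs,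
  and the germ can serve as the second coordinate of a point above \<open>p\<close>.\<close>

definition germ :: "'a geometry \<Rightarrow> 'a \<Rightarrow> 'a set \<Rightarrow> 'a set set" where
  "germ G p L = {M. (link G p)\<^sup>*\<^sup>* L M}"

definition germ_lift :: "'a geometry \<Rightarrow> 'a set \<Rightarrow> ('a \<times> 'a set set) set" where
  "germ_lift G L = (\<lambda>p. (p, germ G p L)) ` L"

definition unbuttoned :: "'a geometry \<Rightarrow> ('a \<times> 'a set set) geometry" where
  "unbuttoned G = \<lparr>points = (\<Union>L\<in>lines G. germ_lift G L), lines = germ_lift G ` lines G\<rparr>"

lemma unbuttoned_simps [simp]:
  "points (unbuttoned G) = (\<Union>L\<in>lines G. germ_lift G L)"
  "lines (unbuttoned G) = germ_lift G ` lines G"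
  unfolding unbuttoned_def by simp_all

lemma mem_germ_lift: "x \<in> germ_lift G L \<longleftrightarrow> fst x \<in> L \<and> snd x = germ G (fst x) L"
  unfolding germ_lift_def by (cases x) auto

lemma fst_germ_lift: "fst ` germ_lift G L = L"
  unfolding germ_lift_def by (auto simp: image_image)

lemma links_germ_eq:
  assumes "(link G p)\<^sup>*\<^sup>* L M"
  shows "germ G p L = germ G p M"
proof -
  have "(link G p)\<^sup>*\<^sup>* M L"
    using assms
  proof induction
    case (step y z)
    then show ?case using link_sym[of G p y z] by (meson converse_rtranclp_into_rtranclp)
  qed simp
  then have "(link G p)\<^sup>*\<^sup>* L N \<longleftrightarrow> (link G p)\<^sup>*\<^sup>* M N" for N
    using assms rtranclp_trans[of "link G p" L M N] rtranclp_trans[of "link G p" M L N] by blast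
  then show ?thesis unfolding germ_def by blast
qed

lemma germ_eq_links: "germ G p L = germ G p M \<Longrightarrow> (link G p)\<^sup>*\<^sup>* L M"
  using rtranclp.rtrancl_refl[of "link G p" M] unfolding germ_def by blast

lemma germ_eqI: "link G p L M \<Longrightarrow> germ G p L = germ G p M"
  by (rule links_germ_eq) (rule r_into_rtranclp)

lemma collinear_unbuttoned_iff:
  "collinear (unbuttoned G) x y \<longleftrightarrow> fst x \<noteq> fst y \<and>
    (\<exists>L\<in>lines G. x \<in> germ_lift G L \<and> y \<in> germ_lift G L)"
  unfolding collinear_def by (auto simp: mem_germ_lift prod_eq_iff)

lemma collinear_fst: "collinear (unbuttoned G) x y \<Longrightarrow> collinear G (fst x) (fst y)"
  unfolding collinear_unbuttoned_iff unfolding collinear_def mem_germ_lift by blast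

lemma (in pre_parapolar) unbuttoning_unbuttoned: "unbuttoning (unbuttoned G) G fst"
proof
  show "point_line_geometry (unbuttoned G)"
    unfolding point_line_geometry_def
  proof (intro conjI ballI)
    fix K assume "K \<in> lines (unbuttoned G)"
    then obtain L where L: "L \<in> lines G" "K = germ_lift G L" by auto
    then show "K \<subseteq> points (unbuttoned G)" by auto
    obtain x y where "x \<in> L" "y \<in> L" "x \<noteq> y" using line_two L by blast
    then show "\<exists>x\<in>K. \<exists>y\<in>K. x \<noteq> y" unfolding L(2) germ_lift_def by auto
  qed simp
  show "point_line_geometry G" by (rule plg)
  show "lines G = image fst ` lines (unbuttoned G)"
    by (simp add: image_image fst_germ_lift)
  show "fst x \<noteq> fst y" if "collinear (unbuttoned G) x y" for x y
    using that unfolding collinear_unbuttoned_iff by blast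
  have eqI: "x' = x"
    if "x \<in> germ_lift G L" "x' \<in> germ_lift G M" "fst x' = fst x" "(link G (fst x))\<^sup>*\<^sup>* L M" for x x' L M
    using that links_germ_eq[OF that(4)] unfolding mem_germ_lift by (simp add: prod_eq_iff)
  show "x' = x"
    if h: "collinear (unbuttoned G) x y" "collinear (unbuttoned G) y' x'" "fst x' = fst x"
      "fst y' = fst y"
    for x y y' x'
  proof -
    obtain L where L: "L \<in> lines G" "x \<in> germ_lift G L" "y \<in> germ_lift G L" "fst x \<noteq> fst y"
      using h(1) unfolding collinear_unbuttoned_iff by blast
    obtain M where M: "M \<in> lines G" "x' \<in> germ_lift G M" "y' \<in> germ_lift G M"
      using h(2) unfolding collinear_unbuttoned_iff by blast
    have "link G (fst x) L M" using L M h(3,4) unfolding link_def mem_germ_lift by metis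
    then show ?thesis using eqI[OF L(2) M(2) h(3)] by blast
  qed
  show "x' = x"
    if h: "collinear (unbuttoned G) x y" "collinear (unbuttoned G) y' z" "collinear (unbuttoned G) z' x'"
    "fst x' = fst x" "fst y' = fst y" "fst z' = fst z" for x y y' z z' x'
  proof -
    obtain L where L: "L \<in> lines G" "x \<in> germ_lift G L" "y \<in> germ_lift G L" "fst x \<noteq> fst y"
      using h(1) unfolding collinear_unbuttoned_iff by blast
    obtain K where K: "K \<in> lines G" "y' \<in> germ_lift G K" "z \<in> germ_lift G K" "fst y' \<noteq> fst z"
      using h(2) unfolding collinear_unbuttoned_iff by blast
    obtain M where M: "M \<in> lines G" "z' \<in> germ_lift G M" "x' \<in> germ_lift G M" "fst z' \<noteq> fst x'"
      using h(3) unfolding collinear_unbuttoned_iff by blast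
    have "collinear G (fst y) (fst z)" using K h(5) unfolding collinear_def mem_germ_lift by metis
    then have "link G (fst x) L M" using L M h(4,6) unfolding link_def mem_germ_lift by metis
    then show ?thesis using eqI[OF L(2) M(3) h(4)] by blast
  qed
  show "x' = x"
    if h: "collinear (unbuttoned G) x y" "collinear (unbuttoned G) y' z" "collinear (unbuttoned G) z' w"
    "collinear (unbuttoned G) w' x'"
    "fst x' = fst x" "fst y' = fst y" "fst z' = fst z" "fst w' = fst w" "fst x \<noteq> fst z"
      for x y y' z z' w w' x'
  proof -
    obtain L where L: "L \<in> lines G" "x \<in> germ_lift G L" "y \<in> germ_lift G L" "fst x \<noteq> fst y"
      using h(1) unfolding collinear_unbuttoned_iff by blast
    obtain M where M: "M \<in> lines G" "w' \<in> germ_lift G M" "x' \<in> germ_lift G M" "fst w' \<noteq> fst x'"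
      using h(4) unfolding collinear_unbuttoned_iff by blast
    define p q r s where pqrs: "p = fst x" "q = fst y" "r = fst z" "s = fst w"
    have Lp: "p \<in> L" "q \<in> L" "p \<noteq> q" using L pqrs unfolding mem_germ_lift by auto
    have Mp: "p \<in> M" "s \<in> M" "s \<noteq> p" using M h(5,8) pqrs unfolding mem_germ_lift by auto
    have qr: "collinear G q r" using collinear_fst[OF h(2)] h(6) pqrs by simp
    have rs: "collinear G r s" using collinear_fst[OF h(3)] h(7) pqrs by simp
    have pq: "collinear G p q" using Lp L(1) unfolding collinear_def by blast
    have ps: "collinear G p s" using Mp M(1) unfolding collinear_def by blast
    have pr: "p \<noteq> r" using h(9) pqrs by simp
    have "(link G p)\<^sup>*\<^sup>* L M"
    proof (cases "q = s \<or> collinear G q s")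
      case True
      then have "link G p L M" using Lp Mp L(1) M(1) unfolding link_def by metis
      then show ?thesis by blast
    next
      case qs: False
      show ?thesis
      \<comment> \<open>A line through \<open>p\<close> and \<open>r\<close> is linked to both sides
        \<open>L\<close> and \<open>M\<close>. If there is none, the distinct common neighbours
        \<open>q\<close> and \<open>s\<close> rule out the unique neighbour alternative and yield a
        symp, where \<open>symp_links\<close> applies.\<close>
      proof (cases "collinear G p r")
        case True
        then obtain A where A: "A \<in> lines G" "p \<in> A" "r \<in> A" unfolding collinear_def by blast
        have "link G p L A" using A Lp L(1) qr pr unfolding link_def by metis
        moreover have "link G p A M" using A Mp M(1) rs pr unfolding link_def by metis
        ultimately show ?thesis by (meson converse_rtranclp_into_rtranclp rtranclp.rtrancl_refl)
      next
        case False
        then obtain S where S: "symp G S" "p \<in> S" "r \<in> S"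
          using symp_or_unique[OF pq qr pr] ps collinear_sym[OF rs] rs qs by blast
        have qS: "q \<in> S" "s \<in> S" using symp_closed[OF S pr False] pq qr ps collinear_sym[OF rs] rs
          by auto
        have "adj G a b" if "collinear G a b" for a b
          using that collinear_points[OF plg that] unfolding adj_def by blast
        then have "adj G p q" "adj G q r" "adj G p s" "adj G s r"
          using pq qr ps collinear_sym[OF rs] by auto
        moreover have "\<not> adj G p r" using False pr unfolding adj_def by blast
        ultimately show ?thesis using symp_links[OF S qS] L(1) M(1) Lp Mp by blast
      qed
    qed
    then show ?thesis using eqI[OF L(2) M(3) h(5)] pqrs by simp
  qed
qed

section \<open>Connected components and walks realizing distances\<close>

definition component :: "'a geometry \<Rightarrow> 'a \<Rightarrow> 'a set" where
  "component G x = {y. (collinear G)\<^sup>*\<^sup>* x y}"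

lemma component_subset:
  assumes "point_line_geometry G" "x \<in> points G"
  shows "component G x \<subseteq> points G"
proof
  fix y assume "y \<in> component G x"
  then have "(collinear G)\<^sup>*\<^sup>* x y" unfolding component_def by simp
  then show "y \<in> points G" by (induction) (use assms collinear_points(2)[OF assms(1)] in auto)
qed

lemma component_line_closed:
  assumes "point_line_geometry G" "x \<in> points G"
  shows "line_closed G (component G x)"
  unfolding line_closed_def
proof (intro conjI ballI impI component_subset[OF assms] subsetI)
  fix L y z assume h: "L \<in> lines G" "y \<in> L" "y \<in> component G x" "z \<in> L"
  show "z \<in> component G x"
  proof (cases "z = y")
    case False
    then have "collinear G y z" using h unfolding collinear_def by blast
    then show ?thesis using h(3) unfolding component_def by (simp add: rtranclp.rtrancl_into_rtrancl)
  qed (use h in simp)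
qed

lemma component_self: "x \<in> component G x"
  unfolding component_def by simp

lemma collinear_rtranclp_sym: "(collinear G)\<^sup>*\<^sup>* x y \<Longrightarrow> (collinear G)\<^sup>*\<^sup>* y x"
proof (induction rule: rtranclp_induct)
  case (step y z)
  then show ?case using collinear_sym[of G y z] by (meson converse_rtranclp_into_rtranclp)
qed simp

lemma component_eq: "y \<in> component G x \<Longrightarrow> component G y = component G x"
  unfolding component_def using collinear_rtranclp_sym[of G x y] by (auto intro: rtranclp_trans)

lemma rtranclp_path:
  assumes "point_line_geometry G" "(collinear G)\<^sup>*\<^sup>* x y" "x \<in> points G"
  shows "\<exists>xs. is_path G x xs y"
  using assms(2)
proof induction
  case base
  have "is_path G x [x] x" using assms(3) unfolding is_path_def by simp
  then show ?case by blast
next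
  case (step y z)
  then obtain xs where xs: "is_path G x xs y" by blast
  have "is_path G x (xs @ [z]) z"
    using xs step(2) collinear_points(2)[OF assms(1) step(2)] unfolding is_path_def
    by (simp add: successively_append_iff)
  then show ?case by blast
qed

lemma connected_component:
  assumes G: "point_line_geometry G" "x \<in> points G"
  shows "connected_geometry (induced_geometry G (component G x))"
  unfolding connected_geometry_def
proof (intro ballI)
  let ?H = "induced_geometry G (component G x)"
  note closed = component_line_closed[OF G]
  fix y z assume "y \<in> points ?H" "z \<in> points ?H"
  then have y: "y \<in> component G x" "z \<in> component G x" by simp_all
  then have "(collinear G)\<^sup>*\<^sup>* y z" using component_eq[OF y(1)] unfolding component_def by blast
  then have "(collinear ?H)\<^sup>*\<^sup>* y z \<and> z \<in> component G x"
  proof induction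
    case (step u v)
    then have "collinear ?H u v \<and> v \<in> component G x"
      using line_closed_collinear[OF closed] collinear_induced[OF line_closed_subspace[OF closed]]
        by blast
    then show ?case using step.IH rtranclp.rtrancl_into_rtrancl[of "collinear ?H" y u v] by blast
  qed (use y in simp)
  then show "\<exists>xs. is_path ?H y xs z"
    using rtranclp_path[OF point_line_geometry_induced[OF G(1) closed]] y(1) by simp
qed

lemma path_relpowp: "is_path G x xs y \<Longrightarrow> (collinear G ^^ (length xs - 1)) x y"
proof (induction xs arbitrary: x)
  case (Cons a zs)
  show ?case
  proof (cases zs)
    case Nil
    then show ?thesis using Cons.prems unfolding is_path_def by auto
  next
    case (Cons b us)
    then have "collinear G x b" "is_path G b zs y"
      using Cons.prems unfolding is_path_def by auto
    then have "(collinear G ^^ Suc (length zs - 1)) x y"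
      using Cons.IH[of b] by (intro relpowp_Suc_I2)
    then show ?thesis using Cons by simp
  qed
qed (simp add: is_path_def)

lemma gdist_relpowp:
  assumes "gdist G x y = enat n"
  shows "(collinear G ^^ n) x y"
proof -
  let ?A = "(\<lambda>xs. enat (length xs - 1)) ` {xs. is_path G x xs y}"
  have "?A \<noteq> {}"
  proof
    assume "?A = {}"
    then have "gdist G x y = \<infinity>" unfolding gdist_def by (simp add: Inf_enat_def)
    then show False using assms by simp
  qed
  then have "Inf ?A \<in> ?A" unfolding Inf_enat_def using LeastI[of "\<lambda>x. x \<in> ?A"] by auto
  then obtain xs where "is_path G x xs y" "gdist G x y = enat (length xs - 1)"
    unfolding gdist_def by auto
  then show ?thesis using path_relpowp assms by fastforce
qed

context unbuttoning
begin

text \<open>Jumps inside the class \<open>c\<close> of the start point are excluded because the first button condition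
  requires this class to differ from the other three. A path of length 0 inside a sheet is absorbed
  into the neighbouring jumps, so that only the total number of steps matters.\<close>

definition jump :: "'a \<Rightarrow> 'b \<Rightarrow> 'b \<Rightarrow> bool" where
  "jump c x y \<longleftrightarrow> \<pi> x = \<pi> y \<and> (\<pi> x = c \<longrightarrow> x = y)"

definition walk :: "'a \<Rightarrow> nat \<Rightarrow> 'b \<Rightarrow> 'b \<Rightarrow> bool" where
  "walk c n = (collinear X OO jump c) ^^ n"

lemma jump_refl: "jump c x x"
  unfolding jump_def by simp

lemma jump_trans: "jump c x y \<Longrightarrow> jump c y z \<Longrightarrow> jump c x z"
  unfolding jump_def by metis

lemma jump_eq: "jump c x y \<Longrightarrow> \<pi> y = \<pi> x"
  unfolding jump_def by simp

lemma jump_fixes: "jump c x y \<Longrightarrow> \<pi> y = c \<Longrightarrow> x = y"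
  unfolding jump_def by simp

lemma walk_Suc: "walk c (Suc n) x z \<longleftrightarrow> (\<exists>y y'. walk c n x y \<and> collinear X y y' \<and> jump c y' z)"
  unfolding walk_def by auto

lemma walk_0: "walk c 0 x y \<longleftrightarrow> x = y"
  unfolding walk_def by simp

lemma walk_jump: "n \<noteq> 0 \<Longrightarrow> walk c n x y \<Longrightarrow> jump c y z \<Longrightarrow> walk c n x z"
proof (cases n)
  case (Suc m)
  assume "walk c n x y" and yz: "jump c y z"
  then obtain u v where "walk c m x u" "collinear X u v" "jump c v y" using Suc by (auto simp: walk_Suc)
  then show ?thesis using jump_trans[OF _ yz, of v] Suc walk_Suc by blast
qed simp

lemma walk_append:
  assumes "walk c n x a" "(collinear X ^^ m) a b"
  shows "walk c (n + m) x b"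
  using assms(2)
proof (induction m arbitrary: b)
  case (Suc m)
  then obtain d where "(collinear X ^^ m) a d" "collinear X d b" by auto
  then show ?case using Suc.IH[of d] jump_refl walk_Suc by auto
qed (use assms in simp)

lemma closed_walk:
  assumes w: "walk (\<pi> x) n x x'" and n: "n \<le> 4" and x': "\<pi> x' = \<pi> x"
  shows "x' = x"
proof -
  consider "n = 0" | "n = Suc 0" | "n = Suc (Suc 0)" | "n = Suc (Suc (Suc 0))" |
    "n = Suc (Suc (Suc (Suc 0)))"
    using n by linarith
  then show ?thesis
  proof cases
    case 1
    then show ?thesis using w by (simp add: walk_0)
  next
    case 2
    then obtain y where "collinear X x y" "jump (\<pi> x) y x'" using w by (auto simp: walk_Suc walk_0)
    then show ?thesis using collinear_neq[of x y] x' unfolding jump_def by auto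
  next
    case 3
    then obtain y y' z where h: "collinear X x y" "jump (\<pi> x) y y'" "collinear X y' z" "jump (\<pi> x) z x'"
      using w by (auto simp: walk_Suc walk_0)
    have z: "z = x'" using jump_fixes[OF h(4) x'] .
    show ?thesis using digon[OF h(1) h(3)[unfolded z] x' jump_eq[OF h(2)]] .
  next
    case 4
    then obtain y y' z z' v
      where h: "collinear X x y" "jump (\<pi> x) y y'" "collinear X y' z" "jump (\<pi> x) z z'"
      "collinear X z' v" "jump (\<pi> x) v x'"
      using w by (auto simp: walk_Suc walk_0)
    have v: "v = x'" using jump_fixes[OF h(6) x'] .
    show ?thesis using triangle[OF h(1,3) h(5)[unfolded v] x' jump_eq[OF h(2)] jump_eq[OF h(4)]] .
  next
    case 5
    then obtain y y' z z' v v' u where h: "collinear X x y" "jump (\<pi> x) y y'" "collinear X y' z"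
      "jump (\<pi> x) z z'" "collinear X z' v" "jump (\<pi> x) v v'" "collinear X v' u" "jump (\<pi> x) u x'"
      using w by (auto simp: walk_Suc walk_0)
    have u: "u = x'" using jump_fixes[OF h(8) x'] .
    show ?thesis
    proof (cases "\<pi> z = \<pi> x")
      \<comment> \<open>Halfway the walk is back in the class of \<open>x\<close>, where no proper
        jump is allowed, so it splits into two digons based at \<open>x\<close>.\<close>
      case True
      have z': "z = z'" using jump_fixes[OF h(4)] jump_eq[OF h(4)] True by simp
      have z: "z = x" using digon[OF h(1,3) True jump_eq[OF h(2)]] .
      show ?thesis using digon[OF h(5) h(7)[unfolded u] _ jump_eq[OF h(6)]] x' z z' by simp
    next
      case False
      show ?thesis
        using quadrangle[OF h(1,3,5) h(7)[unfolded u] x' jump_eq[OF h(2)] jump_eq[OF h(4)] jump_eq[OF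
          h(6)]
            False[symmetric]] .
    qed
  qed
qed

text \<open>Legs of any lengths with total at most 4 are merged into a single walk of that many
  steps, to which \<open>closed_walk\<close> applies.\<close>

lemma jump_distance_ge:
  assumes p: "\<pi> p1 = \<pi> p2" "p1 \<noteq> p2"
    and eq: "\<pi> q1 = \<pi> q2" "\<pi> r1 = \<pi> r2" "\<pi> s1 = \<pi> s2"
    and ne: "\<pi> q1 \<noteq> \<pi> p2" "\<pi> r1 \<noteq> \<pi> p2" "\<pi> s1 \<noteq> \<pi> p2"
  shows "gdist X p2 q1 + gdist X q2 r1 + gdist X r2 s1 + gdist X s2 p1 \<ge> 5"
proof (rule ccontr)
  assume "\<not> ?thesis"
  then have lt: "gdist X p2 q1 + gdist X q2 r1 + gdist X r2 s1 + gdist X s2 p1 < 5" by simp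
  then obtain a b c d where d: "gdist X p2 q1 = enat a" "gdist X q2 r1 = enat b" "gdist X r2 s1 = enat c"
    "gdist X s2 p1 = enat d"
    by (cases "gdist X p2 q1"; cases "gdist X q2 r1"; cases "gdist X r2 s1"; cases "gdist X s2 p1") auto
  then have le: "a + b + c + d \<le> 4" using lt by (simp add: numeral_eq_enat)
  let ?c = "\<pi> p2"
  \<comment> \<open>A jump is absorbed only by a walk that has made a step. The first leg is
    nontrivial because it leaves the class of \<open>p2\<close>, and this serves all later
    jumps.\<close>
  have "a \<noteq> 0" using gdist_relpowp[OF d(1)] ne(1) by (cases a) auto
  have "walk ?c a p2 q1" using walk_append[of ?c 0 p2 p2 a q1] gdist_relpowp[OF d(1)]
    by (simp add: walk_0)
  then have "walk ?c a p2 q2" using walk_jump[OF \<open>a \<noteq> 0\<close>] eq ne unfolding jump_def by blast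
  then have "walk ?c (a + b) p2 r1" using walk_append gdist_relpowp[OF d(2)] by blast
  then have "walk ?c (a + b) p2 r2" using walk_jump[of "a + b"] \<open>a \<noteq> 0\<close> eq ne unfolding jump_def by blast
  then have "walk ?c (a + b + c) p2 s1" using walk_append gdist_relpowp[OF d(3)] by blast
  then have "walk ?c (a + b + c) p2 s2" using walk_jump[of "a + b + c"] \<open>a \<noteq> 0\<close> eq ne unfolding jump_def
    by blast
  then have "walk ?c (a + b + c + d) p2 p1" using walk_append gdist_relpowp[OF d(4)] by blast
  then show False using closed_walk le p by blast
qed

end

text \<open>In a triangle \<open>p\<close>, \<open>u\<close>, \<open>v\<close> the third side is
  linked to \<open>M\<close> at \<open>u\<close> and to \<open>N\<close> at \<open>v\<close>. The
  lifts of \<open>u\<close> along \<open>M\<close> and of \<open>v\<close> along \<open>N\<close>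
  therefore lie on the lift of that side, and the triangle lifts.\<close>

lemma (in pre_parapolar) lift_links:
  assumes K: "line_closed (unbuttoned G) K" and L: "(link G p)\<^sup>*\<^sup>* L M" "L \<in> lines G" "p \<in> L"
    and pK: "(p, germ G p L) \<in> K"
  shows "(link (induced_geometry (unbuttoned G) K) (p, germ G p L))\<^sup>*\<^sup>* (germ_lift G L) (germ_lift G M)"
  using L(1)
proof induction
  case (step M N)
  let ?H = "induced_geometry (unbuttoned G) K" and ?p = "(p, germ G p L)"
  obtain u v where M: "M \<in> lines G" "p \<in> M" and N: "N \<in> lines G" "p \<in> N"
    and uv: "u \<in> M" "v \<in> N" "u \<noteq> p" "v \<noteq> p" "u = v \<or> collinear G u v"
    using step(2) unfolding link_def by blast
  have "germ G p M = germ G p L" "germ G p N = germ G p L"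
    using links_germ_eq[OF step(1)] germ_eqI[OF step(2)] by simp_all
  then have p: "?p \<in> germ_lift G M" "?p \<in> germ_lift G N" using M N by (simp_all add: mem_germ_lift)
  have lines: "germ_lift G M \<in> lines ?H" "germ_lift G N \<in> lines ?H"
    using K p pK M N unfolding line_closed_def by auto
  define u' v' where uv': "u' = (u, germ G u M)" "v' = (v, germ G v N)"
  have mem: "u' \<in> germ_lift G M" "v' \<in> germ_lift G N" using uv uv' by (simp_all add: mem_germ_lift)
  have "u' = v' \<or> collinear ?H u' v'"
  proof (cases "u = v")
    case True
    have "link G u M N" unfolding link_def using M N uv True by metis
    then show ?thesis using germ_eqI[of G u M N] True uv' by simp
  next
    case False
    then obtain A where A: "A \<in> lines G" "u \<in> A" "v \<in> A" using uv(5) unfolding collinear_def by blast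
    have "collinear G p u" "collinear G p v" using M N uv unfolding collinear_def by blast+
    then have "\<exists>a\<in>M. \<exists>b\<in>A. a \<noteq> u \<and> b \<noteq> u \<and> (a = b \<or> collinear G a b)"
      "\<exists>a\<in>N. \<exists>b\<in>A. a \<noteq> v \<and> b \<noteq> v \<and> (a = b \<or> collinear G a b)"
      using \<open>collinear G p u\<close> \<open>collinear G p v\<close> A(2,3) M(2) N(2) uv(3,4) False
      by (intro bexI[of _ p] bexI[of _ v] bexI[of _ u]; simp)+
    then have um: "link G u M A" and vn: "link G v N A"
      using A M(1) N(1) uv(1,2) unfolding link_def by simp_all
    have "germ G u M = germ G u A" "germ G v N = germ G v A" using germ_eqI[OF um] germ_eqI[OF vn]
      by simp_all
    then have A': "u' \<in> germ_lift G A" "v' \<in> germ_lift G A" using A uv' by (simp_all add: mem_germ_lift)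
    have "u' \<in> K" using lines(1) mem(1) by auto
    then have "germ_lift G A \<in> lines ?H" using K A A' unfolding line_closed_def by auto
    then show ?thesis using A' False uv' unfolding collinear_def by blast
  qed
  then have "link ?H ?p (germ_lift G M) (germ_lift G N)"
    unfolding link_def using lines p mem uv uv' by blast
  then show ?case using step.IH by (rule rtranclp.rtrancl_into_rtrancl[rotated])
qed simp

context pre_parapolar
begin

section \<open>The sheets and the button conditions\<close>

abbreviation "sheet x \<equiv> induced_geometry (unbuttoned G) (component (unbuttoned G) x)"

interpretation U: unbuttoning "unbuttoned G" G fst
  by (rule unbuttoning_unbuttoned)

lemma sheet_pre_parapolar:
  assumes "x \<in> points (unbuttoned G)"
  shows "pre_parapolar (sheet x)"
  using pre_parapolar_induced[OF U.pre_parapolar_lift component_line_closed[OF U.plgX assms]]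
    pre_parapolar_axioms by blast

text \<open>Lifted lines with a common point have equal germs there, so a chain of links joins them
  in \<open>G\<close>, and \<open>lift_links\<close> keeps this chain in the sheet.\<close>

lemma sheet_locally_connected:
  assumes x: "x \<in> points (unbuttoned G)"
  shows "locally_connected (sheet x)"
proof (rule pre_parapolar.locally_connected_of_links[OF sheet_pre_parapolar[OF x]])
  fix p A B assume h: "A \<in> lines (sheet x)" "B \<in> lines (sheet x)" "p \<in> A" "p \<in> B"
  then obtain L M where L: "L \<in> lines G" "A = germ_lift G L" and M: "M \<in> lines G" "B = germ_lift G M"
    by auto
  then have p: "fst p \<in> L" "p = (fst p, germ G (fst p) L)" "germ G (fst p) L = germ G (fst p) M"
    using h by (auto simp: mem_germ_lift prod_eq_iff)
  have "p \<in> component (unbuttoned G) x" using h by auto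
  then show "(link (sheet x) p)\<^sup>*\<^sup>* A B"
    using lift_links[OF component_line_closed[OF U.plgX x] germ_eq_links[OF p(3)] L(1) p(1)] p(2) L M
      by simp
qed

lemma sheet_lacunary_class:
  assumes x: "x \<in> points (unbuttoned G)" and k: "k \<ge> 1" and lac: "lacunary k G"
  shows "lacunary_class k (sheet x)" "polar_space (sheet x) \<or> parapolar_space (sheet x)"
    "symplectic_rank_at_least 2 (sheet x)"
proof -
  let ?H = "sheet x"
  interpret H: pre_parapolar ?H using sheet_pre_parapolar[OF x] .
  note closed = component_line_closed[OF U.plgX x]
  have lacH: "lacunary k ?H"
    using lacunary_induced[OF U.plgX closed] U.lacunary_iff[OF k] lac by blast
  have rank: "symplectic_rank_at_least 3 ?H"
    using H.rank_three symplecton_iff_symp[OF H.plg] unfolding symplectic_rank_at_least_def by blast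
  then show "symplectic_rank_at_least 2 ?H"
    using polar_rank_at_least_mono[of _ 3 2] unfolding symplectic_rank_at_least_def by auto
  have ne: "points ?H \<noteq> {}" using component_self[of x "unbuttoned G"] by auto
  have "lacunary_class k ?H \<and> (polar_space ?H \<or> parapolar_space ?H)"
  proof (cases "\<exists>L\<in>lines ?H. \<exists>p\<in>points ?H. p \<notin> L \<and> (\<forall>y\<in>L. \<not> collinear ?H p y)")
    case True
    then have "parapolar_space ?H"
      using H.parapolar_of_far_line[OF connected_component[OF U.plgX x]] by blast
    then show ?thesis
      unfolding lacunary_class_def using rank lacH sheet_locally_connected[OF x] by blast
  next
    case False
    then have S: "symp ?H (points ?H)" using H.near_lines_symp[OF ne] by blast
    have eq: "induced_geometry ?H (points ?H) = ?H" using induced_points[OF H.plg] .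
    have "polar_space_of_rank_at_least ?H 3" using H.rank_three[OF S] by (simp only: eq)
    moreover have "polar_space_of_rank_at_least ?H (k + 1)"
      using lacH S eq symplecton_iff_symp[OF H.plg, of "points ?H"]
      unfolding lacunary_def symplectic_rank_at_least_def by metis
    ultimately have "polar_space_of_rank_at_least ?H (max 3 (k + 1))" by (simp add: max_def)
    then show ?thesis
      using symp_points_polar[OF S H.plg] unfolding lacunary_class_def by blast
  qed
  then show "lacunary_class k ?H" "polar_space ?H \<or> parapolar_space ?H" by auto
qed

definition sheets :: "('a \<times> 'a set set) geometry set" where
  "sheets = sheet ` points (unbuttoned G)"

definition same_fst :: "(('a \<times> 'a set set) \<times> ('a \<times> 'a set set)) set" where
  "same_fst = {(x, y). x \<in> points (unbuttoned G) \<and> y \<in> points (unbuttoned G) \<and> fst x = fst y}"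

lemma union_sheets: "union_geometry sheets = unbuttoned G"
proof -
  let ?U = "unbuttoned G"
  have "(\<Union>x\<in>points ?U. component ?U x) = points ?U"
  proof
    show "(\<Union>x\<in>points ?U. component ?U x) \<subseteq> points ?U"
      using component_subset[OF U.plgX] by (rule UN_least)
    show "points ?U \<subseteq> (\<Union>x\<in>points ?U. component ?U x)"
    proof
      fix x assume "x \<in> points ?U"
      then show "x \<in> (\<Union>x\<in>points ?U. component ?U x)" using component_self by (rule UN_I)
    qed
  qed
  then have "points (union_geometry sheets) = points ?U"
    unfolding union_geometry_def sheets_def by (simp del: unbuttoned_simps)
  moreover have "L \<in> lines (union_geometry sheets)" if L: "L \<in> lines ?U" for L
  proof -
    obtain x where x: "x \<in> L" "x \<in> points ?U" using U.plgX L unfolding point_line_geometry_def by blast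
    have "L \<subseteq> component ?U x"
      using component_line_closed[OF U.plgX x(2)] component_self[of x ?U] L x(1)
        unfolding line_closed_def by blast
    then show ?thesis using L x(2) unfolding union_geometry_def sheets_def
      by (auto simp del: unbuttoned_simps)
  qed
  moreover have "lines (union_geometry sheets) \<subseteq> lines ?U"
    unfolding union_geometry_def sheets_def by (auto simp del: unbuttoned_simps)
  ultimately have "lines (union_geometry sheets) = lines ?U" by blast
  then show ?thesis using \<open>points (union_geometry sheets) = points ?U\<close>
    by (intro geometry.equality) simp_all
qed

lemma same_fst_equiv: "equiv (points (unbuttoned G)) same_fst"
  unfolding same_fst_def by (rule equivI) (auto simp: refl_on_def sym_def trans_def)

lemma same_fst_class: "x \<in> points (unbuttoned G) \<Longrightarrow> same_fst `` {x} = {y \<in> points (unbuttoned G). fst y =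
  fst x}"
  unfolding same_fst_def by auto

lemma sheets_C1: "button_C1 sheets same_fst"
  unfolding button_C1_def union_sheets Let_def
proof (intro ballI allI impI)
  let ?U = "unbuttoned G"
  fix P Q V W p1 p2 q1 q2 r1 r2 s1 s2
  assume PQ: "P \<in> points ?U // same_fst" "Q \<in> points ?U // same_fst" "V \<in> points ?U // same_fst"
    "W \<in> points ?U // same_fst" "P \<notin> {Q, V, W}"
    and mem: "p1 \<in> P" "p2 \<in> P" "q1 \<in> Q" "q2 \<in> Q" "r1 \<in> V" "r2 \<in> V" "s1 \<in> W" "s2 \<in> W" and ne: "p1 \<noteq> p2"
  have cls: "A = {y \<in> points ?U. fst y = fst a}" if A: "A \<in> points ?U // same_fst" and a: "a \<in> A" for A a
  proof -
    obtain x where x: "x \<in> points ?U" "A = same_fst `` {x}" using A by (rule quotientE)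
    then show ?thesis using a same_fst_class[OF x(1)] by simp
  qed
  have same: "fst a = fst b" if "a \<in> A" "b \<in> A" "A \<in> points ?U // same_fst" for a b A
    using cls[OF that(3,2)] that(1) by blast
  have diff: "fst a \<noteq> fst b"
    if "a \<in> A" "b \<in> B" "A \<in> points ?U // same_fst" "B \<in> points ?U // same_fst" "A \<noteq> B" for a b A B
    using cls[OF that(3,1)] cls[OF that(4,2)] that(5) by metis
  show "gdist ?U p2 q1 + gdist ?U q2 r1 + gdist ?U r2 s1 + gdist ?U s2 p1 \<ge> 5"
  proof (rule U.jump_distance_ge)
    show "fst p1 = fst p2" using same mem PQ by blast
    show "fst q1 = fst q2" using same mem PQ by blast
    show "fst r1 = fst r2" using same mem PQ by blast
    show "fst s1 = fst s2" using same mem PQ by blast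
    show "fst q1 \<noteq> fst p2" using diff[OF mem(3,2)] PQ by blast
    show "fst r1 \<noteq> fst p2" using diff[OF mem(5,2)] PQ by blast
    show "fst s1 \<noteq> fst p2" using diff[OF mem(7,2)] PQ by blast
  qed (rule ne)
qed

lemma sheets_C2:
  assumes conn: "connected_geometry G"
  shows "button_C2 sheets same_fst"
  unfolding button_C2_def
proof (intro ballI)
  let ?U = "unbuttoned G"
  let ?rel = "{(A, B). A \<in> sheets \<and> B \<in> sheets \<and> (\<exists>x\<in>points A. \<exists>y\<in>points B. (x, y) \<in> same_fst)}"
  have adj: "(sheet x, sheet y) \<in> ?rel" if "x \<in> points ?U" "y \<in> points ?U" "fst x = fst y" for x y
  proof -
    have "x \<in> points (sheet x)" "y \<in> points (sheet y)" using component_self by auto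
    moreover have "(x, y) \<in> same_fst" using that unfolding same_fst_def by simp
    ultimately show ?thesis using that unfolding sheets_def by blast
  qed
  \<comment> \<open>Each edge of a path in \<open>G\<close> lifts into a single sheet; sheets are
    changed only between points above the same vertex.\<close>
  have walk: "(sheet x, sheet y) \<in> ?rel\<^sup>*"
    if "(collinear G)\<^sup>*\<^sup>* u v" "x \<in> points ?U" "y \<in> points ?U" "fst x = u" "fst y = v" for u v x y
    using that(1,3,5)
  proof (induction arbitrary: y)
    case base
    then show ?case using adj[OF that(2)] that(4) by blast
  next
    case (step v w)
    obtain a b where ab: "collinear ?U a b" "fst a = v" "fst b = w" using U.lift_collinear[OF step(2)]
      by blast
    have pts: "a \<in> points ?U" "b \<in> points ?U" using collinear_points[OF U.plgX ab(1)] by auto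
    have "b \<in> component ?U a" using ab(1) unfolding component_def by blast
    then have ba: "sheet b = sheet a" using component_eq by metis
    have "fst b = fst y" using ab(3) step.prems(2) by simp
    from adj[OF pts(2) step.prems(1) this] have "(sheet a, sheet y) \<in> ?rel" unfolding ba .
    with step.IH[OF pts(1) ab(2)] show ?case by (rule rtrancl.rtrancl_into_rtrancl)
  qed
  fix A B assume "A \<in> sheets" "B \<in> sheets"
  then obtain x y where x: "x \<in> points ?U" "A = sheet x" and y: "y \<in> points ?U" "B = sheet y"
    unfolding sheets_def by blast
  have "fst x \<in> points G" "fst y \<in> points G"
    using x(1) y(1) line_points by (auto simp: mem_germ_lift)
  then obtain xs where "is_path G (fst x) xs (fst y)" using conn unfolding connected_geometry_def
    by blast
  then have "(collinear G)\<^sup>*\<^sup>* (fst x) (fst y)" using path_relpowp relpowp_imp_rtranclp by metis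
  then show "(A, B) \<in> ?rel\<^sup>*" using walk x y by blast
qed

lemma buttoned_isomorphic: "geometry_isomorphic G (buttoned_geometry sheets same_fst)"
proof -
  let ?U = "unbuttoned G"
  define f where "f p = {x \<in> points ?U. fst x = p}" for p
  have q: "same_fst `` {x} = f (fst x)" if "x \<in> points ?U" for x
    using same_fst_class[OF that] unfolding f_def .
  have above: "\<exists>x. x \<in> points ?U \<and> fst x = p" if p: "p \<in> points G" for p
  proof -
    obtain L where "L \<in> lines G" "p \<in> L" using point_line[OF p] by blast
    then have "(p, germ G p L) \<in> points ?U" by (auto simp: mem_germ_lift)
    then show ?thesis by (metis fst_conv)
  qed
  have "bij_betw f (points G) (points ?U // same_fst)"
    unfolding bij_betw_def
  proof
    show "inj_on f (points G)"
    proof (rule inj_onI)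
      fix p p' assume h: "p \<in> points G" "f p = f p'"
      obtain x where "x \<in> points ?U" "fst x = p" using above[OF h(1)] by blast
      then have "x \<in> f p'" using h(2) unfolding f_def by blast
      then show "p = p'" using \<open>fst x = p\<close> unfolding f_def by simp
    qed
    show "f ` points G = points ?U // same_fst"
    proof
      show "f ` points G \<subseteq> points ?U // same_fst"
      proof
        fix A assume "A \<in> f ` points G"
        then obtain p where p: "p \<in> points G" "A = f p" by blast
        obtain x where "x \<in> points ?U" "fst x = p" using above[OF p(1)] by blast
        then show "A \<in> points ?U // same_fst" using q[of x] quotientI[of x "points ?U" same_fst] p
          by simp
      qed
      show "points ?U // same_fst \<subseteq> f ` points G"
      proof
        fix A assume "A \<in> points ?U // same_fst"
        then obtain x where x: "x \<in> points ?U" "A = same_fst `` {x}" by (rule quotientE)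
        moreover have "fst x \<in> points G" using x(1) line_points by (auto simp: mem_germ_lift)
        ultimately show "A \<in> f ` points G" using q by blast
      qed
    qed
  qed
  moreover have "(\<lambda>x. same_fst `` {x}) ` germ_lift G L = f ` L" if "L \<in> lines G" for L
  proof -
    have "(\<lambda>x. same_fst `` {x}) ` germ_lift G L = (\<lambda>x. f (fst x)) ` germ_lift G L"
      using q that by (intro image_cong) auto
    also have "\<dots> = f ` fst ` germ_lift G L" by (simp add: image_image)
    finally show ?thesis using fst_germ_lift by metis
  qed
  then have "(\<lambda>L. (\<lambda>x. same_fst `` {x}) ` L) ` lines ?U = image f ` lines G"
    by (simp add: image_image)
  ultimately show ?thesis
    unfolding geometry_isomorphic_def buttoned_geometry_def union_sheets
      by (auto simp: Setcompr_eq_image)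
qed

lemma lacunary_buttoned_over:
  assumes conn: "connected_geometry G" and ne: "points G \<noteq> {}" and nlc: "\<not> locally_connected G"
    and k: "k \<ge> 1" and lac: "lacunary k G"
  shows "buttoned_over (lacunary_class k :: ('a \<times> 'a set set) geometry \<Rightarrow> bool) G"
proof -
  let ?U = "unbuttoned G"
  have cls: "lacunary_class k H" if "H \<in> sheets" for H
    using that sheet_lacunary_class(1)[OF _ k lac] unfolding sheets_def by blast
  have "disjoint_family_of_sheets sheets"
    unfolding disjoint_family_of_sheets_def
  proof (intro conjI ballI impI)
    obtain L where L: "L \<in> lines G" using ne point_line by blast
    obtain x where "x \<in> L" using line_two[OF L] by blast
    then have "(x, germ G x L) \<in> points ?U" using L by (auto simp: mem_germ_lift)
    then show "sheets \<noteq> {}" unfolding sheets_def by blast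
    show "polar_space H \<or> parapolar_space H" if "H \<in> sheets" for H
      using that sheet_lacunary_class(2)[OF _ k lac] unfolding sheets_def by blast
    show "locally_connected H" if "H \<in> sheets" for H
      using that sheet_locally_connected unfolding sheets_def by blast
    show "symplectic_rank_at_least 2 H" if "H \<in> sheets" for H
      using that sheet_lacunary_class(3)[OF _ k lac] unfolding sheets_def by blast
    fix A B assume AB: "A \<in> sheets" "B \<in> sheets" "A \<noteq> B"
    then obtain x y where x: "A = sheet x" and y: "B = sheet y" unfolding sheets_def by blast
    show "points A \<inter> points B = {}"
    proof (rule ccontr)
      assume "points A \<inter> points B \<noteq> {}"
      then obtain z where "z \<in> component ?U x" "z \<in> component ?U y" using x y by auto
      then show False using component_eq AB(3) x y by metis
    qed
  qed
  then have "buttoning sheets same_fst"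
    unfolding buttoning_def union_sheets using same_fst_equiv sheets_C1 sheets_C2[OF conn] by blast
  \<comment> \<open>With a trivial relation every point would carry a single germ, so all lines
    through it would be linked, contrary to local disconnectedness.\<close>
  moreover have "\<exists>x y. (x, y) \<in> same_fst \<and> x \<noteq> y"
  proof (rule ccontr)
    assume trivial: "\<nexists>x y. (x, y) \<in> same_fst \<and> x \<noteq> y"
    have "locally_connected G"
    proof (rule locally_connected_of_links)
      fix p L M assume h: "L \<in> lines G" "M \<in> lines G" "p \<in> L" "p \<in> M"
      then have "((p, germ G p L), (p, germ G p M)) \<in> same_fst"
        unfolding same_fst_def by (auto simp: mem_germ_lift)
      then have "germ G p L = germ G p M" using trivial by blast
      then show "(link G p)\<^sup>*\<^sup>* L M" by (rule germ_eq_links)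
    qed
    then show False using nlc by blast
  qed
  ultimately show ?thesis
    unfolding buttoned_over_def using cls buttoned_isomorphic by blast
qed

end

text \<open>Sufficiency is proved for sheets over an arbitrary point type, while necessity
  constructs sheets whose points pair a point of \<open>\<Omega>\<close> with a germ.\<close>

theorem theoremA12:
  fixes k :: nat and \<Omega> :: "'a geometry"
  assumes "k \<ge> 1"
    and "parapolar_space \<Omega>"
    and "\<not> locally_connected \<Omega>"
    and "symplectic_rank_at_least 3 \<Omega>"
  shows "(lacunary k \<Omega> \<longleftrightarrow>
            buttoned_over (lacunary_class k :: ('a \<times> 'a set set) geometry \<Rightarrow> bool) \<Omega>) \<and>
         (buttoned_over (lacunary_class k :: 'b geometry \<Rightarrow> bool) \<Omega> \<longrightarrow> lacunary k \<Omega>)"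
proof -
  interpret pre_parapolar \<Omega> using parapolar_pre_parapolar assms by blast
  have "connected_geometry \<Omega>" "points \<Omega> \<noteq> {}" using assms(2) unfolding parapolar_space_def by auto
  then have "lacunary k \<Omega> \<Longrightarrow> buttoned_over (lacunary_class k :: ('a \<times> 'a set set) geometry \<Rightarrow> bool) \<Omega>"
    using lacunary_buttoned_over assms(1,3) by simp
  moreover have "buttoned_over (lacunary_class k :: ('a \<times> 'a set set) geometry \<Rightarrow> bool) \<Omega> \<Longrightarrow> lacunary k \<Omega>"
    using buttoned_over_lacunary[OF assms(1) plg] .
  moreover have "buttoned_over (lacunary_class k :: 'b geometry \<Rightarrow> bool) \<Omega> \<Longrightarrow> lacunary k \<Omega>"
    using buttoned_over_lacunary[OF assms(1) plg] .
  ultimately show ?thesis by blast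
qed

end
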